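(* Let $K,E>0$ and consider the spatial fiber of the Anti-de Sitter Schwarzschild spacetime $(M^3,g_{K,E})$, written as a warped product $M=[\widehat s,\infty)\times\mathbb{S}^2$ with metric $g_{K,E}=ds^2+r(s)^2(d\theta^2+\sin^2\theta\,d\phi^2)$. Then the family $\{\Omega_s\}_{s\in(\widehat s,\infty)}$, where $\Omega_s=(\widehat s,s)\times\mathbb{S}^2$, is locally rigid at every $s>\widehat s$.
   Context: The metric. Let $\psi_{K,E}(r)=\sqrt{1-2K/r+Er^2}$ and $$g_{K,E}=\psi_{K,E}(r)^{-2}dr^2+r^2(d\theta^2+\sin^2\theta\,d\phi^2)$$ on $(\widehat r,\infty)\times\mathbb{S}^2$, where $\widehat r$ is the only positive zero of $\psi_{K,E}$ (for $K,E>0$). The metric extends smoothly to $[\widehat r,\infty)\times\mathbb{S}^2$. The change of variable $ds=\psi_{K,E}(r)^{-1}dr$, with $s=\widehat s$ corresponding to $r=\widehat r$, gives the warped form $g_{K,E}=ds^2+r(s)^2(d\theta^2+\sin^2\theta\,d\phi^2)$ on $[\widehat s,\infty)\times\mathbb{S}^2$. Variational setting. The boundary of $\Omega_s$ consists of a fixed part $\{\widehat s\}\times\mathbb{S}^2$, which is not varied, and the constant mean curvature sphere $\{s\}\times\mathbb{S}^2$. One considers $\mathcal{F}^\lambda(\Omega)=\mathrm{Area}+\lambda\,\mathrm{Vol}(\Omega)$ under volume-preserving normal variations of the second part only; critical points are the sets whose varied boundary part has constant mean curvature. Bifurcation and rigidity. $s_*$ is a bifurcation point if there are sequences $\sigma_k\to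 s_*$ and surfaces $S_k\to\{s_*\}\times\mathbb{S}^2$ such that each $S_k$ has constant mean curvature, the signed volume enclosed between $S_k$ and $\{\sigma_k\}\times\mathbb{S}^2$ is zero, and $S_k\ne\{\sigma_k\}\times\mathbb{S}^2$ for all $k$. Convergence means that, for large $k$, $S_k$ is the graph $\{(u_k(x),x):x\in\mathbb{S}^2\}$ with $u_k\to s_*$ in $C^{2,\beta}(\mathbb{S}^2)$ for some fixed $\beta\in(0,1)$. The family is locally rigid at $s_*$ if $s_*$ is not a bifurcation point. *)

theory Defs
  imports "HOL-Analysis.Analysis"
begin

section \<open>Riemannian geometry in coordinates\<close>

definition pd :: "'n::finite \<Rightarrow> (real ^ 'n \<Rightarrow> 'b::real_normed_vector) \<Rightarrow> real ^ 'n \<Rightarrow> 'b" where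
  "pd i f p = frechet_derivative f (at p) (axis i 1)"

definition ginner :: "(real ^ 'n \<Rightarrow> real ^ 'n ^ 'n) \<Rightarrow> real ^ 'n \<Rightarrow> real ^ 'n \<Rightarrow> real ^ 'n \<Rightarrow> real" where
  "ginner G p v w = v \<bullet> (G p *v w)"

definition christoffel ::
    "(real ^ 'n \<Rightarrow> real ^ 'n ^ 'n) \<Rightarrow> real ^ 'n \<Rightarrow> 'n::finite \<Rightarrow> 'n \<Rightarrow> 'n \<Rightarrow> real" where
  "christoffel G p k i j = (1/2) * (\<Sum>l\<in>UNIV. matrix_inv (G p) $ k $ l *
     (pd i (\<lambda>q. G q $ j $ l) p + pd j (\<lambda>q. G q $ i $ l) p - pd l (\<lambda>q. G q $ i $ j) p))"

text \<open>For a parametrised surface \<open>X\<close> this is the Levi-Civita covariant derivative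
  of \<open>\<partial>\<^sub>b X\<close> in the direction \<open>\<partial>\<^sub>a X\<close>.\<close>

definition cov_deriv ::
    "(real ^ 3 \<Rightarrow> real ^ 3 ^ 3) \<Rightarrow> (real ^ 2 \<Rightarrow> real ^ 3) \<Rightarrow> real ^ 2 \<Rightarrow> 2 \<Rightarrow> 2 \<Rightarrow> real ^ 3" where
  "cov_deriv G X q a b = (\<chi> k. pd a (pd b X) q $ k +
     (\<Sum>i\<in>UNIV. \<Sum>j\<in>UNIV. christoffel G (X q) k i j * pd a X q $ i * pd b X q $ j))"

text \<open>The Euclidean cross product of the tangent vectors is a covector annihilating the
  tangent plane; raising its index with the inverse metric gives a \<open>G\<close>-normal vector.\<close>

definition unit_normal ::
    "(real ^ 3 \<Rightarrow> real ^ 3 ^ 3) \<Rightarrow> (real ^ 2 \<Rightarrow> real ^ 3) \<Rightarrow> real ^ 2 \<Rightarrow> real ^ 3" where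
  "unit_normal G X q =
     (let n = matrix_inv (G (X q)) *v cross3 (pd 1 X q) (pd 2 X q)
      in n /\<^sub>R sqrt (ginner G (X q) n n))"

definition first_form ::
    "(real ^ 3 \<Rightarrow> real ^ 3 ^ 3) \<Rightarrow> (real ^ 2 \<Rightarrow> real ^ 3) \<Rightarrow> real ^ 2 \<Rightarrow> real ^ 2 ^ 2" where
  "first_form G X q = (\<chi> a b. ginner G (X q) (pd a X q) (pd b X q))"

text \<open>The sign is chosen such that a round sphere with its outward normal has positive
  mean curvature. The mean curvature is the trace (not the average) of the second
  fundamental form.\<close>

definition second_form ::
    "(real ^ 3 \<Rightarrow> real ^ 3 ^ 3) \<Rightarrow> (real ^ 2 \<Rightarrow> real ^ 3) \<Rightarrow> real ^ 2 \<Rightarrow> real ^ 2 ^ 2" where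
  "second_form G X q = (\<chi> a b. - ginner G (X q) (cov_deriv G X q a b) (unit_normal G X q))"

definition mean_curvature ::
    "(real ^ 3 \<Rightarrow> real ^ 3 ^ 3) \<Rightarrow> (real ^ 2 \<Rightarrow> real ^ 3) \<Rightarrow> real ^ 2 \<Rightarrow> real" where
  "mean_curvature G X q = trace (matrix_inv (first_form G X q) ** second_form G X q)"

section \<open>The spatial fiber of Anti-de Sitter Schwarzschild spacetime\<close>

definition psi :: "real \<Rightarrow> real \<Rightarrow> real \<Rightarrow> real" where
  "psi K E r = sqrt (1 - 2 * K / r + E * r\<^sup>2)"

definition rhat :: "real \<Rightarrow> real \<Rightarrow> real" where
  "rhat K E = (THE r. 0 < r \<and> psi K E r = 0)"

text \<open>The integrand has an integrable singularity at \<open>rhat K E\<close>.\<close>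

definition s_of_r :: "real \<Rightarrow> real \<Rightarrow> real \<Rightarrow> real \<Rightarrow> real" where
  "s_of_r K E shat r = shat + integral {rhat K E..r} (\<lambda>\<rho>. 1 / psi K E \<rho>)"

definition r_of_s :: "real \<Rightarrow> real \<Rightarrow> real \<Rightarrow> real \<Rightarrow> real" where
  "r_of_s K E shat = inv_into {rhat K E..} (s_of_r K E shat)"

text \<open>The matrix of \<open>ds\<^sup>2 + r(s)\<^sup>2 (d\<theta>\<^sup>2 + sin\<^sup>2 \<theta> d\<phi>\<^sup>2)\<close> in the coordinates \<open>(s, \<theta>, \<phi>)\<close>.\<close>

definition adss_metric :: "real \<Rightarrow> real \<Rightarrow> real \<Rightarrow> real ^ 3 \<Rightarrow> real ^ 3 ^ 3" where
  "adss_metric K E shat p =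
     vector [vector [1, 0, 0],
             vector [0, (r_of_s K E shat (p $ 1))\<^sup>2, 0],
             vector [0, 0, (r_of_s K E shat (p $ 1))\<^sup>2 * (sin (p $ 2))\<^sup>2]]"

definition sph :: "real \<Rightarrow> real \<Rightarrow> real ^ 3" where
  "sph \<theta> \<phi> = vector [sin \<theta> * cos \<phi>, sin \<theta> * sin \<phi>, cos \<theta>]"

section \<open>Graphs over the sphere\<close>

text \<open>Points of \<open>M\<close> are pairs \<open>(s, x)\<close> with \<open>s \<ge> shat\<close> and \<open>x\<close> in the unit sphere of
  \<open>\<real>\<^sup>3\<close>. A function on the sphere is a function on \<open>\<real>\<^sup>3\<close> of which only the values
  on \<open>sphere 0 1\<close> are used.\<close>

definition slice :: "real \<Rightarrow> (real \<times> (real ^ 3)) set" where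
  "slice s = {s} \<times> sphere 0 1"

definition sphere_graph :: "(real ^ 3 \<Rightarrow> real) \<Rightarrow> (real \<times> (real ^ 3)) set" where
  "sphere_graph u = {(u x, x) | x. x \<in> sphere 0 1}"

text \<open>The graph of \<open>u\<close> in spherical coordinates relative to the positively oriented
  orthonormal frame given by the columns of \<open>A\<close>. The metric has the same expression in all
  these coordinate systems, and together they cover the sphere, including the poles of
  any single one of them.\<close>

definition graph_param :: "(real ^ 3 \<Rightarrow> real) \<Rightarrow> real ^ 3 ^ 3 \<Rightarrow> real ^ 2 \<Rightarrow> real ^ 3" where
  "graph_param u A q = vector [u (A *v sph (q $ 1) (q $ 2)), q $ 1, q $ 2]"

definition cmc_graph :: "real \<Rightarrow> real \<Rightarrow> real \<Rightarrow> (real ^ 3 \<Rightarrow> real) \<Rightarrow> bool" where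
  "cmc_graph K E shat u \<longleftrightarrow>
     (\<exists>c. \<forall>A \<theta> \<phi>. rotation_matrix A \<and> 0 < \<theta> \<and> \<theta> < pi \<longrightarrow>
        mean_curvature (adss_metric K E shat) (graph_param u A) (vector [\<theta>, \<phi>]) = c)"

text \<open>The innermost integral is oriented: regions where \<open>u < \<sigma>\<close> count negatively.\<close>

definition signed_volume :: "real \<Rightarrow> real \<Rightarrow> real \<Rightarrow> real \<Rightarrow> (real ^ 3 \<Rightarrow> real) \<Rightarrow> real" where
  "signed_volume K E shat \<sigma> u =
     (LBINT \<phi>=ereal 0..ereal (2 * pi). (LBINT \<theta>=ereal 0..ereal pi.
        (LBINT t=ereal \<sigma>..ereal (u (sph \<theta> \<phi>)).
          sqrt (det (adss_metric K E shat (vector [t, \<theta>, \<phi>]))))))"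

section \<open>The Hoelder space of order 2 on the sphere\<close>

text \<open>Derivatives on the sphere are those of the 0-homogeneous extension to
  \<open>\<real>\<^sup>3 - {0}\<close>. At a point of the sphere its first derivative is the intrinsic gradient; its
  second derivative is the intrinsic Hessian on tangent vectors, while the remaining
  entries are first-order terms. So the norm below is equivalent to the usual one.\<close>

definition hom_ext :: "(real ^ 3 \<Rightarrow> real) \<Rightarrow> real ^ 3 \<Rightarrow> real" where
  "hom_ext f y = f (sgn y)"

definition C2_holder :: "real \<Rightarrow> (real ^ 3 \<Rightarrow> real) \<Rightarrow> bool" where
  "C2_holder \<beta> f \<longleftrightarrow>
     (\<forall>y. y \<noteq> 0 \<longrightarrow> hom_ext f differentiable at y) \<and>
     (\<forall>j y. y \<noteq> 0 \<longrightarrow> pd j (hom_ext f) differentiable at y) \<and>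
     (\<exists>C. \<forall>i j. \<forall>x\<in>sphere 0 1. \<forall>y\<in>sphere 0 1.
        \<bar>pd i (pd j (hom_ext f)) x - pd i (pd j (hom_ext f)) y\<bar> \<le> C * dist x y powr \<beta>)"

definition C2_holder_norm :: "real \<Rightarrow> (real ^ 3 \<Rightarrow> real) \<Rightarrow> real" where
  "C2_holder_norm \<beta> f =
     (SUP x\<in>sphere 0 1. \<bar>f x\<bar>) +
     (\<Sum>j\<in>UNIV. SUP x\<in>sphere 0 1. \<bar>pd j (hom_ext f) x\<bar>) +
     (\<Sum>i\<in>UNIV. \<Sum>j\<in>UNIV. SUP x\<in>sphere 0 1. \<bar>pd i (pd j (hom_ext f)) x\<bar>) +
     (\<Sum>i\<in>UNIV. \<Sum>j\<in>UNIV. SUP (x, y)\<in>{(x, y). x \<in> sphere 0 1 \<and> y \<in> sphere 0 1 \<and> x \<noteq> y}.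
        \<bar>pd i (pd j (hom_ext f)) x - pd i (pd j (hom_ext f)) y\<bar> / dist x y powr \<beta>)"

section \<open>Bifurcation and rigidity\<close>

text \<open>The sphere \<open>slice s\<close> is the varied part of the boundary of
  \<open>\<Omega>\<^sub>s = {shat<..<s} \<times> sphere 0 1\<close>. Since only the tail of the sequence of surfaces
  matters, all of them are taken to be graphs.\<close>

definition bifurcation_point :: "real \<Rightarrow> real \<Rightarrow> real \<Rightarrow> real \<Rightarrow> bool" where
  "bifurcation_point K E shat s \<longleftrightarrow>
     (\<exists>\<beta> \<sigma> u. 0 < \<beta> \<and> \<beta> < 1 \<and>
        (\<forall>k::nat. shat < \<sigma> k) \<and> \<sigma> \<longlonglongrightarrow> s \<and>
        (\<forall>k. C2_holder \<beta> (u k) \<and> (\<forall>x\<in>sphere 0 1. shat < u k x)) \<and>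
        (\<lambda>k. C2_holder_norm \<beta> (\<lambda>x. u k x - s)) \<longlonglongrightarrow> 0 \<and>
        (\<forall>k. cmc_graph K E shat (u k)) \<and>
        (\<forall>k. signed_volume K E shat (\<sigma> k) (u k) = 0) \<and>
        (\<forall>k. sphere_graph (u k) \<noteq> slice (\<sigma> k)))"

definition locally_rigid :: "real \<Rightarrow> real \<Rightarrow> real \<Rightarrow> real \<Rightarrow> bool" where
  "locally_rigid K E shat s \<longleftrightarrow> \<not> bifurcation_point K E shat s"

end

theory Submission imports Defs begin

text \<open>For a graph \<open>s = u\<close> over the sphere write \<open>N = sqrt (r(u)\<^sup>2 + |grad u|\<^sup>2)\<close>. The
  equation \<open>H = c\<close> has the divergence form \<open>div (grad u / N) = 2 r'(u) r(u) / N - c r(u)\<close>.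
  Testing it with \<open>1\<close> shows that \<open>c\<close> is close to \<open>2 r'(s) / r(s)\<close> if \<open>u\<close> is \<open>C\<^sup>1\<close>-close to \<open>s\<close>.
  Testing it with \<open>u - m\<close>, where \<open>m\<close> is the mean of \<open>u\<close>, then bounds
  the Dirichlet energy of \<open>u\<close> by about \<open>2 (r'\<^sup>2 - r r'')\<close> times the squared \<open>L\<^sup>2\<close> norm of \<open>u - m\<close>.
  Since \<open>r'\<^sup>2 - r r'' = 1 - 3 K / r < 1\<close>, this contradicts the Poincare inequality
  with the constant \<open>2\<close> of the round sphere unless \<open>u\<close> is constant, and then the volume
  constraint identifies the constant. No regularity beyond \<open>C\<^sup>2\<close> and no
  smallness beyond \<open>C\<^sup>1\<close> is needed.\<close>

section \<open>The warping function\<close>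

text \<open>How the constants meet: on the slice \<open>c = 2 r' / r\<close>, so
  \<open>2 r' - c r\<close> has derivative \<open>- 2 (r'^2 - r r'') / r\<close>, while the
  Dirichlet integrand enters with the weight \<open>1 / N\<close>, close to \<open>1 / r\<close>.
  The common factor \<open>1 / r\<close> drops out, and twice a number below 1 is compared with the
  eigenvalue 2. The margin \<open>3 K / r\<close> is positive at every radius because the mass
  \<open>K\<close> is. The nonlinear error is harmless because \<open>N\<close> differs from
  \<open>r\<close> only quadratically in the gradient: \<open>1 - r / N\<close> is at most
  \<open>|grad u|^2 / (r N)\<close>. Multiplied by the small \<open>u - m\<close>, it is absorbed by
  the Dirichlet integrand. So nothing is linearised in a function space, and a single surface of the
  sequence already gives the contradiction. The obstacle is the poles of spherical coordinates. The
  curvature equation is used in one chart and only between the poles, but all integrands are built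
  from Cartesian derivatives of the 0-homogeneous extension and are continuous on the closed
  coordinate rectangle. The eigenvalue 2 is obtained without spherical harmonics: in each
  one-dimensional inequality the integrand is a sum of squares plus the derivative of a boundary
  term.\<close>

lemma rhat_props:
  assumes "K > 0" "E > 0"
  shows "rhat K E > 0" "rhat K E - 2 * K + E * rhat K E ^ 3 = 0"
proof -
  define P where "P = (\<lambda>r::real. r - 2 * K + E * r ^ 3)"
  \<comment> \<open>Here \<open>sqrt\<close> is odd on the reals and vanishes only at 0, so a
    negative radicand creates no spurious zero of \<open>psi\<close>. Multiplying by
    \<open>r\<close> turns the radicand into a strictly increasing cubic, which makes the
    description by \<open>THE\<close> unique.\<close>
  have psi0: "psi K E r = 0 \<longleftrightarrow> P r = 0" if "r > 0" for r
  proof -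
    have "psi K E r = 0 \<longleftrightarrow> r * (1 - 2 * K / r + E * r\<^sup>2) = 0"
      using that by (simp add: psi_def)
    also have "r * (1 - 2 * K / r + E * r\<^sup>2) = P r"
      using that by (simp add: P_def field_simps power3_eq_cube power2_eq_square)
    finally show ?thesis .
  qed
  have mono: "P x < P y" if "0 \<le> x" "x < y" for x y
  proof -
    have "x ^ 3 \<le> y ^ 3" using that by (intro power_mono) auto
    then show ?thesis using that assms by (simp add: P_def add_less_le_mono)
  qed
  have "\<exists>x. 0 \<le> x \<and> x \<le> 2 * K \<and> P x = 0"
    using assms by (intro IVT') (auto simp: P_def intro!: continuous_intros)
  then obtain x where x: "0 \<le> x" "P x = 0" by auto
  have "x \<noteq> 0" using x assms by (auto simp: P_def)
  with x have x0: "x > 0" by simp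
  have "0 < rhat K E \<and> psi K E (rhat K E) = 0"
    unfolding rhat_def
  proof (rule theI)
    show "0 < x \<and> psi K E x = 0" using x0 x psi0 by simp
    show "y = x" if "0 < y \<and> psi K E y = 0" for y
      using that psi0[of y] mono[of x y] mono[of y x] x x0 by (cases y x rule: linorder_cases) auto
  qed
  then show "rhat K E > 0" "rhat K E - 2 * K + E * rhat K E ^ 3 = 0"
    using psi0 by (auto simp: P_def)
qed

context
  fixes K E shat :: real
  assumes K: "K > 0" and E: "E > 0"
begin

text \<open>The cubic \<open>r - 2 * K + E * r ^ 3\<close> vanishes at \<open>rhat K E\<close> and
  grows at least as fast as \<open>r\<close>. The resulting linear lower bound shows that
  \<open>1 / psi\<close> has at most an inverse square root singularity.\<close>

lemma psi_radicand_ge: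
  assumes "r \<ge> rhat K E"
  shows "1 - 2 * K / r + E * r\<^sup>2 \<ge> (r - rhat K E) / r"
proof -
  note h = rhat_props[OF K E]
  have r: "r > 0" using assms h by simp
  have "rhat K E ^ 3 \<le> r ^ 3" using assms h by (intro power_mono) auto
  then have "E * rhat K E ^ 3 \<le> E * r ^ 3" using E by simp
  then have "r - rhat K E \<le> r - 2 * K + E * r ^ 3" using h by simp
  also have "\<dots> = r * (1 - 2 * K / r + E * r\<^sup>2)"
    using r by (simp add: field_simps power3_eq_cube power2_eq_square)
  finally show ?thesis using r by (simp add: field_simps)
qed

lemma psi_pos:
  assumes "r > rhat K E"
  shows "psi K E r > 0"
proof -
  have "(r - rhat K E) / r > 0" using assms rhat_props[OF K E] by simp
  then show ?thesis using psi_radicand_ge[of r] assms by (simp add: psi_def)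
qed

lemma psi_squared:
  assumes "r > rhat K E"
  shows "(psi K E r)\<^sup>2 = 1 - 2 * K / r + E * r\<^sup>2"
  using psi_pos[OF assms] by (simp add: psi_def)

lemma psi_has_derivative:
  assumes "r > rhat K E"
  shows "(psi K E has_real_derivative (K / r\<^sup>2 + E * r) / psi K E r) (at r)"
proof -
  have "r > 0" using assms rhat_props[OF K E] by simp
  then show ?thesis
    using psi_pos[OF assms] unfolding psi_def
    by (auto intro!: derivative_eq_intros simp: field_simps power2_eq_square)
qed

lemma isCont_psi:
  assumes "r > rhat K E"
  shows "isCont (psi K E) r"
  using psi_has_derivative[OF assms] by (rule DERIV_isCont)

text \<open>Comparison with a multiple of \<open>1 / sqrt (x - R)\<close>, whose primitive
  \<open>2 * sqrt (x - R)\<close> is continuous up to the singular endpoint.\<close>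

lemma inverse_psi_integrable:
  assumes "rhat K E \<le> a"
  shows "(\<lambda>\<rho>. 1 / psi K E \<rho>) integrable_on {a..b}"
proof (cases "rhat K E \<le> b")
  case True
  define R where "R = rhat K E"
  have b: "b > 0" and R: "R > 0" using True rhat_props[OF K E] by (auto simp: R_def)
  have "((\<lambda>x. sqrt b * (1 / sqrt (x - R))) has_integral
      (sqrt b * (2 * sqrt (b - R)) - sqrt b * (2 * sqrt (R - R)))) {R..b}"
    using True by (intro fundamental_theorem_of_calculus_interior)
      (auto simp: R_def has_real_derivative_iff_has_vector_derivative[symmetric] field_simps
        intro!: derivative_eq_intros continuous_intros)
  then have maj: "(\<lambda>x. sqrt b * (1 / sqrt (x - R))) integrable_on {R..b}"
    by (rule has_integral_integrable)
  have "(\<lambda>\<rho>. 1 / psi K E \<rho>) integrable_on {R..b}"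
  proof (rule measurable_bounded_by_integrable_imp_integrable[OF _ maj])
    have "(\<lambda>\<rho>. 1 / psi K E \<rho>) \<in> borel_measurable lborel"
      unfolding psi_def by measurable
    then show "(\<lambda>\<rho>. 1 / psi K E \<rho>) \<in> borel_measurable (lebesgue_on {R..b})"
      by (intro measurable_restrict_space1 measurable_completion)
    show "norm (1 / psi K E x) \<le> sqrt b * (1 / sqrt (x - R))" if x: "x \<in> {R..b}" for x
    proof (cases "x = R")
      \<comment> \<open>At the horizon both sides of the bound are divisions by zero and hence equal
        to 0.\<close>
      case True
      have "psi K E R = 0"
        using rhat_props[OF K E]
        by (simp add: psi_def R_def field_simps power3_eq_cube power2_eq_square)
      then show ?thesis using True b by simp
    next
      case False
      then have x': "R < x" "x \<le> b" "x > 0" using x R by auto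
      have "(x - R) / b \<le> (x - R) / x" using x' b by (simp add: frac_le)
      also have "\<dots> \<le> 1 - 2 * K / x + E * x\<^sup>2"
        using psi_radicand_ge[of x] x' by (simp add: R_def)
      finally have "sqrt ((x - R) / b) \<le> psi K E x" by (simp add: psi_def)
      moreover have "sqrt ((x - R) / b) > 0" using x' b by simp
      ultimately have "1 / psi K E x \<le> 1 / sqrt ((x - R) / b)" by (intro frac_le) auto
      moreover have "psi K E x > 0" using x' psi_pos by (simp add: R_def)
      ultimately show ?thesis by (simp add: real_sqrt_divide)
    qed
  qed simp
  then show ?thesis
    by (rule integrable_on_subinterval) (use assms in \<open>auto simp: R_def\<close>)
next
  case False
  then show ?thesis using assms by (simp add: integrable_on_empty)
qed

lemma s_of_r_diff:
  assumes "rhat K E \<le> a" "a \<le> b"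
  shows "s_of_r K E shat b - s_of_r K E shat a = integral {a..b} (\<lambda>\<rho>. 1 / psi K E \<rho>)"
  using Henstock_Kurzweil_Integration.integral_combine[OF assms inverse_psi_integrable[of "rhat K E" b]]
  by (simp add: s_of_r_def)

text \<open>The integrand is unbounded near the lower limit, so the version of the fundamental
  theorem is used that asks for continuity at the upper limit only, together with
  integrability.\<close>

lemma s_of_r_has_derivative:
  assumes "r > rhat K E"
  shows "(s_of_r K E shat has_real_derivative 1 / psi K E r) (at r)"
proof -
  have "((\<lambda>u. integral {rhat K E..u} (\<lambda>\<rho>. 1 / psi K E \<rho>)) has_vector_derivative 1 / psi K E r)
    (at r within {rhat K E..r+1})"
    using assms isCont_psi[OF assms] psi_pos[OF assms]
    by (intro integral_has_vector_derivative_continuous_at[where S = "{}", simplified]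
        inverse_psi_integrable continuous_intros) (auto intro: continuous_at_imp_continuous_at_within)
  then have "((\<lambda>u. integral {rhat K E..u} (\<lambda>\<rho>. 1 / psi K E \<rho>)) has_real_derivative 1 / psi K E r)
    (at r within {rhat K E..r+1})"
    by (simp add: has_real_derivative_iff_has_vector_derivative)
  moreover have "at r within {rhat K E..r+1} = at r"
    by (rule at_within_interior) (use assms in auto)
  ultimately show ?thesis
    unfolding s_of_r_def by (auto intro!: derivative_eq_intros)
qed

lemma s_of_r_continuous_on: "continuous_on {rhat K E..b} (s_of_r K E shat)"
  unfolding s_of_r_def
  by (intro continuous_intros indefinite_integral_continuous_1 inverse_psi_integrable) simp

lemma s_of_r_strict_mono:
  assumes "rhat K E \<le> a" "a < b"
  shows "s_of_r K E shat a < s_of_r K E shat b"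
proof (rule DERIV_pos_imp_increasing_open[OF assms(2)])
  show "\<exists>y. DERIV (s_of_r K E shat) x :> y \<and> y > 0" if "a < x" "x < b" for x
    using s_of_r_has_derivative[of x] psi_pos[of x] that assms by force
  show "continuous_on {a..b} (s_of_r K E shat)"
    using s_of_r_continuous_on by (rule continuous_on_subset) (use assms in auto)
qed

lemma s_of_r_rhat: "s_of_r K E shat (rhat K E) = shat"
  by (simp add: s_of_r_def)

text \<open>For \<open>r \<ge> 1\<close> one has \<open>psi K E r \<le> sqrt (1 + E) * r\<close>, so
  arc length grows at least logarithmically. This makes \<open>r_of_s\<close> meaningful for every
  \<open>s > shat\<close>.\<close>

lemma s_of_r_unbounded: "\<exists>r\<ge>rhat K E. s_of_r K E shat r \<ge> x"
proof -
  define a where "a = max 1 (rhat K E + 1)"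
  \<comment> \<open>Chosen so that the minorant \<open>1 / (sqrt (1 + E) * \<rho>)\<close>
    integrates over \<open>{a..b}\<close> to exactly the missing amount.\<close>
  define b where "b = a * exp (sqrt (1 + E) * max 0 (x - s_of_r K E shat a))"
  have a: "1 \<le> a" "rhat K E \<le> a" "rhat K E < a" and ab: "a \<le> b"
    using E by (auto simp: a_def b_def mult_le_cancel_left1)
  have "((\<lambda>\<rho>. 1 / (sqrt (1 + E) * \<rho>)) has_integral (ln b / sqrt (1 + E) - ln a / sqrt (1 + E))) {a..b}"
  proof (rule fundamental_theorem_of_calculus[OF ab])
    fix x assume "x \<in> {a..b}"
    then have "((\<lambda>\<rho>. ln \<rho> / sqrt (1 + E)) has_real_derivative 1 / (sqrt (1 + E) * x)) (at x within {a..b})"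
      using a DERIV_cdivide[OF DERIV_ln_divide[of x], of "sqrt (1 + E)"]
      by (auto intro: has_field_derivative_at_within simp: mult.commute)
    then show "((\<lambda>\<rho>. ln \<rho> / sqrt (1 + E)) has_vector_derivative 1 / (sqrt (1 + E) * x)) (at x within {a..b})"
      by (simp add: has_real_derivative_iff_has_vector_derivative)
  qed
  moreover have "ln b / sqrt (1 + E) - ln a / sqrt (1 + E) = max 0 (x - s_of_r K E shat a)"
    using a E unfolding b_def by (simp add: ln_mult field_simps)
  ultimately have *: "((\<lambda>\<rho>. 1 / (sqrt (1 + E) * \<rho>)) has_integral max 0 (x - s_of_r K E shat a)) {a..b}"
    by simp
  have "max 0 (x - s_of_r K E shat a) \<le> integral {a..b} (\<lambda>\<rho>. 1 / psi K E \<rho>)"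
  proof (rule has_integral_le[OF *])
    show "((\<lambda>\<rho>. 1 / psi K E \<rho>) has_integral integral {a..b} (\<lambda>\<rho>. 1 / psi K E \<rho>)) {a..b}"
      using inverse_psi_integrable[OF a(2)] by (rule integrable_integral)
    show "1 / (sqrt (1 + E) * \<rho>) \<le> 1 / psi K E \<rho>" if \<rho>: "\<rho> \<in> {a..b}" for \<rho>
    proof -
      have p: "psi K E \<rho> > 0" using \<rho> a by (intro psi_pos) auto
      have "1 \<le> \<rho>\<^sup>2" using \<rho> a by (simp add: one_le_power)
      moreover have "2 * K / \<rho> \<ge> 0" using \<rho> a K by simp
      ultimately have "1 - 2 * K / \<rho> + E * \<rho>\<^sup>2 \<le> (1 + E) * \<rho>\<^sup>2" by (simp add: algebra_simps)
      then have "psi K E \<rho> \<le> sqrt ((1 + E) * \<rho>\<^sup>2)" by (simp add: psi_def)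
      also have "\<dots> = sqrt (1 + E) * \<rho>" using \<rho> a by (simp add: real_sqrt_mult)
      finally show ?thesis using p by (intro frac_le) auto
    qed
  qed
  then have "s_of_r K E shat b \<ge> x" using s_of_r_diff[OF a(2) ab] by simp
  then show ?thesis using a ab by (intro exI[of _ b]) auto
qed

section \<open>The warping function as inverse of arc length, and its first two derivatives\<close>

lemma r_of_s_inverse:
  assumes "s > shat"
  shows "r_of_s K E shat s > rhat K E" "s_of_r K E shat (r_of_s K E shat s) = s"
proof -
  obtain b where b: "b \<ge> rhat K E" "s_of_r K E shat b \<ge> s" using s_of_r_unbounded by blast
  obtain r where r: "rhat K E \<le> r" "s_of_r K E shat r = s"
    using IVT'[of "s_of_r K E shat" "rhat K E" s b] b assms s_of_r_continuous_on s_of_r_rhat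
    by auto
  then have mem: "s \<in> s_of_r K E shat ` {rhat K E..}" by auto
  show *: "s_of_r K E shat (r_of_s K E shat s) = s"
    unfolding r_of_s_def by (rule f_inv_into_f[OF mem])
  have "r_of_s K E shat s \<in> {rhat K E..}"
    unfolding r_of_s_def by (rule inv_into_into[OF mem])
  moreover have "r_of_s K E shat s \<noteq> rhat K E" using * s_of_r_rhat assms by auto
  ultimately show "r_of_s K E shat s > rhat K E" by auto
qed

lemma r_of_s_s_of_r:
  assumes "r \<ge> rhat K E"
  shows "r_of_s K E shat (s_of_r K E shat r) = r"
  unfolding r_of_s_def
proof (rule inv_into_f_f)
  show "inj_on (s_of_r K E shat) {rhat K E..}"
  proof (rule inj_onI)
    fix x y assume "x \<in> {rhat K E..}" "y \<in> {rhat K E..}" "s_of_r K E shat x = s_of_r K E shat y"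
    then show "x = y"
      using s_of_r_strict_mono[of x y] s_of_r_strict_mono[of y x]
      by (cases x y rule: linorder_cases) auto
  qed
qed (use assms in auto)

lemma r_of_s_pos:
  assumes "s > shat"
  shows "r_of_s K E shat s > 0"
  using r_of_s_inverse(1)[OF assms] rhat_props(1)[OF K E] by simp

lemma r_of_s_has_derivative:
  assumes "s > shat"
  shows "(r_of_s K E shat has_real_derivative psi K E (r_of_s K E shat s)) (at s)"
proof -
  let ?r = "r_of_s K E shat" and ?s = "s_of_r K E shat"
  have r: "?r s > rhat K E" "?s (?r s) = s" using r_of_s_inverse[OF assms] by auto
  have "isCont ?r (?s (?r s))"
  \<comment> \<open>The midpoint as left end keeps the interval away from \<open>rhat K E\<close>,
    where \<open>s_of_r\<close> is not known to be differentiable.\<close>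
  proof (rule isCont_inverse_function2[where a = "(rhat K E + ?r s) / 2" and b = "?r s + 1"
        and x = "?r s" and f = ?s and g = ?r])
    show "(rhat K E + ?r s) / 2 < ?r s" "?r s < ?r s + 1" using r by auto
    show "?r (?s z) = z" if "(rhat K E + ?r s) / 2 \<le> z" for z
      using that r by (intro r_of_s_s_of_r) auto
    show "isCont ?s z" if "(rhat K E + ?r s) / 2 \<le> z" for z
      using that r by (intro DERIV_isCont[OF s_of_r_has_derivative]) auto
  qed
  then have "isCont ?r s" using r by simp
  then have "DERIV ?r s :> inverse (1 / psi K E (?r s))"
    using psi_pos[OF r(1)] assms r
    by (intro DERIV_inverse_function[where f = ?s and a = shat and b = "s + 1"])
      (auto intro: r_of_s_inverse s_of_r_has_derivative)
  then show ?thesis by simp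
qed

text \<open>By the chain rule \<open>r''\<close> is \<open>psi\<close> times the derivative of
  \<open>psi\<close>, that is half the derivative of \<open>psi\<close> squared, so the square root
  cancels.\<close>

lemma warping_derivative_has_derivative:
  assumes "s > shat"
  shows "((\<lambda>s. psi K E (r_of_s K E shat s)) has_real_derivative
    K / (r_of_s K E shat s)\<^sup>2 + E * r_of_s K E shat s) (at s)"
proof -
  have r: "r_of_s K E shat s > rhat K E" using r_of_s_inverse[OF assms] by auto
  show ?thesis
    using DERIV_chain2[OF psi_has_derivative[OF r] r_of_s_has_derivative[OF assms]]
      psi_pos[OF r] by simp
qed

text \<open>The terms with \<open>E\<close> cancel in \<open>r r'' - r'^2\<close>. The part above
  \<open>-1\<close> is the strict stability margin and comes from \<open>K\<close> alone.\<close>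

lemma warping_identity:
  assumes "s > shat"
  shows "r_of_s K E shat s * (K / (r_of_s K E shat s)\<^sup>2 + E * r_of_s K E shat s)
     - (psi K E (r_of_s K E shat s))\<^sup>2 = 3 * K / r_of_s K E shat s - 1"
  unfolding psi_squared[OF r_of_s_inverse(1)[OF assms]]
  using r_of_s_pos[OF assms] by (simp add: field_simps power2_eq_square)

end

section \<open>The sharp Poincare inequality on the sphere\<close>

text \<open>The common end of the ground state arguments: \<open>g\<close> minus the derivative of
  \<open>B\<close> is nonnegative, and the boundary values of \<open>B\<close> remain.
  Differentiability is asked in the open interval only, since the functions \<open>B\<close> below
  contain quotients by \<open>sin\<close> that degenerate at the endpoints.\<close>

lemma integral_ge_of_derivative_le:
  fixes B g :: "real \<Rightarrow> real"
  assumes "a \<le> b" "continuous_on {a..b} B" "continuous_on {a..b} g"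
    and "\<And>x. a < x \<Longrightarrow> x < b \<Longrightarrow> (B has_real_derivative B' x) (at x)"
    and "\<And>x. a < x \<Longrightarrow> x < b \<Longrightarrow> B' x \<le> g x"
  shows "B b - B a \<le> integral {a..b} g"
proof -
  define G where "G = (\<lambda>x. integral {a..x} g)"
  have int: "g integrable_on {a..b}" using assms by (intro integrable_continuous_real)
  have G: "(G has_real_derivative g x) (at x)" if "a < x" "x < b" for x
  proof -
    have "(G has_real_derivative g x) (at x within {a..b})"
      unfolding G_def using assms that by (intro integral_has_real_derivative) auto
    moreover have "at x within {a..b} = at x"
      by (rule at_within_interior) (use that in auto)
    ultimately show ?thesis by simp
  qed
  have "G a - B a \<le> G b - B b"
  proof (rule DERIV_nonneg_imp_increasing_open[OF assms(1)])
    show "\<exists>y. ((\<lambda>x. G x - B x) has_real_derivative y) (at x) \<and> 0 \<le> y" if "a < x" "x < b" for x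
      using DERIV_diff[OF G[OF that] assms(4)[OF that]] assms(5)[OF that] by force
    show "continuous_on {a..b} (\<lambda>x. G x - B x)"
      unfolding G_def using assms int by (intro continuous_intros indefinite_integral_continuous_1)
  qed
  then show ?thesis by (simp add: G_def)
qed

text \<open>Dividing numerator and denominator by \<open>x - c\<close> turns the quotient into one
  of difference quotients, so no derivative away from \<open>c\<close> enters.\<close>

lemma vanishing_quotient_tendsto:
  fixes h g :: "real \<Rightarrow> real"
  assumes "(h has_real_derivative h') (at c)" "h c = 0"
    and "(g has_real_derivative g') (at c)" "g c = 0" "g' \<noteq> 0"
  shows "((\<lambda>x. h x / g x) \<longlongrightarrow> h' / g') (at c)"
proof -
  have "((\<lambda>x. (h x - h c) / (x - c)) \<longlongrightarrow> h') (at c)"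
    "((\<lambda>x. (g x - g c) / (x - c)) \<longlongrightarrow> g') (at c)"
    using assms by (auto simp: has_field_derivative_iff)
  then have "((\<lambda>x. ((h x - h c) / (x - c)) / ((g x - g c) / (x - c))) \<longlongrightarrow> h' / g') (at c)"
    using assms by (intro tendsto_divide)
  moreover have "eventually (\<lambda>x. ((h x - h c) / (x - c)) / ((g x - g c) / (x - c)) = h x / g x) (at c)"
    using assms by (auto simp: eventually_at_filter)
  ultimately show ?thesis by (rule Lim_transform_eventually)
qed

text \<open>At the zeros of \<open>sin\<close> the junk value \<open>0\<close> of the quotient is also its limit.\<close>

lemma isCont_square_over_sin:
  fixes h :: "real \<Rightarrow> real"
  assumes h: "(h has_real_derivative h') (at x)" and z: "sin (x - c) = 0 \<Longrightarrow> h x = 0"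
  shows "isCont (\<lambda>x. (h x)\<^sup>2 / sin (x - c)) x"
proof (cases "sin (x - c) = 0")
  case False
  then show ?thesis using DERIV_isCont[OF h] by (intro continuous_intros) auto
next
  case True
  then have "cos (x - c) \<noteq> 0"
    using sin_cos_squared_add[of "x - c"] by auto
  moreover have "((\<lambda>x. sin (x - c)) has_real_derivative cos (x - c)) (at x)"
    by (auto intro!: derivative_eq_intros)
  ultimately have "((\<lambda>x. h x / sin (x - c)) \<longlongrightarrow> h' / cos (x - c)) (at x)"
    using vanishing_quotient_tendsto[OF h z[OF True], of "\<lambda>x. sin (x - c)"] True by simp
  moreover have "(h \<longlongrightarrow> 0) (at x)" using DERIV_isCont[OF h] z[OF True] by (simp add: isCont_def)
  ultimately have "((\<lambda>x. h x * (h x / sin (x - c))) \<longlongrightarrow> 0 * (h' / cos (x - c))) (at x)"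
    by (intro tendsto_mult)
  then show ?thesis using True by (simp add: isCont_def power2_eq_square)
qed

text \<open>With \<open>cot\<close> taken at \<open>x - c\<close>, the integrand
  \<open>(g')^2 - g^2\<close> is the square \<open>(g' - g cot)^2\<close> plus the derivative of
  \<open>g^2 cot\<close>. The ground state is \<open>sin (x - c)\<close>, a solution of
  \<open>y'' + y = 0\<close>. Writing the boundary term as
  \<open>(g x)\<^sup>2 / sin (x - c) * cos (x - c)\<close> lets it extend continuously to the zeros
  of \<open>sin\<close>.\<close>

lemma cot_ground_state:
  fixes g :: "real \<Rightarrow> real"
  assumes g: "\<And>x. (g has_real_derivative g' x) (at x)"
    and cont: "continuous_on UNIV g'"
    and ab: "a \<le> b"
    and ns: "\<And>x. a < x \<Longrightarrow> x < b \<Longrightarrow> sin (x - c) \<noteq> 0"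
    and z: "\<And>x. sin (x - c) = 0 \<Longrightarrow> g x = 0"
  shows "(g b)\<^sup>2 / sin (b - c) * cos (b - c) - (g a)\<^sup>2 / sin (a - c) * cos (a - c)
    \<le> integral {a..b} (\<lambda>x. (g' x)\<^sup>2 - (g x)\<^sup>2)"
proof (rule integral_ge_of_derivative_le[OF ab])
  have gc: "isCont g x" for x using g by (rule DERIV_isCont)
  have cg: "continuous_on UNIV g" using gc continuous_at_imp_continuous_on by blast
  show "continuous_on {a..b} (\<lambda>x. (g x)\<^sup>2 / sin (x - c) * cos (x - c))"
    using isCont_square_over_sin[OF g z]
    by (intro continuous_at_imp_continuous_on ballI continuous_mult) auto
  show "continuous_on {a..b} (\<lambda>x. (g' x)\<^sup>2 - (g x)\<^sup>2)"
    by (intro continuous_intros continuous_on_subset[OF cont] continuous_on_subset[OF cg]) auto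
  fix x assume x: "a < x" "x < b"
  define S where "S = sin (x - c)"
  define C where "C = cos (x - c)"
  have S0: "S \<noteq> 0" using ns[OF x] by (simp add: S_def)
  show "((\<lambda>x. (g x)\<^sup>2 / sin (x - c) * cos (x - c)) has_real_derivative
     (g' x)\<^sup>2 - (g x)\<^sup>2 - (g' x - g x * C / S)\<^sup>2) (at x)"
  proof -
    have "((\<lambda>x. (g x)\<^sup>2 / sin (x - c) * cos (x - c)) has_real_derivative
      (2 * g x * g' x * S - (g x)\<^sup>2 * C) / (S * S) * C - (g x)\<^sup>2 / S * S) (at x)"
      using S0 unfolding S_def C_def
      by (auto intro!: derivative_eq_intros g simp: field_simps)
    moreover have "(2 * g x * g' x * S - (g x)\<^sup>2 * C) / (S * S) * C - (g x)\<^sup>2 / S * S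
      = (g' x)\<^sup>2 - (g x)\<^sup>2 - (g' x - g x * C / S)\<^sup>2"
      using S0 by (simp add: field_simps power2_eq_square)
    ultimately show ?thesis by simp
  qed
qed auto

text \<open>By the intermediate value theorem \<open>h\<close> takes the same value at some \<open>c\<close> and \<open>c + pi\<close>. Subtracting
  it leaves a function that vanishes at all zeros of \<open>sin (x - c)\<close>, hence is comparable with this
  ground state.\<close>

lemma wirtinger:
  fixes h :: "real \<Rightarrow> real"
  assumes h: "\<And>x. (h has_real_derivative h' x) (at x)"
    and cont: "continuous_on UNIV h'"
    and per: "\<And>x. h (x + 2 * pi) = h x"
    and mean: "integral {0..2*pi} h = 0"
  shows "integral {0..2*pi} (\<lambda>x. (h x)\<^sup>2) \<le> integral {0..2*pi} (\<lambda>x. (h' x)\<^sup>2)"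
proof -
  have hc: "isCont h x" for x using h by (rule DERIV_isCont)
  have ch: "continuous_on S h" for S using hc continuous_at_imp_continuous_on by blast
  have ch': "continuous_on S h'" for S using cont by (rule continuous_on_subset) simp
  obtain c where c: "0 \<le> c" "c \<le> pi" "h (c + pi) = h c"
  proof -
    define d where "d = (\<lambda>x. h (x + pi) - h x)"
    have cd: "continuous_on {0..pi} d" unfolding d_def
      by (intro continuous_intros continuous_on_compose2[OF ch[of UNIV]]) auto
    have "d pi = - d 0" using per[of 0] by (simp add: d_def)
    then have "\<exists>x. 0 \<le> x \<and> x \<le> pi \<and> d x = 0"
      using IVT'[of d 0 0 pi] IVT2'[of d pi 0 0] cd by (cases "d 0 \<le> 0") auto
    then show ?thesis using that by (auto simp: d_def)
  qed
  define g where "g = (\<lambda>x. h x - h c)"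
  have g: "(g has_real_derivative h' x) (at x)" for x
    unfolding g_def by (auto intro!: derivative_eq_intros h)
  have perZ: "h (x + 2 * pi * of_int n) = h x" for x n
  proof (induction n rule: int_induct[where k = 0])
    case (step1 i) then show ?case using per[of "x + 2 * pi * i"] by (simp add: algebra_simps)
  next
    case (step2 i) then show ?case using per[of "x + 2 * pi * (i - 1)"] by (simp add: algebra_simps)
  qed simp
  have gz: "g x = 0" if "sin (x - c) = 0" for x
  proof -
    obtain n :: int where n: "x - c = of_int n * pi" using \<open>sin (x - c) = 0\<close> by (auto simp: sin_zero_iff_int2)
    show ?thesis
    proof (cases "even n")
      case True
      then obtain m where "n = 2 * m" by auto
      then have "x = c + 2 * pi * of_int m" using n by (simp add: algebra_simps)
      then show ?thesis using perZ by (simp add: g_def)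
    next
      case False
      then obtain m where "n = 2 * m + 1" by (rule oddE)
      then have "x = (c + pi) + 2 * pi * of_int m" using n by (simp add: algebra_simps)
      then show ?thesis using perZ c by (simp add: g_def)
    qed
  qed
  define Q where "Q = (\<lambda>x. (g x)\<^sup>2 / sin (x - c) * cos (x - c))"
  define F where "F = (\<lambda>x. (h' x)\<^sup>2 - (g x)\<^sup>2)"
  have cF: "F integrable_on {a..b}" for a b
    unfolding F_def g_def by (intro integrable_continuous_real continuous_intros ch ch')
  have step: "Q b - Q a \<le> integral {a..b} F"
    if "a \<le> b" "\<And>x. a < x \<Longrightarrow> x < b \<Longrightarrow> sin (x - c) \<noteq> 0" for a b
    using cot_ground_state[OF g cont that gz] by (simp add: Q_def F_def)
  \<comment> \<open>The interval is cut at \<open>c\<close> and \<open>c + pi\<close>, so that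
    \<open>sin (x - c)\<close> has no zero inside any of the three pieces.\<close>
  have s1: "Q c - Q 0 \<le> integral {0..c} F"
  proof (rule step)
    show "sin (x - c) \<noteq> 0" if "0 < x" "x < c" for x
      using sin_gt_zero[of "c - x"] that c sin_minus[of "c - x"] by simp
  qed (use c in auto)
  have s2: "Q (c + pi) - Q c \<le> integral {c..c + pi} F"
  proof (rule step)
    show "sin (x - c) \<noteq> 0" if "c < x" "x < c + pi" for x
      using sin_gt_zero[of "x - c"] that by simp
  qed auto
  have s3: "Q (2*pi) - Q (c + pi) \<le> integral {c + pi..2*pi} F"
  proof (rule step)
    show "sin (x - c) \<noteq> 0" if "c + pi < x" "x < 2 * pi" for x
    proof -
      have "sin (x - c - pi) > 0" using that c by (intro sin_gt_zero) auto
      then show ?thesis by (simp add: sin_diff)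
    qed
  qed (use c in auto)
  \<comment> \<open>The boundary terms of the three pieces telescope to
    \<open>Q (2*pi) - Q 0\<close>, which vanishes by periodicity.\<close>
  have Q: "Q (2*pi) = Q 0"
  proof -
    have "sin (2 * pi - c) = sin (0 - c)" "cos (2 * pi - c) = cos (0 - c)"
      by (simp_all add: sin_diff cos_diff)
    then show ?thesis using per[of 0] by (simp add: Q_def g_def)
  qed
  have "integral {0..2*pi} F = integral {0..c} F + integral {c..c+pi} F + integral {c+pi..2*pi} F"
    using c Henstock_Kurzweil_Integration.integral_combine[of 0 c "c+pi" F]
      Henstock_Kurzweil_Integration.integral_combine[of 0 "c+pi" "2*pi" F] cF by simp
  then have "0 \<le> integral {0..2*pi} F" using s1 s2 s3 Q by linarith
  also have "integral {0..2*pi} F = integral {0..2*pi} (\<lambda>x. (h' x)\<^sup>2) - integral {0..2*pi} (\<lambda>x. (g x)\<^sup>2)"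
    unfolding F_def g_def
    by (intro integral_diff integrable_continuous_real continuous_intros ch ch')
  \<comment> \<open>Replacing \<open>g\<close> by \<open>h\<close> only helps: as \<open>h\<close>
    has mean zero, the shift by \<open>h c\<close> adds \<open>2 * pi * (h c)\<^sup>2\<close> to the
    integral of the square.\<close>
  also have "integral {0..2*pi} (\<lambda>x. (g x)\<^sup>2) =
    integral {0..2*pi} (\<lambda>x. ((h x)\<^sup>2 + (h c)\<^sup>2) - (2 * h c) * h x)"
    unfolding g_def by (simp add: power2_diff mult_ac)
  also have "\<dots> = (integral {0..2*pi} (\<lambda>x. (h x)\<^sup>2) + integral {0..2*pi} (\<lambda>x. (h c)\<^sup>2))
      - integral {0..2*pi} (\<lambda>x. (2 * h c) * h x)"
    by (subst integral_diff integral_add;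
        (intro integral_diff integral_add integrable_continuous_real continuous_intros ch)?)+
      (rule refl)
  also have "integral {0..2*pi} (\<lambda>x. (2 * h c) * h x) = 0"
    using mean by simp
  finally have "integral {0..2*pi} (\<lambda>x. (h x)\<^sup>2) + 2 * pi * (h c)\<^sup>2 \<le> integral {0..2*pi} (\<lambda>x. (h' x)\<^sup>2)"
    by simp
  moreover have "0 \<le> 2 * pi * (h c)\<^sup>2" by simp
  ultimately show ?thesis by linarith
qed

text \<open>The primitive \<open>F\<close> of \<open>p sin\<close> vanishes at both poles. The bound \<open>2 \<integral> F\<^sup>2 / sin \<le> \<integral> p\<^sup>2 sin\<close>, proved with
  the ground state \<open>sin\<^sup>2\<close>, and integration by parts in \<open>\<integral> p F'\<close> give the claim; the function \<open>B\<close>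
  collects the boundary terms of both steps.\<close>

lemma legendre_inequality:
  fixes p :: "real \<Rightarrow> real"
  assumes p: "\<And>x. (p has_real_derivative p' x) (at x)"
    and cont: "continuous_on UNIV p'"
    and mean: "integral {0..pi} (\<lambda>x. p x * sin x) = 0"
  shows "2 * integral {0..pi} (\<lambda>x. (p x)\<^sup>2 * sin x) \<le> integral {0..pi} (\<lambda>x. (p' x)\<^sup>2 * sin x)"
proof -
  have pc: "isCont p x" for x using p by (rule DERIV_isCont)
  have cp: "continuous_on S p" for S using pc continuous_at_imp_continuous_on by blast
  have cp': "continuous_on S p'" for S using cont by (rule continuous_on_subset) simp
  define F where "F = (\<lambda>x. integral {0..x} (\<lambda>x. p x * sin x))"
  have F0: "F 0 = 0" and Fpi: "F pi = 0" using mean by (auto simp: F_def)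
  have Fd: "(F has_real_derivative p x * sin x) (at x within {0..pi})" if "x \<in> {0..pi}" for x
    unfolding F_def using that by (intro integral_has_real_derivative continuous_intros cp) auto
  have Fd': "(F has_real_derivative p x * sin x) (at x)" if "0 < x" "x < pi" for x
    using Fd[of x] that at_within_interior[of x "{0..pi}"] by simp
  \<comment> \<open>At a pole \<open>F\<close> and its derivative \<open>p sin\<close> both vanish
    while \<open>sin\<close> has a simple zero. The limit 0 agrees with the value of the division by
    zero, so \<open>F / sin\<close> is continuous on the closed interval.\<close>
  have lim: "((\<lambda>x. F x / sin x) \<longlongrightarrow> 0) (at x within {0..pi})" if x: "x = 0 \<or> x = pi" for x
  proof -
    have Fx: "F x = 0" "sin x = 0" "cos x \<noteq> 0" "x \<in> {0..pi}" using x F0 Fpi by auto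
    have "((\<lambda>y. (F y - F x) / (y - x)) \<longlongrightarrow> p x * sin x) (at x within {0..pi})"
      "((\<lambda>y. (sin y - sin x) / (y - x)) \<longlongrightarrow> cos x) (at x within {0..pi})"
      using Fd[OF Fx(4)] has_field_derivative_at_within[OF DERIV_sin[of x]]
      by (auto simp: has_field_derivative_iff)
    then have "((\<lambda>y. ((F y - F x) / (y - x)) / ((sin y - sin x) / (y - x))) \<longlongrightarrow> p x * sin x / cos x)
        (at x within {0..pi})"
      using Fx by (intro tendsto_divide)
    moreover have "eventually (\<lambda>y. ((F y - F x) / (y - x)) / ((sin y - sin x) / (y - x)) = F y / sin y)
        (at x within {0..pi})"
      using Fx by (auto simp: eventually_at_filter)
    ultimately show ?thesis using Fx Lim_transform_eventually by fastforce
  qed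
  have cont_q: "continuous_on {0..pi} (\<lambda>x. F x / sin x)"
    unfolding continuous_on_def
  proof
    fix x assume x: "x \<in> {0..pi}"
    show "((\<lambda>x. F x / sin x) \<longlongrightarrow> F x / sin x) (at x within {0..pi})"
    proof (cases "x = 0 \<or> x = pi")
      case True
      then show ?thesis using lim[OF True] by auto
    next
      case False
      then have "sin x > 0" using x by (intro sin_gt_zero) auto
      moreover have "(F \<longlongrightarrow> F x) (at x within {0..pi})"
        using DERIV_continuous[OF Fd[OF x]] by (simp add: continuous_within)
      ultimately show ?thesis by (intro tendsto_divide tendsto_intros) auto
    qed
  qed
  define B where "B = (\<lambda>x. - 4 * p x * F x + 4 * cos x * (F x / sin x)\<^sup>2)"
  have "B pi - B 0 \<le> integral {0..pi} (\<lambda>x. (p' x)\<^sup>2 * sin x - 2 * ((p x)\<^sup>2 * sin x))"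
  proof (rule integral_ge_of_derivative_le)
    have "continuous_on {0..pi} F"
      using Fd by (meson DERIV_continuous continuous_on_eq_continuous_within)
    then show "continuous_on {0..pi} B" unfolding B_def by (intro continuous_intros cp cont_q)
    show "continuous_on {0..pi} (\<lambda>x. (p' x)\<^sup>2 * sin x - 2 * ((p x)\<^sup>2 * sin x))"
      by (intro continuous_intros cp cp')
    fix x :: real assume x: "0 < x" "x < pi"
    define S where "S = sin x"
    define C where "C = cos x"
    have S: "S > 0" using x sin_gt_zero by (simp add: S_def)
    define B' where "B' = - 4 * p' x * F x - 4 * p x * (p x * S) - 4 * S * (F x / S)\<^sup>2
      + 4 * C * (2 * (F x / S) * ((p x * S * S - F x * C) / (S * S)))"
    show "(B has_real_derivative B') (at x)"
      using S unfolding B_def B'_def S_def C_def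
      by (auto intro!: derivative_eq_intros Fd' p x simp: mult_ac)
    \<comment> \<open>Both squares vanish for \<open>p = cos\<close>, where \<open>F\<close> is
      \<open>sin^2 / 2\<close>: this is the eigenfunction for the eigenvalue 2 and dictates the
      coefficients in \<open>B\<close>. The second square is \<open>F' - 2 cot F\<close> in
      disguise, which is zero for the ground state \<open>sin^2\<close>.\<close>
    have "(p' x)\<^sup>2 * S - 2 * ((p x)\<^sup>2 * S) - B'
      = S * (p' x + 2 * F x / S)\<^sup>2 + 2 * S * (p x - 2 * C * F x / S\<^sup>2)\<^sup>2"
    proof -
      define f where "f = F x / S"
      have "F x = f * S" using S by (simp add: f_def)
      then show ?thesis
        unfolding B'_def using S by (simp add: field_simps power2_eq_square)
    qed
    then show "B' \<le> (p' x)\<^sup>2 * sin x - 2 * ((p x)\<^sup>2 * sin x)"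
      unfolding S_def[symmetric] using S by (smt (verit) mult_nonneg_nonneg zero_le_power2)
  qed simp
  moreover have "B pi = 0" "B 0 = 0" using F0 Fpi by (auto simp: B_def)
  ultimately have "0 \<le> integral {0..pi} (\<lambda>x. (p' x)\<^sup>2 * sin x - 2 * ((p x)\<^sup>2 * sin x))" by simp
  also have "\<dots> = integral {0..pi} (\<lambda>x. (p' x)\<^sup>2 * sin x) - 2 * integral {0..pi} (\<lambda>x. (p x)\<^sup>2 * sin x)"
    by (subst integral_diff; (intro integrable_continuous_real continuous_intros cp cp')?) simp
  finally show ?thesis by simp
qed


section \<open>Iterated integrals over the closed coordinate rectangle of the sphere\<close>

definition polar_continuous :: "(real \<Rightarrow> real \<Rightarrow> real) \<Rightarrow> bool" where
  "polar_continuous F \<longleftrightarrow> continuous_on ({0..pi} \<times> {0..2*pi}) (\<lambda>(\<theta>, \<phi>). F \<theta> \<phi>)"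

text \<open>The area density \<open>sin \<theta>\<close> is not built in; integrals over the sphere
  carry it in the integrand. This lets the flux terms, which are derivatives with respect to the
  coordinates, be integrated directly.\<close>

definition polar_integral :: "(real \<Rightarrow> real \<Rightarrow> real) \<Rightarrow> real" where
  "polar_integral F = integral {0..pi} (\<lambda>\<theta>. integral {0..2*pi} (F \<theta>))"

lemma polar_continuous_section:
  assumes "polar_continuous F" "\<theta> \<in> {0..pi}"
  shows "continuous_on {0..2*pi} (F \<theta>)"
proof -
  have 1: "continuous_on {0..2*pi} (Pair \<theta>)" by (intro continuous_intros)
  have 2: "Pair \<theta> ` {0..2*pi} \<subseteq> {0..pi} \<times> {0..2*pi}" using assms(2) by auto
  show ?thesis
    using continuous_on_compose2[OF assms(1)[unfolded polar_continuous_def] 1 2] by simp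
qed

lemma polar_continuous_inner:
  assumes "polar_continuous F" "\<theta> \<in> {0..pi}"
  shows "F \<theta> integrable_on {0..2*pi}"
  using polar_continuous_section[OF assms] by (rule integrable_continuous_real)

lemma polar_continuous_outer:
  assumes "polar_continuous F"
  shows "continuous_on {0..pi} (\<lambda>\<theta>. integral {0..2*pi} (F \<theta>))"
  using integral_continuous_on_param[of "{0..pi}" 0 "2*pi" F] assms
  by (simp add: polar_continuous_def)

lemma polar_integral_mono:
  assumes "polar_continuous F" "polar_continuous G"
    and "\<And>\<theta> \<phi>. 0 \<le> \<theta> \<Longrightarrow> \<theta> \<le> pi \<Longrightarrow> 0 \<le> \<phi> \<Longrightarrow> \<phi> \<le> 2*pi \<Longrightarrow> F \<theta> \<phi> \<le> G \<theta> \<phi>"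
  shows "polar_integral F \<le> polar_integral G"
  unfolding polar_integral_def
  by (intro integral_le integrable_continuous_real polar_continuous_outer polar_continuous_inner assms)
    (use assms in auto)

lemma polar_integral_add:
  assumes "polar_continuous F" "polar_continuous G"
  shows "polar_integral (\<lambda>\<theta> \<phi>. F \<theta> \<phi> + G \<theta> \<phi>) = polar_integral F + polar_integral G"
proof -
  have "polar_integral (\<lambda>\<theta> \<phi>. F \<theta> \<phi> + G \<theta> \<phi>) =
    integral {0..pi} (\<lambda>\<theta>. integral {0..2*pi} (F \<theta>) + integral {0..2*pi} (G \<theta>))"
    unfolding polar_integral_def
    by (intro integral_cong integral_add polar_continuous_inner assms)
  also have "\<dots> = polar_integral F + polar_integral G"
    unfolding polar_integral_def
    by (intro integral_add integrable_continuous_real polar_continuous_outer assms)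
  finally show ?thesis .
qed

lemma polar_integral_cmult: "polar_integral (\<lambda>\<theta> \<phi>. c * F \<theta> \<phi>) = c * polar_integral F"
  by (simp add: polar_integral_def)

text \<open>The vanishing principle for nonnegative continuous functions is applied twice, first to
  the inner integral as a function of \<open>\<theta>\<close>, then on the single parallel.\<close>

lemma polar_integral_eq_0:
  assumes F: "polar_continuous F"
    and nonneg: "\<And>\<theta> \<phi>. 0 \<le> \<theta> \<Longrightarrow> \<theta> \<le> pi \<Longrightarrow> 0 \<le> \<phi> \<Longrightarrow> \<phi> \<le> 2*pi \<Longrightarrow> 0 \<le> F \<theta> \<phi>"
    and zero: "polar_integral F = 0"
    and \<theta>: "0 \<le> \<theta>" "\<theta> \<le> pi" and \<phi>: "0 \<le> \<phi>" "\<phi> \<le> 2*pi"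
  shows "F \<theta> \<phi> = 0"
proof -
  have inner: "0 \<le> integral {0..2*pi} (F \<theta>)" if "\<theta> \<in> {0..pi}" for \<theta>
    by (intro integral_nonneg polar_continuous_inner F that) (use nonneg that in auto)
  have "integral {0..2*pi} (F \<theta>) = 0"
    using integral_eq_0_iff[OF polar_continuous_outer[OF F] pi_gt_zero inner] zero \<theta>
    by (simp add: polar_integral_def)
  moreover have "continuous_on {0..2*pi} (F \<theta>)"
    using polar_continuous_section[OF F] \<theta> by simp
  ultimately show ?thesis
    using integral_eq_0_iff[of 0 "2*pi" "F \<theta>"] nonneg \<theta> \<phi> by auto
qed

lemma integral_param_has_derivative:
  fixes F F' :: "real \<Rightarrow> real \<Rightarrow> real"
  assumes F: "\<And>\<theta> \<phi>. a < \<theta> \<Longrightarrow> \<theta> < b \<Longrightarrow> ((\<lambda>\<theta>. F \<theta> \<phi>) has_real_derivative F' \<theta> \<phi>) (at \<theta>)"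
    and int: "\<And>\<theta>. a < \<theta> \<Longrightarrow> \<theta> < b \<Longrightarrow> F \<theta> integrable_on {c..d}"
    and cont: "continuous_on ({a<..<b} \<times> UNIV) (\<lambda>x. F' (fst x) (snd x))"
    and x: "a < x" "x < b"
  shows "((\<lambda>\<theta>. integral {c..d} (F \<theta>)) has_real_derivative integral {c..d} (F' x)) (at x)"
proof -
  have "continuous_on ({a<..<b} \<times> {c..d}) (\<lambda>x. F' (fst x) (snd x))"
    using cont by (rule continuous_on_subset) auto
  then have "((\<lambda>\<theta>. integral (cbox c d) (F \<theta>)) has_real_derivative integral (cbox c d) (F' x))
    (at x within {a<..<b})"
    using assms
    by (intro leibniz_rule_field_derivative) (auto simp: case_prod_unfold intro: has_field_derivative_at_within)
  then show ?thesis using x at_within_open[of x "{a<..<b}"] by auto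
qed

lemma integral_sin_0_pi: "integral {0..pi} sin = (2 :: real)"
  using fundamental_theorem_of_calculus[of 0 pi "\<lambda>x. - cos x" sin]
  by (auto intro!: derivative_eq_intros integral_unique
      simp: has_real_derivative_iff_has_vector_derivative[symmetric])

text \<open>\<open>k\<close> is the derivative of \<open>U\<close> along the unit vector in the direction of \<open>\<phi>\<close>. Using it
  instead of the coordinate derivative avoids quotients by \<open>sin \<theta>\<close> at the poles.\<close>

locale sphere_function =
  fixes U Ut k Utt Utp kt kp :: "real \<Rightarrow> real \<Rightarrow> real"
  assumes U_t: "\<And>\<theta> \<phi>. ((\<lambda>\<theta>. U \<theta> \<phi>) has_real_derivative Ut \<theta> \<phi>) (at \<theta>)"
    and U_p: "\<And>\<theta> \<phi>. ((\<lambda>\<phi>. U \<theta> \<phi>) has_real_derivative sin \<theta> * k \<theta> \<phi>) (at \<phi>)"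
    and Ut_t: "\<And>\<theta> \<phi>. ((\<lambda>\<theta>. Ut \<theta> \<phi>) has_real_derivative Utt \<theta> \<phi>) (at \<theta>)"
    and Ut_p: "\<And>\<theta> \<phi>. ((\<lambda>\<phi>. Ut \<theta> \<phi>) has_real_derivative Utp \<theta> \<phi>) (at \<phi>)"
    and k_t: "\<And>\<theta> \<phi>. ((\<lambda>\<theta>. k \<theta> \<phi>) has_real_derivative kt \<theta> \<phi>) (at \<theta>)"
    and k_p: "\<And>\<theta> \<phi>. ((\<lambda>\<phi>. k \<theta> \<phi>) has_real_derivative kp \<theta> \<phi>) (at \<phi>)"
    and cont_U: "continuous_on UNIV (\<lambda>x. U (fst x) (snd x))"
    and cont_Ut: "continuous_on UNIV (\<lambda>x. Ut (fst x) (snd x))"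
    and cont_k: "continuous_on UNIV (\<lambda>x. k (fst x) (snd x))"
    and cont_Utt: "continuous_on UNIV (\<lambda>x. Utt (fst x) (snd x))"
    and cont_kt: "continuous_on UNIV (\<lambda>x. kt (fst x) (snd x))"
    and per_U: "\<And>\<theta> \<phi>. U \<theta> (\<phi> + 2 * pi) = U \<theta> \<phi>"
    and per_Ut: "\<And>\<theta> \<phi>. Ut \<theta> (\<phi> + 2 * pi) = Ut \<theta> \<phi>"
    and per_k: "\<And>\<theta> \<phi>. k \<theta> (\<phi> + 2 * pi) = k \<theta> \<phi>"
    and north: "\<And>\<phi>. U 0 \<phi> = U 0 0"
    and south: "\<And>\<phi>. U pi \<phi> = U pi 0"
begin

lemma continuous_on_polar [continuous_intros]:
  assumes "continuous_on S f" "continuous_on S g"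
  shows "continuous_on S (\<lambda>x. U (f x) (g x))" "continuous_on S (\<lambda>x. Ut (f x) (g x))"
    "continuous_on S (\<lambda>x. k (f x) (g x))" "continuous_on S (\<lambda>x. Utt (f x) (g x))"
    "continuous_on S (\<lambda>x. kt (f x) (g x))"
  using continuous_on_compose2[OF cont_U continuous_on_Pair[OF assms]]
    continuous_on_compose2[OF cont_Ut continuous_on_Pair[OF assms]]
    continuous_on_compose2[OF cont_k continuous_on_Pair[OF assms]]
    continuous_on_compose2[OF cont_Utt continuous_on_Pair[OF assms]]
    continuous_on_compose2[OF cont_kt continuous_on_Pair[OF assms]]
  by auto

definition mean :: real where
  "mean = polar_integral (\<lambda>\<theta> \<phi>. U \<theta> \<phi> * sin \<theta>) / (4 * pi)"

lemma polar_integral_mean: "polar_integral (\<lambda>\<theta> \<phi>. (U \<theta> \<phi> - mean) * sin \<theta>) = 0"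
proof -
  have "polar_integral (\<lambda>\<theta> \<phi>. - mean * sin \<theta>) = - mean * (4 * pi)"
    by (simp add: polar_integral_def integral_sin_0_pi)
  moreover have "polar_integral (\<lambda>\<theta> \<phi>. U \<theta> \<phi> * sin \<theta> + (- mean * sin \<theta>)) =
     polar_integral (\<lambda>\<theta> \<phi>. U \<theta> \<phi> * sin \<theta>) + polar_integral (\<lambda>\<theta> \<phi>. - mean * sin \<theta>)"
    by (intro polar_integral_add) (auto simp: polar_continuous_def case_prod_unfold intro!: continuous_intros)
  ultimately show ?thesis by (simp add: mean_def algebra_simps)
qed

text \<open>Split \<open>U\<close> into its average \<open>V\<close> over the parallels and the remainder \<open>g\<close>. For \<open>g\<close>, Wirtinger's inequality
  turns the derivative along the parallels into the potential \<open>1 / sin\<close>, for which \<open>sin\<close> is the ground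
  state; \<open>V\<close> is covered by the inequality above.\<close>

lemma poincare:
  "2 * polar_integral (\<lambda>\<theta> \<phi>. (U \<theta> \<phi> - mean)\<^sup>2 * sin \<theta>)
    \<le> polar_integral (\<lambda>\<theta> \<phi>. ((Ut \<theta> \<phi>)\<^sup>2 + (k \<theta> \<phi>)\<^sup>2) * sin \<theta>)"
proof -
  define V where "V = (\<lambda>\<theta>. integral {0..2*pi} (U \<theta>) / (2 * pi))"
  define V' where "V' = (\<lambda>\<theta>. integral {0..2*pi} (Ut \<theta>) / (2 * pi))"
  define p where "p = (\<lambda>\<theta>. V \<theta> - mean)"
  define g where "g = (\<lambda>\<theta> \<phi>. U \<theta> \<phi> - V \<theta>)"
  define gt where "gt = (\<lambda>\<theta> \<phi>. Ut \<theta> \<phi> - V' \<theta>)"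
  have V: "(V has_real_derivative V' \<theta>) (at \<theta>)" for \<theta>
    unfolding V_def V'_def
    by (intro DERIV_cdivide integral_param_has_derivative[where a = "\<theta> - 1" and b = "\<theta> + 1"]
        integrable_continuous_real continuous_intros U_t) auto
  have cV': "continuous_on S V'" for S
  proof -
    have 1: "continuous_on (UNIV \<times> cbox 0 (2*pi)) (\<lambda>x. Ut (fst x) (snd x))"
      using cont_Ut by (rule continuous_on_subset) simp
    have "continuous_on UNIV (\<lambda>\<theta>. integral (cbox 0 (2*pi)) (Ut \<theta>))"
      by (rule integral_continuous_on_param) (use 1 in \<open>simp only: case_prod_unfold\<close>)
    then have "continuous_on UNIV V'"
      unfolding V'_def cbox_interval by (rule continuous_on_divide[OF _ continuous_on_const]) simp
    then show ?thesis by (rule continuous_on_subset) simp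
  qed
  have cV: "continuous_on S V" for S
    using V by (meson DERIV_isCont continuous_at_imp_continuous_on)
  have cV2: "continuous_on S (\<lambda>x. V (f x))" "continuous_on S (\<lambda>x. V' (f x))"
    if "continuous_on S f" for S and f :: "real \<times> real \<Rightarrow> real"
    using continuous_on_compose2[OF cV[of UNIV] that] continuous_on_compose2[OF cV'[of UNIV] that] by auto
  have V_int: "integral {0..2*pi} (U \<theta>) = 2 * pi * V \<theta>" for \<theta> by (simp add: V_def)
  have g0: "integral {0..2*pi} (g \<theta>) = 0" for \<theta>
  proof -
    have "integral {0..2*pi} (g \<theta>) = integral {0..2*pi} (U \<theta>) - integral {0..2*pi} (\<lambda>\<phi>. V \<theta>)"
      unfolding g_def by (intro integral_diff integrable_continuous_real continuous_intros)
    then show ?thesis by (simp add: V_def)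
  qed
  have gt0: "integral {0..2*pi} (gt \<theta>) = 0" for \<theta>
  proof -
    have "integral {0..2*pi} (gt \<theta>) = integral {0..2*pi} (Ut \<theta>) - integral {0..2*pi} (\<lambda>\<phi>. V' \<theta>)"
      unfolding gt_def by (intro integral_diff integrable_continuous_real continuous_intros)
    then show ?thesis by (simp add: V'_def)
  qed
  have g_t: "((\<lambda>\<theta>. g \<theta> \<phi>) has_real_derivative gt \<theta> \<phi>) (at \<theta>)" for \<theta> \<phi>
    unfolding g_def gt_def by (auto intro!: derivative_eq_intros U_t V)
  have cg: "continuous_on S (\<lambda>x. g (f x) (h x))" "continuous_on S (\<lambda>x. gt (f x) (h x))"
    if "continuous_on S f" "continuous_on S h" for S and f h :: "real \<times> real \<Rightarrow> real"
    unfolding g_def gt_def using that by (intro continuous_intros cV2; simp)+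
  have cg1: "continuous_on S (g \<theta>)" "continuous_on S (gt \<theta>)" for S \<theta>
    unfolding g_def gt_def by (intro continuous_intros)+
  define A where "A = (\<lambda>\<theta>. integral {0..2*pi} (\<lambda>\<phi>. (g \<theta> \<phi>)\<^sup>2))"
  define G where "G = (\<lambda>\<theta>. integral {0..2*pi} (\<lambda>\<phi>. (gt \<theta> \<phi>)\<^sup>2))"
  define M where "M = (\<lambda>\<theta>. integral {0..2*pi} (\<lambda>\<phi>. g \<theta> \<phi> * gt \<theta> \<phi>))"
  define Q where "Q = (\<lambda>\<theta>. integral {0..2*pi} (\<lambda>\<phi>. (k \<theta> \<phi>)\<^sup>2))"
  have A: "(A has_real_derivative 2 * M \<theta>) (at \<theta>)" for \<theta>
  proof -
    have "(A has_real_derivative integral {0..2*pi} (\<lambda>\<phi>. 2 * (g \<theta> \<phi> * gt \<theta> \<phi>))) (at \<theta>)"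
      unfolding A_def
      by (intro integral_param_has_derivative[where a = "\<theta> - 1" and b = "\<theta> + 1"]
        integrable_continuous_real continuous_intros cg cg1)
        (auto intro!: derivative_eq_intros g_t)
    then show ?thesis by (simp add: M_def)
  qed
  have cA: "continuous_on S A" for S
    using A by (meson DERIV_isCont continuous_at_imp_continuous_on)
  have pgt: "polar_continuous (\<lambda>\<theta> \<phi>. (gt \<theta> \<phi>)\<^sup>2)"
    unfolding polar_continuous_def case_prod_unfold
    by (rule continuous_on_power, rule cg) (intro continuous_intros)+
  have pk: "polar_continuous (\<lambda>\<theta> \<phi>. (k \<theta> \<phi>)\<^sup>2)"
    unfolding polar_continuous_def case_prod_unfold
    by (rule continuous_on_power, rule continuous_on_polar) (intro continuous_intros)+
  have cG: "continuous_on {0..pi} G"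
    unfolding G_def by (rule polar_continuous_outer[OF pgt])
  have cQ: "continuous_on {0..pi} Q"
    unfolding Q_def by (rule polar_continuous_outer[OF pk])
  \<comment> \<open>A parallel shrinks to a point at a pole, so \<open>U\<close> equals its average
    there. This removes the boundary term \<open>cos \<theta> * A \<theta>\<close> below.\<close>
  have "A \<theta> = 0" if "\<theta> = 0 \<or> \<theta> = pi" for \<theta>
  proof -
    have "U \<theta> \<phi> = U \<theta> 0" for \<phi> using that north[of \<phi>] south[of \<phi>] by (elim disjE) simp_all
    then have "U \<theta> = (\<lambda>\<phi>. U \<theta> 0)" by (rule ext)
    then obtain c where c: "U \<theta> = (\<lambda>\<phi>. c)" by blast
    have "g \<theta> = (\<lambda>\<phi>. 0)" unfolding g_def V_def c by simp
    then show ?thesis by (simp add: A_def)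
  qed
  then have A0: "A 0 = 0" "A pi = 0" by auto
  \<comment> \<open>Along a parallel the coordinate derivative of \<open>g\<close> is
    \<open>sin \<theta> * k\<close>, and subtracting \<open>V\<close> has made the mean zero, as
    Wirtinger's inequality requires.\<close>
  have A_le: "A \<theta> \<le> (sin \<theta>)\<^sup>2 * Q \<theta>" for \<theta>
  proof -
    have "A \<theta> \<le> integral {0..2*pi} (\<lambda>\<phi>. (sin \<theta> * k \<theta> \<phi>)\<^sup>2)"
      unfolding A_def
    proof (rule wirtinger)
      show "(g \<theta> has_real_derivative sin \<theta> * k \<theta> \<phi>) (at \<phi>)" for \<phi>
        unfolding g_def by (auto intro!: derivative_eq_intros U_p)
    qed (auto simp: g0 intro!: continuous_intros, simp add: g_def per_U)
    then show ?thesis by (simp add: Q_def power_mult_distrib)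
  qed
  define H where "H = (\<lambda>\<theta>. (G \<theta> + Q \<theta> - 2 * A \<theta>) * sin \<theta>)"
  have "cos pi * A pi - cos 0 * A 0 \<le> integral {0..pi} H"
  proof (rule integral_ge_of_derivative_le)
    show "continuous_on {0..pi} (\<lambda>\<theta>. cos \<theta> * A \<theta>)" by (intro continuous_intros cA)
    show "continuous_on {0..pi} H" unfolding H_def by (intro continuous_intros cA cG cQ)
    fix \<theta> :: real assume \<theta>: "0 < \<theta>" "\<theta> < pi"
    show "((\<lambda>\<theta>. cos \<theta> * A \<theta>) has_real_derivative (2 * cos \<theta> * M \<theta> - sin \<theta> * A \<theta>)) (at \<theta>)"
      by (auto intro!: derivative_eq_intros A)
    define S where "S = sin \<theta>"
    define C where "C = cos \<theta>"
    have S: "S > 0" using \<theta> sin_gt_zero by (simp add: S_def)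
    have sc: "C\<^sup>2 = 1 - S\<^sup>2" by (simp add: S_def C_def cos_squared_eq)
    \<comment> \<open>The square measures the deviation of \<open>g\<close> from a multiple of the
      ground state \<open>sin\<close>. Its last term splits by
      \<open>C\<^sup>2 = 1 - S\<^sup>2\<close>, and the singular part \<open>A \<theta> / S\<close>
      is what \<open>A_le\<close> controls.\<close>
    have "0 \<le> integral {0..2*pi} (\<lambda>\<phi>. S * (gt \<theta> \<phi> - C / S * g \<theta> \<phi>)\<^sup>2)"
      by (intro integral_nonneg integrable_continuous_real continuous_intros cg1) (use S in auto)
    also have "(\<lambda>\<phi>. S * (gt \<theta> \<phi> - C / S * g \<theta> \<phi>)\<^sup>2) =
       (\<lambda>\<phi>. S * (gt \<theta> \<phi>)\<^sup>2 - 2 * C * (g \<theta> \<phi> * gt \<theta> \<phi>) + C\<^sup>2 / S * (g \<theta> \<phi>)\<^sup>2)"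
      using S by (auto simp: field_simps power2_eq_square)
    also have "integral {0..2*pi} \<dots> = S * G \<theta> - 2 * C * M \<theta> + C\<^sup>2 / S * A \<theta>"
      unfolding G_def M_def A_def
      by (subst integral_add integral_diff;
        (intro integral_add integral_diff integrable_continuous_real continuous_intros cg1)?)+ simp
    also have "C\<^sup>2 / S * A \<theta> = A \<theta> / S - S * A \<theta>"
      using S unfolding sc by (simp add: field_simps power2_eq_square)
    also have "A \<theta> / S \<le> S * Q \<theta>"
      using A_le[of \<theta>] S by (simp add: S_def field_simps power2_eq_square)
    finally show "2 * cos \<theta> * M \<theta> - sin \<theta> * A \<theta> \<le> H \<theta>"
      unfolding H_def S_def[symmetric] C_def[symmetric] by (simp add: algebra_simps)
  qed simp
  then have *: "0 \<le> integral {0..pi} H" using A0 by simp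
  have meanp: "integral {0..pi} (\<lambda>\<theta>. p \<theta> * sin \<theta>) = 0"
  proof -
    have "integral {0..2*pi} (\<lambda>\<phi>. (U \<theta> \<phi> - mean) * sin \<theta>) = 2 * pi * (p \<theta> * sin \<theta>)" for \<theta>
    proof -
      have "integral {0..2*pi} (\<lambda>\<phi>. U \<theta> \<phi> - mean) = integral {0..2*pi} (U \<theta>) - integral {0..2*pi} (\<lambda>\<phi>. mean)"
        by (intro integral_diff integrable_continuous_real continuous_intros)
      then have "integral {0..2*pi} (\<lambda>\<phi>. U \<theta> \<phi> - mean) = 2 * pi * p \<theta>"
        using V_int[of \<theta>] by (simp add: p_def algebra_simps)
      then show ?thesis by simp
    qed
    then have "integral {0..pi} (\<lambda>\<theta>. 2 * pi * (p \<theta> * sin \<theta>)) = 0"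
      using polar_integral_mean by (simp only: polar_integral_def)
    then show ?thesis by simp
  qed
  have pd: "(p has_real_derivative V' \<theta>) (at \<theta>)" for \<theta>
    unfolding p_def by (auto intro!: derivative_eq_intros V)
  have L: "2 * integral {0..pi} (\<lambda>\<theta>. (p \<theta>)\<^sup>2 * sin \<theta>) \<le> integral {0..pi} (\<lambda>\<theta>. (V' \<theta>)\<^sup>2 * sin \<theta>)"
    using pd cV' meanp by (rule legendre_inequality)
  \<comment> \<open>Parallelwise orthogonality: the cross terms vanish here and in \<open>e2\<close>
    because \<open>g\<close> and \<open>gt\<close> have mean zero on each parallel, so the two parts
    of \<open>U\<close> can be estimated separately.\<close>
  have e1: "integral {0..2*pi} (\<lambda>\<phi>. (U \<theta> \<phi> - mean)\<^sup>2 * sin \<theta>) = (A \<theta> + 2 * pi * (p \<theta>)\<^sup>2) * sin \<theta>" for \<theta>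
  proof -
    have "(\<lambda>\<phi>. (U \<theta> \<phi> - mean)\<^sup>2) = (\<lambda>\<phi>. (g \<theta> \<phi>)\<^sup>2 + (2 * p \<theta>) * g \<theta> \<phi> + (p \<theta>)\<^sup>2)"
      by (auto simp: g_def p_def power2_eq_square algebra_simps)
    moreover have "integral {0..2*pi} \<dots> = A \<theta> + 2 * p \<theta> * integral {0..2*pi} (g \<theta>) + 2 * pi * (p \<theta>)\<^sup>2"
      unfolding A_def
      by (subst integral_add; (intro integral_add integrable_continuous_real continuous_intros cg1)?)+ simp
    ultimately have "integral {0..2*pi} (\<lambda>\<phi>. (U \<theta> \<phi> - mean)\<^sup>2) = A \<theta> + 2 * pi * (p \<theta>)\<^sup>2"
      by (simp only: g0 mult_zero_right add_0_right)
    then show ?thesis by simp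
  qed
  have e2: "integral {0..2*pi} (\<lambda>\<phi>. ((Ut \<theta> \<phi>)\<^sup>2 + (k \<theta> \<phi>)\<^sup>2) * sin \<theta>)
    = (G \<theta> + 2 * pi * (V' \<theta>)\<^sup>2 + Q \<theta>) * sin \<theta>" for \<theta>
  proof -
    have "(\<lambda>\<phi>. (Ut \<theta> \<phi>)\<^sup>2 + (k \<theta> \<phi>)\<^sup>2) =
        (\<lambda>\<phi>. (gt \<theta> \<phi>)\<^sup>2 + (2 * V' \<theta>) * gt \<theta> \<phi> + (V' \<theta>)\<^sup>2 + (k \<theta> \<phi>)\<^sup>2)"
      by (auto simp: gt_def power2_eq_square algebra_simps)
    moreover have "integral {0..2*pi} \<dots> =
        G \<theta> + 2 * V' \<theta> * integral {0..2*pi} (gt \<theta>) + 2 * pi * (V' \<theta>)\<^sup>2 + Q \<theta>"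
      unfolding G_def Q_def
      by (subst integral_add; (intro integral_add integrable_continuous_real continuous_intros cg1)?)+ simp
    ultimately have "integral {0..2*pi} (\<lambda>\<phi>. (Ut \<theta> \<phi>)\<^sup>2 + (k \<theta> \<phi>)\<^sup>2) = G \<theta> + 2 * pi * (V' \<theta>)\<^sup>2 + Q \<theta>"
      by (simp only: gt0 mult_zero_right add_0_right)
    then show ?thesis by simp
  qed
  have cp: "continuous_on S p" for S unfolding p_def by (intro continuous_intros cV)
  have i: "(\<lambda>\<theta>. A \<theta> * sin \<theta>) integrable_on {0..pi}" "(\<lambda>\<theta>. G \<theta> * sin \<theta>) integrable_on {0..pi}"
    "(\<lambda>\<theta>. Q \<theta> * sin \<theta>) integrable_on {0..pi}"
    "(\<lambda>\<theta>. (p \<theta>)\<^sup>2 * sin \<theta>) integrable_on {0..pi}" "(\<lambda>\<theta>. (V' \<theta>)\<^sup>2 * sin \<theta>) integrable_on {0..pi}"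
    by (intro integrable_continuous_real continuous_intros cA cG cQ cp cV')+
  note i = i[THEN integrable_integral]
  have "((\<lambda>\<theta>. (A \<theta> + 2 * pi * (p \<theta>)\<^sup>2) * sin \<theta>) has_integral
     integral {0..pi} (\<lambda>\<theta>. A \<theta> * sin \<theta>) + 2 * pi * integral {0..pi} (\<lambda>\<theta>. (p \<theta>)\<^sup>2 * sin \<theta>)) {0..pi}"
    using has_integral_add[OF i(1) has_integral_mult_right[OF i(4), of "2 * pi"]]
    by (simp add: algebra_simps)
  then have I1: "polar_integral (\<lambda>\<theta> \<phi>. (U \<theta> \<phi> - mean)\<^sup>2 * sin \<theta>) =
    integral {0..pi} (\<lambda>\<theta>. A \<theta> * sin \<theta>) + 2 * pi * integral {0..pi} (\<lambda>\<theta>. (p \<theta>)\<^sup>2 * sin \<theta>)"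
    unfolding polar_integral_def e1 by (rule integral_unique)
  have "((\<lambda>\<theta>. (G \<theta> + 2 * pi * (V' \<theta>)\<^sup>2 + Q \<theta>) * sin \<theta>) has_integral
     integral {0..pi} (\<lambda>\<theta>. G \<theta> * sin \<theta>) + 2 * pi * integral {0..pi} (\<lambda>\<theta>. (V' \<theta>)\<^sup>2 * sin \<theta>)
       + integral {0..pi} (\<lambda>\<theta>. Q \<theta> * sin \<theta>)) {0..pi}"
    using has_integral_add[OF has_integral_add[OF i(2) has_integral_mult_right[OF i(5), of "2 * pi"]] i(3)]
    by (simp add: algebra_simps)
  then have I2: "polar_integral (\<lambda>\<theta> \<phi>. ((Ut \<theta> \<phi>)\<^sup>2 + (k \<theta> \<phi>)\<^sup>2) * sin \<theta>) =
    integral {0..pi} (\<lambda>\<theta>. G \<theta> * sin \<theta>) + 2 * pi * integral {0..pi} (\<lambda>\<theta>. (V' \<theta>)\<^sup>2 * sin \<theta>)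
       + integral {0..pi} (\<lambda>\<theta>. Q \<theta> * sin \<theta>)"
    unfolding polar_integral_def e2 by (rule integral_unique)
  have "(H has_integral (integral {0..pi} (\<lambda>\<theta>. G \<theta> * sin \<theta>) + integral {0..pi} (\<lambda>\<theta>. Q \<theta> * sin \<theta>)
     - 2 * integral {0..pi} (\<lambda>\<theta>. A \<theta> * sin \<theta>))) {0..pi}"
    unfolding H_def
    using has_integral_diff[OF has_integral_add[OF i(2) i(3)] has_integral_mult_right[OF i(1), of 2]]
    by (simp add: algebra_simps)
  then have I3: "integral {0..pi} H = integral {0..pi} (\<lambda>\<theta>. G \<theta> * sin \<theta>) +
      integral {0..pi} (\<lambda>\<theta>. Q \<theta> * sin \<theta>) - 2 * integral {0..pi} (\<lambda>\<theta>. A \<theta> * sin \<theta>)"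
    by (rule integral_unique)
  \<comment> \<open>The estimate for \<open>V\<close>, weighted with \<open>2 * pi\<close>, is added
    to the estimate \<open>0 \<le> integral {0..pi} H\<close> for \<open>g\<close>.\<close>
  have "2 * (a + 2 * pi * x) \<le> g + 2 * pi * y + q"
    if "2 * x \<le> y" "0 \<le> h" "h = g + q - 2 * a" for a g h q x y :: real
  proof -
    have "2 * pi * x = pi * (2 * x)" by simp
    also have "\<dots> \<le> pi * y" using that by (intro mult_left_mono) auto
    finally have "2 * pi * x \<le> pi * y" .
    moreover have "2 * pi * y = pi * y + pi * y" by simp
    moreover have "2 * (a + 2 * pi * x) = 2 * a + (2 * pi * x + 2 * pi * x)" by simp
    ultimately show ?thesis using that by linarith
  qed
  then show ?thesis unfolding I1 I2 using L * I3 by blast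
qed

end

section \<open>The mean curvature of a graph in a warped product\<close>

lemma matrix_inv_eqI:
  fixes A B :: "real ^ 'n ^ 'n"
  assumes "A ** B = mat 1"
  shows "matrix_inv A = B"
proof -
  have "B ** A = mat 1" using assms by (simp add: matrix_left_right_inverse)
  then have "A ** matrix_inv A = mat 1"
    unfolding matrix_inv_def using assms by (metis (mono_tags, lifting) someI_ex)
  then have "B ** (A ** matrix_inv A) = B" by simp
  then show ?thesis using \<open>B ** A = mat 1\<close> by (simp add: matrix_mul_assoc)
qed

lemma pd_eqI:
  assumes "(f has_derivative D) (at q)"
  shows "pd i f q = D (axis i 1)"
  using frechet_derivative_at[OF assms] by (simp add: pd_def)

lemma has_derivative_pd_sum:
  fixes f :: "real ^ 'n \<Rightarrow> real"
  assumes "f differentiable at q"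
  shows "(f has_derivative (\<lambda>h. \<Sum>j\<in>UNIV. pd j f q * h $ j)) (at q)"
proof -
  let ?D = "frechet_derivative f (at q)"
  have D: "(f has_derivative ?D) (at q)" using assms by (simp add: frechet_derivative_works)
  then have lin: "linear ?D" by (rule has_derivative_linear)
  have "?D h = (\<Sum>j\<in>UNIV. pd j f q * h $ j)" for h
  proof -
    have "?D h = ?D (\<Sum>j\<in>UNIV. h $ j *\<^sub>R axis j 1)"
      using basis_expansion[of h] by (simp add: scalar_mult_eq_scaleR)
    then show ?thesis
      using lin by (simp add: linear_sum linear_scale pd_def mult.commute)
  qed
  then have "?D = (\<lambda>h. \<Sum>j\<in>UNIV. pd j f q * h $ j)" by (rule ext)
  with D show ?thesis by simp
qed

lemma has_derivative_vec_nth: "((\<lambda>q. q $ n) has_derivative (\<lambda>h. h $ n)) F"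
  by (rule bounded_linear_imp_has_derivative) (rule bounded_linear_vec_nth)

lemma vector_3_axis: "vector [x, y, z] = x *\<^sub>R axis 1 1 + y *\<^sub>R axis 2 1 + z *\<^sub>R (axis 3 1 :: real ^ 3)"
  by (simp add: vec_eq_iff forall_3 axis_def)

definition warped_metric :: "(real \<Rightarrow> real) \<Rightarrow> real ^ 3 \<Rightarrow> real ^ 3 ^ 3" where
  "warped_metric \<rho> p =
     vector [vector [1, 0, 0],
             vector [0, (\<rho> (p $ 1))\<^sup>2, 0],
             vector [0, 0, (\<rho> (p $ 1))\<^sup>2 * (sin (p $ 2))\<^sup>2]]"

lemma warped_metric_pd:
  assumes \<rho>: "(\<rho> has_real_derivative P) (at (p $ 1))"
  shows "pd i (\<lambda>q. warped_metric \<rho> q $ j $ l) p =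
    (if j = 2 \<and> l = 2 \<and> i = 1 then 2 * \<rho> (p $ 1) * P
     else if j = 3 \<and> l = 3 \<and> i = 1 then 2 * \<rho> (p $ 1) * P * (sin (p $ 2))\<^sup>2
     else if j = 3 \<and> l = 3 \<and> i = 2 then 2 * (\<rho> (p $ 1))\<^sup>2 * sin (p $ 2) * cos (p $ 2)
     else 0)"
proof -
  have d: "((\<lambda>q. \<rho> (q $ 1)) has_derivative (\<lambda>h. h $ 1 * P)) (at p)"
    by (rule DERIV_compose_FDERIV[OF \<rho> has_derivative_vec_nth])
  have s: "((\<lambda>q. sin (q $ 2)) has_derivative (\<lambda>h. h $ 2 * cos (p $ 2))) (at p)"
    by (rule DERIV_compose_FDERIV[OF DERIV_sin has_derivative_vec_nth])
  have d2: "((\<lambda>q. (\<rho> (q $ 1))\<^sup>2) has_derivative (\<lambda>h. 2 * \<rho> (p $ 1) * (h $ 1 * P))) (at p)"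
    by (rule has_derivative_eq_rhs[OF has_derivative_power[OF d]]) (simp add: fun_eq_iff)
  have s2: "((\<lambda>q. (sin (q $ 2))\<^sup>2) has_derivative (\<lambda>h. 2 * sin (p $ 2) * (h $ 2 * cos (p $ 2)))) (at p)"
    by (rule has_derivative_eq_rhs[OF has_derivative_power[OF s]]) (simp add: fun_eq_iff)
  note a = pd_eqI[OF d2, of i]
  have "((\<lambda>q. (\<rho> (q $ 1))\<^sup>2 * (sin (q $ 2))\<^sup>2) has_derivative
    (\<lambda>h. (\<rho> (p $ 1))\<^sup>2 * (2 * sin (p $ 2) * (h $ 2 * cos (p $ 2))) +
          2 * \<rho> (p $ 1) * (h $ 1 * P) * (sin (p $ 2))\<^sup>2)) (at p)"
    by (rule has_derivative_mult[OF d2 s2])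
  note b = pd_eqI[OF this, of i]
  have c: "pd i (\<lambda>q. c) p = 0" for c :: real
    using pd_eqI[OF has_derivative_const, of i c p] by simp
  have G: "(\<lambda>q. warped_metric \<rho> q $ j $ l) =
    (if j = 2 \<and> l = 2 then (\<lambda>q. (\<rho> (q $ 1))\<^sup>2)
     else if j = 3 \<and> l = 3 then (\<lambda>q. (\<rho> (q $ 1))\<^sup>2 * (sin (q $ 2))\<^sup>2)
     else (\<lambda>q. if j = 1 \<and> l = 1 then 1 else 0))"
    using exhaust_3[of j] exhaust_3[of l] by (elim disjE) (simp_all add: warped_metric_def)
  have i: "axis i 1 $ 1 = (if i = 1 then 1 else 0 :: real)" "axis i 1 $ 2 = (if i = 2 then 1 else 0 :: real)"
    by (auto simp: axis_def)
  consider "j = 2 \<and> l = 2" | "j = 3 \<and> l = 3" | "\<not> (j = 2 \<and> l = 2)" "\<not> (j = 3 \<and> l = 3)" by blast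
  then show ?thesis
  proof cases
    case 1
    then have "(\<lambda>q. warped_metric \<rho> q $ j $ l) = (\<lambda>q. (\<rho> (q $ 1))\<^sup>2)" unfolding G by simp
    then have "pd i (\<lambda>q. warped_metric \<rho> q $ j $ l) p = 2 * \<rho> (p $ 1) * ((if i = 1 then 1 else 0) * P)"
      by (simp only: a i)
    then show ?thesis using 1 by simp
  next
    case 2
    then have "(\<lambda>q. warped_metric \<rho> q $ j $ l) = (\<lambda>q. (\<rho> (q $ 1))\<^sup>2 * (sin (q $ 2))\<^sup>2)" unfolding G by simp
    then have "pd i (\<lambda>q. warped_metric \<rho> q $ j $ l) p =
      (\<rho> (p $ 1))\<^sup>2 * (2 * sin (p $ 2) * ((if i = 2 then 1 else 0) * cos (p $ 2))) +
          2 * \<rho> (p $ 1) * ((if i = 1 then 1 else 0) * P) * (sin (p $ 2))\<^sup>2"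
      by (simp only: b i)
    then show ?thesis using 2 by simp
  next
    case 3
    then have "(\<lambda>q. warped_metric \<rho> q $ j $ l) = (\<lambda>q. if j = 1 \<and> l = 1 then 1 else 0)"
      unfolding G by (simp only: if_False)
    then have "pd i (\<lambda>q. warped_metric \<rho> q $ j $ l) p = 0" by (simp only: c)
    moreover have "(if j = 2 \<and> l = 2 \<and> i = 1 then x else if j = 3 \<and> l = 3 \<and> i = 1 then y
      else if j = 3 \<and> l = 3 \<and> i = 2 then z else 0) = 0" for x y z :: real
      using 3 by auto
    ultimately show ?thesis by simp
  qed
qed

lemma matrix_inv_warped_metric:
  assumes "\<rho> (p $ 1) > 0" "sin (p $ 2) > 0"
  shows "matrix_inv (warped_metric \<rho> p) =
     vector [vector [1, 0, 0],
             vector [0, 1 / (\<rho> (p $ 1))\<^sup>2, 0],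
             vector [0, 0, 1 / ((\<rho> (p $ 1))\<^sup>2 * (sin (p $ 2))\<^sup>2)]]"
  using assms
  by (intro matrix_inv_eqI)
    (simp add: warped_metric_def matrix_matrix_mult_def vec_eq_iff forall_3 sum_3 mat_def)

lemma matrix_inv_2:
  fixes M :: "real ^ 2 ^ 2"
  assumes "det M \<noteq> 0"
  shows "matrix_inv M = vector [vector [M $ 2 $ 2 / det M, - M $ 1 $ 2 / det M],
     vector [- M $ 2 $ 1 / det M, M $ 1 $ 1 / det M]]"
proof -
  have "M $ 1 $ 1 * M $ 2 $ 2 = det M + M $ 1 $ 2 * M $ 2 $ 1" by (simp add: det_2)
  then show ?thesis
    using assms
    by (intro matrix_inv_eqI)
      (simp add: matrix_matrix_mult_def vec_eq_iff forall_2 sum_2 mat_def add_divide_distrib mult.commute)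
qed

lemma has_derivative_vector_3:
  fixes a b c :: "'a::real_normed_vector \<Rightarrow> real"
  assumes "(a has_derivative a') F" "(b has_derivative b') F" "(c has_derivative c') F"
  shows "((\<lambda>q. vector [a q, b q, c q] :: real ^ 3) has_derivative (\<lambda>h. vector [a' h, b' h, c' h])) F"
unfolding vector_3_axis by (auto intro!: derivative_eq_intros assms)

lemma christoffel_warped_metric:
  assumes "(\<rho> has_real_derivative P) (at (p $ 1))"
    and "\<rho> (p $ 1) = R" "R > 0" "sin (p $ 2) = S" "S > 0" "cos (p $ 2) = C"
  shows "christoffel (warped_metric \<rho>) p k i j =
    (if k = 1 \<and> i = 2 \<and> j = 2 then - R * P
     else if k = 1 \<and> i = 3 \<and> j = 3 then - R * P * S\<^sup>2
     else if k = 2 \<and> (i = 1 \<and> j = 2 \<or> i = 2 \<and> j = 1) then P / R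
     else if k = 3 \<and> (i = 1 \<and> j = 3 \<or> i = 3 \<and> j = 1) then P / R
     else if k = 2 \<and> i = 3 \<and> j = 3 then - S * C
     else if k = 3 \<and> (i = 2 \<and> j = 3 \<or> i = 3 \<and> j = 2) then C / S
     else 0)"
  using exhaust_3[of k] exhaust_3[of i] exhaust_3[of j] assms
  by (elim disjE) (simp_all add: christoffel_def sum_3 warped_metric_pd[OF assms(1)]
      matrix_inv_warped_metric power2_eq_square)

text \<open>The trace is \<open>(I22 II11 + I11 II22 - I12 (II12 + II21)) / det I\<close> in terms
  of the two fundamental forms. Two of the three powers of \<open>w\<close> come from the
  determinant, the third from normalising the normal. The two mixed second derivatives are kept
  apart because the divergence form also produces them separately.\<close>

lemma mean_curvature_graph:
  fixes f :: "real ^ 2 \<Rightarrow> real"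
  assumes f: "\<And>q. f differentiable at q"
    and f2: "\<And>a. pd a f differentiable at q"
    and \<rho>: "(\<rho> has_real_derivative P) (at (f q))"
    and R: "\<rho> (f q) = R" "R > 0" and S: "sin (q $ 1) = S" "S > 0" and C: "cos (q $ 1) = C"
    and ab: "pd 1 f q = a" "pd 2 f q = b"
    and w: "w = sqrt (1 + a\<^sup>2 / R\<^sup>2 + b\<^sup>2 / (R\<^sup>2 * S\<^sup>2))"
  shows "mean_curvature (warped_metric \<rho>) (\<lambda>q. vector [f q, q $ 1, q $ 2]) q =
     - ((b\<^sup>2 + R\<^sup>2 * S\<^sup>2) * (pd 1 (pd 1 f) q - R * P - 2 * a\<^sup>2 * P / R)
        + (a\<^sup>2 + R\<^sup>2) * (pd 2 (pd 2 f) q - R * P * S\<^sup>2 + S * C * a - 2 * b\<^sup>2 * P / R)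
        - a * b * (pd 1 (pd 2 f) q + pd 2 (pd 1 f) q - 4 * a * b * P / R - 2 * b * C / S))
      / (R ^ 4 * S\<^sup>2 * w ^ 3)"
proof -
  define X where "X = (\<lambda>q. vector [f q, q $ 1, q $ 2] :: real ^ 3)"
  have X1: "pd i X = (\<lambda>q. vector [pd i f q, axis i 1 $ 1, axis i 1 $ 2])" for i
  proof
    fix q
    show "pd i X q = vector [pd i f q, axis i 1 $ 1, axis i 1 $ 2]"
      unfolding X_def
      using pd_eqI[OF has_derivative_vector_3[OF has_derivative_pd_sum[OF f] has_derivative_vec_nth has_derivative_vec_nth], of i 1 2 q]
        exhaust_2[of i]
      by (elim disjE) (simp_all add: axis_def sum_2)
  qed
  have X2: "pd j (pd i X) q = vector [pd j (pd i f) q, 0, 0]" for i j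
    unfolding X1
    using pd_eqI[OF has_derivative_vector_3[OF has_derivative_pd_sum[OF f2] has_derivative_const
        has_derivative_const], of j i "axis i 1 $ 1" "axis i 1 $ 2"] exhaust_2[of j]
    by (elim disjE) (simp_all add: axis_def sum_2)
  have Xq: "X q $ 1 = f q" "X q $ 2 = q $ 1" by (simp_all add: X_def)
  have Xd: "pd 1 X q = vector [a, 1, 0]" "pd 2 X q = vector [b, 0, 1]"
    by (simp_all add: X1 ab axis_def)
  note chr = christoffel_warped_metric[where p = "X q" and \<rho> = \<rho> and P = P and R = R and S = S and C = C,
      unfolded Xq, OF \<rho> R S C]
  define F where "F = (\<lambda>i j. pd i (pd j f) q)"
  have cov: "cov_deriv (warped_metric \<rho>) X q 1 1 = vector [F 1 1 - R * P, 2 * a * P / R, 0]"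
    "cov_deriv (warped_metric \<rho>) X q 1 2 = vector [F 1 2, b * P / R, a * P / R + C / S]"
    "cov_deriv (warped_metric \<rho>) X q 2 1 = vector [F 2 1, b * P / R, a * P / R + C / S]"
    "cov_deriv (warped_metric \<rho>) X q 2 2 = vector [F 2 2 - R * P * S\<^sup>2, - S * C, 2 * b * P / R]"
    by (simp_all add: cov_deriv_def X2 Xd chr sum_3 vec_eq_iff forall_3 F_def)
  have G: "warped_metric \<rho> (X q) = vector [vector [1, 0, 0], vector [0, R\<^sup>2, 0], vector [0, 0, R\<^sup>2 * S\<^sup>2]]"
    by (simp add: warped_metric_def Xq R S)
  have Ginv: "matrix_inv (warped_metric \<rho> (X q)) =
     vector [vector [1, 0, 0], vector [0, 1 / R\<^sup>2, 0], vector [0, 0, 1 / (R\<^sup>2 * S\<^sup>2)]]"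
    using matrix_inv_warped_metric[of \<rho> "X q"] R S by (simp add: Xq)
  have gi: "ginner (warped_metric \<rho>) (X q) u v = u $ 1 * v $ 1 + R\<^sup>2 * u $ 2 * v $ 2 + R\<^sup>2 * S\<^sup>2 * u $ 3 * v $ 3" for u v
    by (simp add: ginner_def G matrix_vector_mult_def inner_vec_def sum_3)
  \<comment> \<open>The cross product is the covector \<open>(1, - a, - b)\<close>, the differential
    of \<open>s - f\<close>; its first entry shows that the normal points outward.\<close>
  have N: "matrix_inv (warped_metric \<rho> (X q)) *v cross3 (pd 1 X q) (pd 2 X q) =
      vector [1, - a / R\<^sup>2, - b / (R\<^sup>2 * S\<^sup>2)]"
    by (simp add: Ginv Xd matrix_vector_mult_def cross3_def sum_3 vec_eq_iff forall_3)
  have w2: "w\<^sup>2 = 1 + a\<^sup>2 / R\<^sup>2 + b\<^sup>2 / (R\<^sup>2 * S\<^sup>2)"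
    unfolding w by (intro real_sqrt_pow2 add_nonneg_nonneg) auto
  have w0: "w > 0" unfolding w by (intro real_sqrt_gt_zero add_pos_nonneg) auto
  have un: "unit_normal (warped_metric \<rho>) X q = (1 / w) *\<^sub>R vector [1, - a / R\<^sup>2, - b / (R\<^sup>2 * S\<^sup>2)]"
  proof -
    have "1 + R\<^sup>2 * (a / R\<^sup>2 * (a / R\<^sup>2)) + R\<^sup>2 * S\<^sup>2 * (b / (R\<^sup>2 * S\<^sup>2) * (b / (R\<^sup>2 * S\<^sup>2)))
       = 1 + a\<^sup>2 / R\<^sup>2 + b\<^sup>2 / (R\<^sup>2 * S\<^sup>2)"
      using R S by (simp add: power2_eq_square)
    then show ?thesis
      unfolding unit_normal_def N Let_def gi w by (simp add: divide_inverse mult_ac)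
  qed
  have I: "first_form (warped_metric \<rho>) X q =
     vector [vector [a\<^sup>2 + R\<^sup>2, a * b], vector [a * b, b\<^sup>2 + R\<^sup>2 * S\<^sup>2]]"
    by (simp add: first_form_def gi Xd vec_eq_iff forall_2 power2_eq_square)
  have II: "second_form (warped_metric \<rho>) X q =
     vector [vector [- (F 1 1 - R * P - 2 * a\<^sup>2 * P / R) / w,
                     - (F 1 2 - 2 * a * b * P / R - b * C / S) / w],
             vector [- (F 2 1 - 2 * a * b * P / R - b * C / S) / w,
                     - (F 2 2 - R * P * S\<^sup>2 + S * C * a - 2 * b\<^sup>2 * P / R) / w]]"
    using R S w0
    by (simp add: second_form_def gi un cov vec_eq_iff forall_2 field_simps power2_eq_square)
  have det: "det (first_form (warped_metric \<rho>) X q) = R ^ 4 * S\<^sup>2 * w\<^sup>2"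
    unfolding w2 I using R S by (simp add: det_2 field_simps power2_eq_square power4_eq_xxxx)
  then have d0: "det (first_form (warped_metric \<rho>) X q) \<noteq> 0" using R S w0 by simp
  have "mean_curvature (warped_metric \<rho>) X q =
     - ((b\<^sup>2 + R\<^sup>2 * S\<^sup>2) * (F 1 1 - R * P - 2 * a\<^sup>2 * P / R)
        + (a\<^sup>2 + R\<^sup>2) * (F 2 2 - R * P * S\<^sup>2 + S * C * a - 2 * b\<^sup>2 * P / R)
        - a * b * (F 1 2 + F 2 1 - 4 * a * b * P / R - 2 * b * C / S)) / w
      / (R ^ 4 * S\<^sup>2 * w\<^sup>2)"
    unfolding mean_curvature_def matrix_inv_2[OF d0] det
    unfolding I II
    using R S w0 by (simp add: trace_def matrix_matrix_mult_def sum_2 diff_divide_distrib add_divide_distrib algebra_simps)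
  also have "\<dots> = - ((b\<^sup>2 + R\<^sup>2 * S\<^sup>2) * (F 1 1 - R * P - 2 * a\<^sup>2 * P / R)
        + (a\<^sup>2 + R\<^sup>2) * (F 2 2 - R * P * S\<^sup>2 + S * C * a - 2 * b\<^sup>2 * P / R)
        - a * b * (F 1 2 + F 2 1 - 4 * a * b * P / R - 2 * b * C / S))
      / (R ^ 4 * S\<^sup>2 * w ^ 3)"
    by (simp add: power3_eq_cube power2_eq_square mult_ac)
  finally show ?thesis unfolding X_def F_def .
qed

section \<open>Graphs of constant mean curvature near a strictly stable slice\<close>

text \<open>The left-hand side of \<open>cmc\<close> is \<open>\<partial>\<^sub>\<theta> (sin \<theta> Ut / N) + \<partial>\<^sub>\<phi> (k / N)\<close> with the derivatives written out.\<close>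

locale cmc_function = sphere_function +
  fixes \<rho> \<rho>' \<rho>'' :: "real \<Rightarrow> real" and l c :: real and N :: "real \<Rightarrow> real \<Rightarrow> real"
  defines "N \<equiv> \<lambda>\<theta> \<phi>. sqrt ((\<rho> (U \<theta> \<phi>))\<^sup>2 + (Ut \<theta> \<phi>)\<^sup>2 + (k \<theta> \<phi>)\<^sup>2)"
  assumes \<rho>_deriv: "\<And>x. x > l \<Longrightarrow> (\<rho> has_real_derivative \<rho>' x) (at x)"
    and \<rho>'_deriv: "\<And>x. x > l \<Longrightarrow> (\<rho>' has_real_derivative \<rho>'' x) (at x)"
    and \<rho>_pos: "\<And>x. x > l \<Longrightarrow> \<rho> x > 0"
    and U_gt: "\<And>\<theta> \<phi>. U \<theta> \<phi> > l"
    and cmc: "\<And>\<theta> \<phi>. 0 < \<theta> \<Longrightarrow> \<theta> < pi \<Longrightarrow>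
      (cos \<theta> * Ut \<theta> \<phi> + sin \<theta> * Utt \<theta> \<phi>) / N \<theta> \<phi>
        - sin \<theta> * Ut \<theta> \<phi> * (\<rho> (U \<theta> \<phi>) * \<rho>' (U \<theta> \<phi>) * Ut \<theta> \<phi>
            + Ut \<theta> \<phi> * Utt \<theta> \<phi> + k \<theta> \<phi> * kt \<theta> \<phi>) / N \<theta> \<phi> ^ 3
        + kp \<theta> \<phi> / N \<theta> \<phi>
        - k \<theta> \<phi> * (\<rho> (U \<theta> \<phi>) * \<rho>' (U \<theta> \<phi>) * (sin \<theta> * k \<theta> \<phi>)
            + Ut \<theta> \<phi> * Utp \<theta> \<phi> + k \<theta> \<phi> * kp \<theta> \<phi>) / N \<theta> \<phi> ^ 3
      = (2 * \<rho>' (U \<theta> \<phi>) * \<rho> (U \<theta> \<phi>) / N \<theta> \<phi> - c * \<rho> (U \<theta> \<phi>)) * sin \<theta>"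
begin

lemma \<rho>U_pos: "\<rho> (U \<theta> \<phi>) > 0"
  using \<rho>_pos U_gt by blast

lemma N_pos: "N \<theta> \<phi> > 0"
  unfolding N_def using \<rho>U_pos[of \<theta> \<phi>] by (intro real_sqrt_gt_zero add_pos_nonneg) auto

lemma N_ge: "N \<theta> \<phi> \<ge> \<rho> (U \<theta> \<phi>)"
  unfolding N_def using \<rho>U_pos[of \<theta> \<phi>] by (intro real_le_rsqrt) auto

lemma N_squared: "(N \<theta> \<phi>)\<^sup>2 = (\<rho> (U \<theta> \<phi>))\<^sup>2 + (Ut \<theta> \<phi>)\<^sup>2 + (k \<theta> \<phi>)\<^sup>2"
  unfolding N_def by (intro real_sqrt_pow2) auto

lemma continuous_on_\<rho>U [continuous_intros]:
  assumes "continuous_on S f" "continuous_on S g"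
  shows "continuous_on S (\<lambda>x. \<rho> (U (f x) (g x)))" "continuous_on S (\<lambda>x. \<rho>' (U (f x) (g x)))"
proof -
  have U: "continuous_on S (\<lambda>x. U (f x) (g x))" using assms by (intro continuous_intros)
  have "continuous_on {l<..} \<rho>" "continuous_on {l<..} \<rho>'"
    using \<rho>_deriv \<rho>'_deriv DERIV_isCont by (blast intro: continuous_at_imp_continuous_on)+
  then show "continuous_on S (\<lambda>x. \<rho> (U (f x) (g x)))" "continuous_on S (\<lambda>x. \<rho>' (U (f x) (g x)))"
    using U U_gt by (auto intro: continuous_on_compose2)
qed

lemma continuous_on_N [continuous_intros]:
  assumes "continuous_on S f" "continuous_on S g"
  shows "continuous_on S (\<lambda>x. N (f x) (g x))"
  unfolding N_def using assms by (intro continuous_intros)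

lemma N_nz [simp]: "N \<theta> \<phi> \<noteq> 0"
  using N_pos[of \<theta> \<phi>] by simp

lemma N_t: "((\<lambda>\<theta>. N \<theta> \<phi>) has_real_derivative
    (\<rho> (U \<theta> \<phi>) * \<rho>' (U \<theta> \<phi>) * Ut \<theta> \<phi> + Ut \<theta> \<phi> * Utt \<theta> \<phi> + k \<theta> \<phi> * kt \<theta> \<phi>) / N \<theta> \<phi>) (at \<theta>)"
  and N_p: "((\<lambda>\<phi>. N \<theta> \<phi>) has_real_derivative
    (\<rho> (U \<theta> \<phi>) * \<rho>' (U \<theta> \<phi>) * (sin \<theta> * k \<theta> \<phi>) + Ut \<theta> \<phi> * Utp \<theta> \<phi> + k \<theta> \<phi> * kp \<theta> \<phi>) / N \<theta> \<phi>) (at \<phi>)"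
proof -
  have r: "((\<lambda>x. \<rho> (h x)) has_real_derivative \<rho>' (h x) * D) (at x)"
    if "h x > l" "(h has_real_derivative D) (at x)" for h x D
    using DERIV_chain2[OF \<rho>_deriv[OF that(1)] that(2)] .
  have pos: "(\<rho> (U \<theta> \<phi>))\<^sup>2 + (Ut \<theta> \<phi>)\<^sup>2 + (k \<theta> \<phi>)\<^sup>2 > 0"
    using N_squared[of \<theta> \<phi>] N_pos[of \<theta> \<phi>] by (metis zero_less_power)
  have sq: "((\<lambda>x. sqrt ((\<rho> (h x))\<^sup>2 + (a x)\<^sup>2 + (b x)\<^sup>2)) has_real_derivative
      (\<rho> (h x) * \<rho>' (h x) * h' + a x * a' + b x * b') / sqrt ((\<rho> (h x))\<^sup>2 + (a x)\<^sup>2 + (b x)\<^sup>2)) (at x)"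
    if h: "h x > l" "(h has_real_derivative h') (at x)"
      and a: "(a has_real_derivative a') (at x)" and b: "(b has_real_derivative b') (at x)"
      and pos: "(\<rho> (h x))\<^sup>2 + (a x)\<^sup>2 + (b x)\<^sup>2 > 0"
    for h a b h' a' b' x
  proof -
    have "((\<lambda>x. (\<rho> (h x))\<^sup>2 + (a x)\<^sup>2 + (b x)\<^sup>2) has_real_derivative
        2 * (\<rho> (h x) * \<rho>' (h x) * h' + a x * a' + b x * b')) (at x)"
      by (rule DERIV_cong[OF DERIV_add[OF DERIV_add[OF DERIV_power[OF r[OF h], of 2]
            DERIV_power[OF a, of 2]] DERIV_power[OF b, of 2]]]) (simp add: algebra_simps)
    note d = DERIV_chain2[where f = sqrt and g = "\<lambda>x. (\<rho> (h x))\<^sup>2 + (a x)\<^sup>2 + (b x)\<^sup>2",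
        OF DERIV_real_sqrt[OF pos] this]
    have "inverse s / 2 * (2 * y) = y / s" for s y :: real by (simp add: inverse_eq_divide)
    then show ?thesis using d by (simp only:)
  qed
  show "((\<lambda>\<theta>. N \<theta> \<phi>) has_real_derivative
    (\<rho> (U \<theta> \<phi>) * \<rho>' (U \<theta> \<phi>) * Ut \<theta> \<phi> + Ut \<theta> \<phi> * Utt \<theta> \<phi> + k \<theta> \<phi> * kt \<theta> \<phi>) / N \<theta> \<phi>) (at \<theta>)"
    unfolding N_def by (rule sq[OF U_gt U_t Ut_t k_t pos])
  show "((\<lambda>\<phi>. N \<theta> \<phi>) has_real_derivative
    (\<rho> (U \<theta> \<phi>) * \<rho>' (U \<theta> \<phi>) * (sin \<theta> * k \<theta> \<phi>) + Ut \<theta> \<phi> * Utp \<theta> \<phi> + k \<theta> \<phi> * kp \<theta> \<phi>) / N \<theta> \<phi>) (at \<phi>)"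
    unfolding N_def by (rule sq[OF U_gt U_p Ut_p k_p pos])
qed

text \<open>The poles contribute no boundary term because the flux through a parallel carries
  the factor \<open>sin \<theta>\<close>.\<close>

lemma weak_cmc:
  "polar_integral (\<lambda>\<theta> \<phi>. b * ((Ut \<theta> \<phi>)\<^sup>2 + (k \<theta> \<phi>)\<^sup>2) / N \<theta> \<phi> * sin \<theta>
    + (a + b * U \<theta> \<phi>) * ((2 * \<rho>' (U \<theta> \<phi>) * \<rho> (U \<theta> \<phi>) / N \<theta> \<phi> - c * \<rho> (U \<theta> \<phi>)) * sin \<theta>)) = 0"
  (is "polar_integral ?R = 0")
proof -
  \<comment> \<open>\<open>D\<close> and \<open>E\<close> are the two coordinate derivatives of the
    flux multiplied by the test function \<open>a + b * U\<close>. All derivatives without assumed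
    continuity, \<open>Utp\<close> and \<open>kp\<close>, are collected in \<open>E\<close>;
    \<open>D\<close> is continuous and can be handled by differentiation under the integral.\<close>
  define D where "D = (\<lambda>\<theta> \<phi>. ((cos \<theta> * Ut \<theta> \<phi> + sin \<theta> * Utt \<theta> \<phi>) / N \<theta> \<phi>
        - sin \<theta> * Ut \<theta> \<phi> * (\<rho> (U \<theta> \<phi>) * \<rho>' (U \<theta> \<phi>) * Ut \<theta> \<phi>
            + Ut \<theta> \<phi> * Utt \<theta> \<phi> + k \<theta> \<phi> * kt \<theta> \<phi>) / N \<theta> \<phi> ^ 3) * (a + b * U \<theta> \<phi>)
        + sin \<theta> * Ut \<theta> \<phi> / N \<theta> \<phi> * (b * Ut \<theta> \<phi>))"
  define E where "E = (\<lambda>\<theta> \<phi>. (kp \<theta> \<phi> / N \<theta> \<phi>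
        - k \<theta> \<phi> * (\<rho> (U \<theta> \<phi>) * \<rho>' (U \<theta> \<phi>) * (sin \<theta> * k \<theta> \<phi>)
            + Ut \<theta> \<phi> * Utp \<theta> \<phi> + k \<theta> \<phi> * kp \<theta> \<phi>) / N \<theta> \<phi> ^ 3) * (a + b * U \<theta> \<phi>)
        + k \<theta> \<phi> / N \<theta> \<phi> * (b * (sin \<theta> * k \<theta> \<phi>)))"
  define F where "F = (\<lambda>\<theta> \<phi>. sin \<theta> * Ut \<theta> \<phi> / N \<theta> \<phi> * (a + b * U \<theta> \<phi>))"
  define J where "J = (\<lambda>\<theta>. integral {0..2*pi} (F \<theta>))"
  have F_t: "((\<lambda>\<theta>. F \<theta> \<phi>) has_real_derivative D \<theta> \<phi>) (at \<theta>)" for \<theta> \<phi>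
    unfolding F_def D_def
    by (rule derivative_eq_intros refl Ut_t U_t N_t N_nz)+
      (simp add: field_simps power2_eq_square power3_eq_cube)
  \<comment> \<open>The gauge integral integrates every derivative, so continuity of
    \<open>E\<close> is not an issue; periodicity makes the result 0.\<close>
  have E_int: "(E \<theta> has_integral 0) {0..2*pi}" for \<theta>
  proof -
    have "((\<lambda>\<phi>. k \<theta> \<phi> / N \<theta> \<phi> * (a + b * U \<theta> \<phi>)) has_real_derivative E \<theta> \<phi>) (at \<phi>)" for \<phi>
      unfolding E_def
      by (rule derivative_eq_intros refl k_p U_p N_p N_nz)+
        (simp add: field_simps power2_eq_square power3_eq_cube)
    then have "(E \<theta> has_integral (k \<theta> (2*pi) / N \<theta> (2*pi) * (a + b * U \<theta> (2*pi))
        - k \<theta> 0 / N \<theta> 0 * (a + b * U \<theta> 0))) {0..2*pi}"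
      by (intro fundamental_theorem_of_calculus)
        (auto simp: has_real_derivative_iff_has_vector_derivative[symmetric]
          intro: has_field_derivative_at_within)
    moreover have "k \<theta> (2*pi) = k \<theta> 0" "U \<theta> (2*pi) = U \<theta> 0" "N \<theta> (2*pi) = N \<theta> 0"
      using per_k[of \<theta> 0] per_U[of \<theta> 0] per_Ut[of \<theta> 0] by (auto simp: N_def)
    ultimately show ?thesis by simp
  qed
  have DE: "D \<theta> \<phi> + E \<theta> \<phi> = ?R \<theta> \<phi>" if "0 < \<theta>" "\<theta> < pi" for \<theta> \<phi>
  proof -
    have "D \<theta> \<phi> + E \<theta> \<phi> = ((cos \<theta> * Ut \<theta> \<phi> + sin \<theta> * Utt \<theta> \<phi>) / N \<theta> \<phi>
        - sin \<theta> * Ut \<theta> \<phi> * (\<rho> (U \<theta> \<phi>) * \<rho>' (U \<theta> \<phi>) * Ut \<theta> \<phi>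
            + Ut \<theta> \<phi> * Utt \<theta> \<phi> + k \<theta> \<phi> * kt \<theta> \<phi>) / N \<theta> \<phi> ^ 3
        + kp \<theta> \<phi> / N \<theta> \<phi>
        - k \<theta> \<phi> * (\<rho> (U \<theta> \<phi>) * \<rho>' (U \<theta> \<phi>) * (sin \<theta> * k \<theta> \<phi>)
            + Ut \<theta> \<phi> * Utp \<theta> \<phi> + k \<theta> \<phi> * kp \<theta> \<phi>) / N \<theta> \<phi> ^ 3) * (a + b * U \<theta> \<phi>)
        + b * ((Ut \<theta> \<phi>)\<^sup>2 + (k \<theta> \<phi>)\<^sup>2) / N \<theta> \<phi> * sin \<theta>"
      unfolding D_def E_def by (simp only: distrib_right left_diff_distrib)
        (simp add: power2_eq_square add_divide_distrib algebra_simps)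
    then show ?thesis unfolding cmc[OF that] by (simp only: mult_ac add_ac)
  qed
  have Rc: "polar_continuous ?R"
    unfolding polar_continuous_def case_prod_unfold by (intro continuous_intros) simp_all
  \<comment> \<open>The equation holds between the poles only; continuity of \<open>J\<close> on the
    closed interval then suffices for the fundamental theorem.\<close>
  have J_t: "(J has_vector_derivative integral {0..2*pi} (?R \<theta>)) (at \<theta>)" if \<theta>: "0 < \<theta>" "\<theta> < pi" for \<theta>
  proof -
    have "(J has_real_derivative integral {0..2*pi} (D \<theta>)) (at \<theta>)"
      unfolding J_def
    proof (rule integral_param_has_derivative[where a = 0 and b = pi])
      show "continuous_on ({0<..<pi} \<times> UNIV) (\<lambda>x. D (fst x) (snd x))"
        unfolding D_def by (intro continuous_intros) simp_all
      show "F \<theta> integrable_on {0..2*pi}" for \<theta>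
        unfolding F_def by (intro integrable_continuous_real continuous_intros) simp_all
    qed (use F_t \<theta> in auto)
    moreover have "integral {0..2*pi} (D \<theta>) = integral {0..2*pi} (?R \<theta>)"
    proof (rule integral_unique)
      have "(?R \<theta> has_integral integral {0..2*pi} (?R \<theta>)) {0..2*pi}"
        using polar_continuous_inner[OF Rc, of \<theta>] \<theta> by (intro integrable_integral) auto
      from has_integral_diff[OF this E_int[of \<theta>]]
      have "((\<lambda>\<phi>. ?R \<theta> \<phi> - E \<theta> \<phi>) has_integral integral {0..2*pi} (?R \<theta>)) {0..2*pi}"
        by simp
      moreover have "(\<lambda>\<phi>. ?R \<theta> \<phi> - E \<theta> \<phi>) = D \<theta>"
        using DE[OF \<theta>] by (auto simp: fun_eq_iff diff_eq_eq)
      ultimately show "(D \<theta> has_integral integral {0..2*pi} (?R \<theta>)) {0..2*pi}"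
        by (simp only:)
    qed
    ultimately show ?thesis by (simp add: has_real_derivative_iff_has_vector_derivative)
  qed
  have "continuous_on {0..pi} J" unfolding J_def
  proof (rule polar_continuous_outer)
    show "polar_continuous F"
      unfolding polar_continuous_def case_prod_unfold F_def by (intro continuous_intros) simp_all
  qed
  then have "((\<lambda>\<theta>. integral {0..2*pi} (?R \<theta>)) has_integral J pi - J 0) {0..pi}"
    using J_t by (intro fundamental_theorem_of_calculus_interior) auto
  then show ?thesis by (simp add: polar_integral_def J_def F_def integral_unique)
qed


lemma polar_integral_sin_pos:
  assumes F: "polar_continuous F" and pos: "\<And>\<theta> \<phi>. F \<theta> \<phi> > 0"
  shows "polar_integral (\<lambda>\<theta> \<phi>. F \<theta> \<phi> * sin \<theta>) > 0"
proof -
  have cont: "polar_continuous (\<lambda>\<theta> \<phi>. F \<theta> \<phi> * sin \<theta>)"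
    using F unfolding polar_continuous_def case_prod_unfold by (intro continuous_intros)
  have nn: "F \<theta> \<phi> * sin \<theta> \<ge> 0" if "0 \<le> \<theta>" "\<theta> \<le> pi" for \<theta> \<phi>
    using pos[of \<theta> \<phi>] sin_ge_zero[OF that] by simp
  have zero: "polar_continuous (\<lambda>\<theta> \<phi>. 0)" by (simp add: polar_continuous_def case_prod_unfold)
  have "polar_integral (\<lambda>\<theta> \<phi>. F \<theta> \<phi> * sin \<theta>) \<ge> polar_integral (\<lambda>\<theta> \<phi>. 0)"
    by (rule polar_integral_mono[OF zero cont]) (simp add: nn)
  \<comment> \<open>The weight vanishes at the poles, so strict positivity is read off on the
    equator.\<close>
  moreover have "polar_integral (\<lambda>\<theta> \<phi>. F \<theta> \<phi> * sin \<theta>) \<noteq> 0"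
    using polar_integral_eq_0[OF cont nn, of "pi / 2" 0] pos[of "pi / 2" 0] by auto
  ultimately show ?thesis by (simp add: polar_integral_def)
qed

text \<open>If \<open>mean\<close> lay outside the bounds, \<open>U - mean\<close> would have a
  strict sign, although its weighted integral is zero.\<close>

lemma mean_bounds:
  assumes "\<And>\<theta> \<phi>. m \<le> U \<theta> \<phi> \<and> U \<theta> \<phi> \<le> M"
  shows "m \<le> mean" "mean \<le> M"
proof -
  show "m \<le> mean"
  proof (rule ccontr)
    assume "\<not> m \<le> mean"
    then have "polar_integral (\<lambda>\<theta> \<phi>. (U \<theta> \<phi> - mean) * sin \<theta>) > 0"
      using assms by (intro polar_integral_sin_pos)
        (auto simp: polar_continuous_def case_prod_unfold not_le intro!: continuous_intros
          intro: less_le_trans)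
    then show False using polar_integral_mean by simp
  qed
  show "mean \<le> M"
  proof (rule ccontr)
    assume "\<not> mean \<le> M"
    then have "polar_integral (\<lambda>\<theta> \<phi>. (mean - U \<theta> \<phi>) * sin \<theta>) > 0"
      using assms by (intro polar_integral_sin_pos)
        (auto simp: polar_continuous_def case_prod_unfold not_le intro!: continuous_intros
          intro: le_less_trans)
    moreover have "polar_integral (\<lambda>\<theta> \<phi>. (mean - U \<theta> \<phi>) * sin \<theta>) =
        polar_integral (\<lambda>\<theta> \<phi>. (-1) * ((U \<theta> \<phi> - mean) * sin \<theta>))"
      by (simp add: algebra_simps)
    ultimately show False using polar_integral_mean unfolding polar_integral_cmult by simp
  qed
qed

text \<open>The weighted integral of \<open>(2 \<rho>' / N - c) \<rho>\<close> is zero and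
  \<open>\<rho>\<close> is positive, so \<open>2 \<rho>' / N - c\<close> takes values of both weak
  signs. Hence \<open>c\<close> lies between two values of \<open>2 \<rho>' / N\<close>.\<close>

lemma cmc_constant_bounds:
  assumes "\<And>\<theta> \<phi>. \<bar>2 * \<rho>' (U \<theta> \<phi>) / N \<theta> \<phi> - c0\<bar> \<le> \<epsilon>"
  shows "\<bar>c - c0\<bar> \<le> \<epsilon>"
proof -
  define G where "G = (\<lambda>\<theta> \<phi>. (2 * \<rho>' (U \<theta> \<phi>) / N \<theta> \<phi> - c) * \<rho> (U \<theta> \<phi>))"
  have "G \<theta> \<phi> * sin \<theta> = (2 * \<rho>' (U \<theta> \<phi>) * \<rho> (U \<theta> \<phi>) / N \<theta> \<phi> - c * \<rho> (U \<theta> \<phi>)) * sin \<theta>" for \<theta> \<phi>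
    by (simp add: G_def left_diff_distrib)
  then have 0: "polar_integral (\<lambda>\<theta> \<phi>. G \<theta> \<phi> * sin \<theta>) = 0"
    \<comment> \<open>The instance is \<open>b = 0\<close>, \<open>a = 1\<close>, so the test
      function is the constant 1.\<close>
    using weak_cmc[of 0 1] by (simp only: mult_zero_left div_0 add_0_left add_0_right mult_1_left)
  have Gc: "polar_continuous G"
    unfolding G_def polar_continuous_def case_prod_unfold by (intro continuous_intros) simp_all
  then have Gc': "polar_continuous (\<lambda>\<theta> \<phi>. - G \<theta> \<phi>)"
    unfolding polar_continuous_def case_prod_unfold by (intro continuous_intros)
  have "polar_integral (\<lambda>\<theta> \<phi>. - G \<theta> \<phi> * sin \<theta>) = 0"
    using 0 polar_integral_cmult[of "-1" "\<lambda>\<theta> \<phi>. G \<theta> \<phi> * sin \<theta>"] by simp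
  then have "\<not> (\<forall>\<theta> \<phi>. - G \<theta> \<phi> > 0)" using polar_integral_sin_pos[OF Gc'] by force
  moreover have "\<not> (\<forall>\<theta> \<phi>. G \<theta> \<phi> > 0)" using polar_integral_sin_pos[OF Gc] 0 by force
  ultimately have "\<exists>\<theta> \<phi>. 2 * \<rho>' (U \<theta> \<phi>) / N \<theta> \<phi> - c \<ge> 0" "\<exists>\<theta> \<phi>. 2 * \<rho>' (U \<theta> \<phi>) / N \<theta> \<phi> - c \<le> 0"
    using \<rho>U_pos unfolding G_def by (force simp: zero_less_mult_iff mult_less_0_iff not_less)+
  then show ?thesis using assms by (smt (verit))
qed

text \<open>The right-hand side of the equation is split as
  \<open>g(U) - 2 \<rho>'(U) (1 - \<rho>(U) / N)\<close>, up to the factor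
  \<open>sin \<theta>\<close>, with \<open>g = 2 \<rho>' - c \<rho>\<close>. Tested with
  \<open>U - m\<close>, the first part costs at most \<open>\<kappa>\<close> times the square of
  \<open>U - m\<close>, and the second is absorbed by the Dirichlet term, leaving the weight
  \<open>\<mu>\<close>. With the Poincare inequality this yields
  \<open>(2 * \<mu> - \<kappa>)\<close> times the integral of the square being at most 0.\<close>

lemma cmc_imp_constant:
  assumes J: "\<And>\<theta> \<phi>. U \<theta> \<phi> \<in> {x1..x2}" "x1 > l"
    and c0: "\<And>\<theta> \<phi>. \<bar>2 * \<rho>' (U \<theta> \<phi>) / N \<theta> \<phi> - c0\<bar> \<le> \<epsilon>"
    and lam: "\<And>\<theta> \<phi>. \<mu> \<le> 1 / N \<theta> \<phi> * (1 - 2 * \<rho>' (U \<theta> \<phi>) * \<bar>U \<theta> \<phi> - mean\<bar> / \<rho> (U \<theta> \<phi>))"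
    and \<rho>'nn: "\<And>\<theta> \<phi>. \<rho>' (U \<theta> \<phi>) \<ge> 0"
    and kap: "\<And>x c. x \<in> {x1..x2} \<Longrightarrow> \<bar>c - c0\<bar> \<le> \<epsilon> \<Longrightarrow> 2 * \<rho>'' x - c * \<rho>' x \<ge> - \<kappa>"
    and lk: "0 \<le> \<mu>" "\<kappa> < 2 * \<mu>"
    and "0 \<le> \<theta>" "\<theta> \<le> pi" "0 \<le> \<phi>" "\<phi> \<le> 2 * pi"
  shows "U \<theta> \<phi> = mean"
proof -
  define m where "m = mean"
  define g where "g = (\<lambda>x. 2 * \<rho>' x - c * \<rho> x)"
  define T where "T = (\<lambda>\<theta> \<phi>. (Ut \<theta> \<phi>)\<^sup>2 + (k \<theta> \<phi>)\<^sup>2)"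
  have m: "m \<in> {x1..x2}" using mean_bounds[of x1 x2] J by (auto simp: m_def)
  have c: "\<bar>c - c0\<bar> \<le> \<epsilon>" by (rule cmc_constant_bounds[OF c0])
  have g': "(g has_real_derivative 2 * \<rho>'' x - c * \<rho>' x) (at x)" if "x \<in> {x1..x2}" for x
    unfolding g_def using that J(2) by (auto intro!: derivative_eq_intros \<rho>'_deriv \<rho>_deriv)
  \<comment> \<open>The lower bound in \<open>kap\<close> is a bound for the derivative of
    \<open>g\<close>; multiplying by \<open>x - m\<close> once more produces a square, so the order
    of \<open>x\<close> and \<open>m\<close> does not matter.\<close>
  have mvt: "(x - m) * (g x - g m) \<ge> - \<kappa> * (x - m)\<^sup>2" if x: "x \<in> {x1..x2}" for x
  proof -
    have "\<exists>z\<in>{x1..x2}. g x - g m = (x - m) * (2 * \<rho>'' z - c * \<rho>' z)"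
    proof (cases x m rule: linorder_cases)
      case less
      obtain z where z: "x < z" "z < m" "g m - g x = (m - x) * (2 * \<rho>'' z - c * \<rho>' z)"
        using MVT2[OF less, of g "\<lambda>x. 2 * \<rho>'' x - c * \<rho>' x", OF g'] x m by auto
      then have "g x - g m = (x - m) * (2 * \<rho>'' z - c * \<rho>' z)" by (simp add: algebra_simps)
      then show ?thesis using z x m by (intro bexI[of _ z]) auto
    next
      case greater
      obtain z where z: "m < z" "z < x" "g x - g m = (x - m) * (2 * \<rho>'' z - c * \<rho>' z)"
        using MVT2[OF greater, of g "\<lambda>x. 2 * \<rho>'' x - c * \<rho>' x", OF g'] x m by auto
      then show ?thesis using x m by (intro bexI[of _ z]) auto
    qed (use m in auto)
    then obtain z where z: "z \<in> {x1..x2}" "g x - g m = (x - m) * (2 * \<rho>'' z - c * \<rho>' z)" by blast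
    have "(x - m) * (g x - g m) = (2 * \<rho>'' z - c * \<rho>' z) * (x - m)\<^sup>2"
      unfolding z(2) by (simp add: power2_eq_square)
    then show ?thesis using mult_right_mono[OF kap[OF z(1) c], of "(x - m)\<^sup>2"] by simp
  qed
  define A where "A = (\<lambda>\<theta> \<phi>. (U \<theta> \<phi> - m)\<^sup>2 * sin \<theta>)"
  define B where "B = (\<lambda>\<theta> \<phi>. T \<theta> \<phi> * sin \<theta>)"
  define L where "L = (\<lambda>\<theta> \<phi>. (U \<theta> \<phi> - m) * sin \<theta>)"
  define R where "R = (\<lambda>\<theta> \<phi>. 1 * T \<theta> \<phi> / N \<theta> \<phi> * sin \<theta>
    + (- m + 1 * U \<theta> \<phi>) * ((2 * \<rho>' (U \<theta> \<phi>) * \<rho> (U \<theta> \<phi>) / N \<theta> \<phi> - c * \<rho> (U \<theta> \<phi>)) * sin \<theta>))"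
  \<comment> \<open>Pointwise form of the whole estimate. The term with \<open>L\<close> is the
    linear part \<open>g m * (U - m)\<close>, which integrates to zero by the choice of the
    mean.\<close>
  have le: "\<mu> * B \<theta> \<phi> + (- \<kappa> * A \<theta> \<phi> + g m * L \<theta> \<phi>) \<le> R \<theta> \<phi>" if \<theta>: "0 \<le> \<theta>" "\<theta> \<le> pi" for \<theta> \<phi>
  proof -
    define x where "x = U \<theta> \<phi>"
    define n where "n = N \<theta> \<phi>"
    define t where "t = T \<theta> \<phi>"
    have n: "n > 0" "n \<ge> \<rho> x" "n\<^sup>2 = (\<rho> x)\<^sup>2 + t" "\<rho> x > 0" "t \<ge> 0" "\<rho>' x \<ge> 0"
      using N_pos N_ge N_squared \<rho>U_pos \<rho>'nn by (auto simp: n_def x_def t_def T_def)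
    \<comment> \<open>From \<open>n\<^sup>2 - (\<rho> x)\<^sup>2 = t\<close> the defect
      \<open>n - \<rho> x\<close> is first order in \<open>t\<close>, hence quadratic in the
      gradient.\<close>
    have "(n - \<rho> x) * \<rho> x \<le> (n - \<rho> x) * (n + \<rho> x)"
      using n by (intro mult_left_mono) auto
    also have "\<dots> = t" using n(3) by (simp add: power2_eq_square algebra_simps)
    finally have nr: "n - \<rho> x \<le> t / \<rho> x" using n by (simp add: field_simps)
    have "(x - m) * (1 - \<rho> x / n) \<le> \<bar>x - m\<bar> * (t / \<rho> x / n)"
    proof -
      have "1 - \<rho> x / n = (n - \<rho> x) / n" using n by (simp add: field_simps)
      also have "\<dots> \<le> t / \<rho> x / n" using nr n by (intro divide_right_mono) auto
      finally have "1 - \<rho> x / n \<le> t / \<rho> x / n" .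
      moreover have "0 \<le> 1 - \<rho> x / n" using n by simp
      ultimately have "\<bar>x - m\<bar> * (1 - \<rho> x / n) \<le> \<bar>x - m\<bar> * (t / \<rho> x / n)"
        by (intro mult_left_mono) auto
      moreover have "(x - m) * (1 - \<rho> x / n) \<le> \<bar>x - m\<bar> * (1 - \<rho> x / n)"
        using \<open>0 \<le> 1 - \<rho> x / n\<close> by (intro mult_right_mono) auto
      ultimately show ?thesis by (rule order_trans[rotated])
    qed
    then have s1: "2 * \<rho>' x * ((x - m) * (1 - \<rho> x / n)) \<le> 2 * \<rho>' x * (\<bar>x - m\<bar> * (t / \<rho> x / n))"
      using n by (intro mult_left_mono) auto
    have "\<mu> * t \<le> (1 / n * (1 - 2 * \<rho>' x * \<bar>x - m\<bar> / \<rho> x)) * t"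
      using lam[of \<theta> \<phi>] n by (intro mult_right_mono) (auto simp: x_def m_def n_def)
    also have "\<dots> = t / n - 2 * \<rho>' x * (\<bar>x - m\<bar> * (t / \<rho> x / n))"
      using n by (simp add: field_simps)
    finally have s2: "\<mu> * t \<le> t / n - 2 * \<rho>' x * (\<bar>x - m\<bar> * (t / \<rho> x / n))" .
    have s3: "- \<kappa> * (x - m)\<^sup>2 + g m * (x - m) \<le> (x - m) * g x"
      using mvt[of x] J(1) by (simp add: x_def algebra_simps)
    have arith: "u + v \<le> w + z" if "z = y - p" "p \<le> q" "u \<le> w - q" "v \<le> y" for u v w y z p q :: real
      using that by linarith
    have "(x - m) * (2 * \<rho>' x * \<rho> x / n - c * \<rho> x) = (x - m) * g x - 2 * \<rho>' x * ((x - m) * (1 - \<rho> x / n))"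
      by (simp add: g_def algebra_simps)
    then have "\<mu> * t + (- \<kappa> * (x - m)\<^sup>2 + g m * (x - m)) \<le> t / n + (x - m) * (2 * \<rho>' x * \<rho> x / n - c * \<rho> x)"
      by (rule arith[OF _ s1 s2 s3])
    then have "(\<mu> * t + (- \<kappa> * (x - m)\<^sup>2 + g m * (x - m))) * sin \<theta>
      \<le> (t / n + (x - m) * (2 * \<rho>' x * \<rho> x / n - c * \<rho> x)) * sin \<theta>"
      using sin_ge_zero[OF \<theta>] by (rule mult_right_mono)
    also have "(\<mu> * t + (- \<kappa> * (x - m)\<^sup>2 + g m * (x - m))) * sin \<theta> = \<mu> * B \<theta> \<phi> + (- \<kappa> * A \<theta> \<phi> + g m * L \<theta> \<phi>)"
      by (simp only: A_def B_def L_def x_def t_def distrib_right mult.assoc)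
    also have "(t / n + (x - m) * (2 * \<rho>' x * \<rho> x / n - c * \<rho> x)) * sin \<theta> = R \<theta> \<phi>"
      by (simp only: R_def x_def t_def n_def distrib_right mult.assoc mult_1_left diff_conv_add_uminus add.commute)
    finally show ?thesis .
  qed
  have pc: "polar_continuous A" "polar_continuous B" "polar_continuous L" "polar_continuous R"
    "polar_continuous (\<lambda>\<theta> \<phi>. \<mu> * B \<theta> \<phi>)" "polar_continuous (\<lambda>\<theta> \<phi>. - \<kappa> * A \<theta> \<phi>)"
    "polar_continuous (\<lambda>\<theta> \<phi>. g m * L \<theta> \<phi>)" "polar_continuous (\<lambda>\<theta> \<phi>. - \<kappa> * A \<theta> \<phi> + g m * L \<theta> \<phi>)"
    "polar_continuous (\<lambda>\<theta> \<phi>. \<mu> * B \<theta> \<phi> + (- \<kappa> * A \<theta> \<phi> + g m * L \<theta> \<phi>))"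
    unfolding A_def B_def L_def R_def T_def polar_continuous_def case_prod_unfold
    by (intro continuous_intros; simp)+
  have "polar_integral (\<lambda>\<theta> \<phi>. \<mu> * B \<theta> \<phi> + (- \<kappa> * A \<theta> \<phi> + g m * L \<theta> \<phi>)) \<le> polar_integral R"
    by (rule polar_integral_mono) (use pc le in auto)
  also have "polar_integral R = 0" unfolding R_def T_def by (rule weak_cmc)
  also have "polar_integral (\<lambda>\<theta> \<phi>. \<mu> * B \<theta> \<phi> + (- \<kappa> * A \<theta> \<phi> + g m * L \<theta> \<phi>)) =
      \<mu> * polar_integral B + (- \<kappa> * polar_integral A + g m * polar_integral L)"
    by (simp only: polar_integral_add[OF pc(5) pc(8)] polar_integral_add[OF pc(6) pc(7)] polar_integral_cmult)
  also have "polar_integral L = 0" unfolding L_def m_def by (rule polar_integral_mean)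
  finally have 1: "\<mu> * polar_integral B \<le> \<kappa> * polar_integral A" by simp
  have "2 * polar_integral A \<le> polar_integral B"
    using poincare unfolding A_def B_def T_def m_def .
  then have "\<mu> * (2 * polar_integral A) \<le> \<mu> * polar_integral B" using lk by (intro mult_left_mono)
  with 1 have 2: "(2 * \<mu> - \<kappa>) * polar_integral A \<le> 0" by (simp add: algebra_simps)
  have A0: "0 \<le> A \<theta> \<phi>" if "0 \<le> \<theta>" "\<theta> \<le> pi" for \<theta> \<phi>
    using sin_ge_zero[OF that] by (simp add: A_def)
  have zero: "polar_continuous (\<lambda>\<theta> \<phi>. 0)" by (simp add: polar_continuous_def case_prod_unfold)
  have "polar_integral (\<lambda>\<theta> \<phi>. 0) \<le> polar_integral A"
    by (rule polar_integral_mono[OF zero pc(1)]) (simp add: A0)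
  then have "0 \<le> polar_integral A" by (simp add: polar_integral_def)
  moreover have "polar_integral A \<le> 0" using 2 lk by (simp add: mult_le_0_iff)
  ultimately have "polar_integral A = 0" by simp
  then have A_eq: "A \<theta> \<phi> = 0" if "0 \<le> \<theta>" "\<theta> \<le> pi" "0 \<le> \<phi>" "\<phi> \<le> 2 * pi" for \<theta> \<phi>
    using polar_integral_eq_0[OF pc(1) A0] that by blast
  have inner: "U \<theta> \<phi> = m" if "\<theta> \<in> {0<..<pi}" "0 \<le> \<phi>" "\<phi> \<le> 2 * pi" for \<theta> \<phi>
    using A_eq[of \<theta> \<phi>] sin_gt_zero[of \<theta>] that by (auto simp: A_def)
  \<comment> \<open>Vanishing of \<open>A\<close> gives the value only where
    \<open>sin \<theta>\<close> is positive; the poles follow by continuity.\<close>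
  have "U \<theta> \<phi> = m"
  proof (rule continuous_constant_on_closure[of "{0<..<pi}" "\<lambda>\<theta>. U \<theta> \<phi>"])
    show "continuous_on (closure {0<..<pi}) (\<lambda>\<theta>. U \<theta> \<phi>)" by (intro continuous_intros)
  qed (use inner assms in \<open>auto simp: closure_greaterThanLessThan\<close>)
  then show ?thesis by (simp add: m_def)
qed

end

section \<open>From the mean curvature formula to the divergence form, and the choice of
  constants\<close>

lemma flux_identity:
  fixes R S n :: real
  assumes R: "R > 0" and S: "S > 0" and n: "n > 0" "n\<^sup>2 = R\<^sup>2 + a\<^sup>2 + k\<^sup>2"
    and c: "c = - (((S * k)\<^sup>2 + R\<^sup>2 * S\<^sup>2) * (att - R * P - 2 * a\<^sup>2 * P / R)
        + (a\<^sup>2 + R\<^sup>2) * (S * kp - R * P * S\<^sup>2 + S * C * a - 2 * (S * k)\<^sup>2 * P / R)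
        - a * (S * k) * ((C * k + S * kt) + atp - 4 * a * (S * k) * P / R - 2 * (S * k) * C / S))
      / (R ^ 4 * S\<^sup>2 * (n / R) ^ 3)"
  shows "(C * a + S * att) / n - S * a * (R * P * a + a * att + k * kt) / n ^ 3
      + kp / n - k * (R * P * (S * k) + a * atp + k * kp) / n ^ 3
    = (2 * P * R / n - c * R) * S"
proof -
  \<comment> \<open>\<open>S * Z\<close> is the numerator of the curvature formula after inserting
    \<open>S * k\<close> for the coordinate derivative along the parallel, and
    \<open>Z / n ^ 3\<close> is the divergence minus \<open>2 * P * R * S / n\<close>. Both sides
    are thus compared through \<open>Z\<close>.\<close>
  define Z where "Z = S * (k\<^sup>2 + R\<^sup>2) * att + (a\<^sup>2 + R\<^sup>2) * (kp + C * a) - a * k * (S * kt + atp - C * k)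
    - S * R * P * (k\<^sup>2 + R\<^sup>2) - S * R * P * (a\<^sup>2 + R\<^sup>2) - 2 * S * P * R * (a\<^sup>2 + k\<^sup>2)"
  have "((S * k)\<^sup>2 + R\<^sup>2 * S\<^sup>2) * (att - R * P - 2 * a\<^sup>2 * P / R)
        + (a\<^sup>2 + R\<^sup>2) * (S * kp - R * P * S\<^sup>2 + S * C * a - 2 * (S * k)\<^sup>2 * P / R)
        - a * (S * k) * ((C * k + S * kt) + atp - 4 * a * (S * k) * P / R - 2 * (S * k) * C / S) = S * Z"
    unfolding Z_def using R S by (simp add: field_simps power2_eq_square)
  moreover have "R ^ 4 * S\<^sup>2 * (n / R) ^ 3 = R * S\<^sup>2 * n ^ 3"
    using R by (simp add: power_divide power4_eq_xxxx power3_eq_cube)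
  ultimately have "c = - (S * Z) / (R * S\<^sup>2 * n ^ 3)" using c by simp
  then have cRS: "c * R * S = - Z / n ^ 3" using R S by (simp add: power2_eq_square)
  have "(C * a + S * att) / n - S * a * (R * P * a + a * att + k * kt) / n ^ 3
      + kp / n - k * (R * P * (S * k) + a * atp + k * kp) / n ^ 3 - 2 * P * R * S / n
    = (n\<^sup>2 * (C * a + S * att + kp - 2 * P * R * S) - S * a * (R * P * a + a * att + k * kt)
        - k * (R * P * (S * k) + a * atp + k * kp)) / n ^ 3"
    using n(1) by (simp add: field_simps power2_eq_square power3_eq_cube)
  also have "n\<^sup>2 * (C * a + S * att + kp - 2 * P * R * S) - S * a * (R * P * a + a * att + k * kt)
        - k * (R * P * (S * k) + a * atp + k * kp) = Z"
    unfolding n(2) Z_def by (simp add: power2_eq_square algebra_simps)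
  finally show ?thesis using cRS by (simp add: left_diff_distrib)
qed

lemma isCont_box:
  fixes G :: "real \<times> real \<times> real \<Rightarrow> real"
  assumes "isCont G (a, b, c)" "G (a, b, c) > t"
  shows "\<exists>d>0. \<forall>x y z. \<bar>x - a\<bar> < d \<longrightarrow> \<bar>y - b\<bar> < d \<longrightarrow> \<bar>z - c\<bar> < d \<longrightarrow> G (x, y, z) > t"
proof -
  have "eventually (\<lambda>p. G p > t) (nhds (a, b, c))"
    using assms by (intro order_tendstoD(1)) (auto simp: isCont_def tendsto_at_iff_tendsto_nhds)
  then obtain e where e: "e > 0" "\<And>p. dist p (a, b, c) < e \<Longrightarrow> G p > t"
    unfolding eventually_nhds_metric by blast
  have "G (x, y, z) > t" if "\<bar>x - a\<bar> < e / 3" "\<bar>y - b\<bar> < e / 3" "\<bar>z - c\<bar> < e / 3" for x y z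
  proof (rule e(2))
    have "dist (x, y, z) (a, b, c) \<le> \<bar>x - a\<bar> + dist (y, z) (b, c)"
      unfolding dist_Pair_Pair[of x _ a] by (rule order_trans[OF sqrt_sum_squares_le_sum]) (auto simp: dist_real_def)
    also have "dist (y, z) (b, c) \<le> \<bar>y - b\<bar> + \<bar>z - c\<bar>"
      unfolding dist_Pair_Pair by (rule order_trans[OF sqrt_sum_squares_le_sum]) (auto simp: dist_real_def)
    finally show "dist (x, y, z) (a, b, c) < e" using that by linarith
  qed
  then show ?thesis using e(1) by (intro exI[of _ "e / 3"]) auto
qed

text \<open>At \<open>x = s\<close>, \<open>v = d = 0\<close> the three bounded quantities equal
  \<open>1 / R\<close>, \<open>2 * P / R\<close> and \<open>- 2 * (P\<^sup>2 - R * Q) / R\<close>,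
  and strict stability separates \<open>\<kappa>\<close> from \<open>2 * \<mu>\<close> there.
  Continuity preserves this nearby. The variable \<open>v\<close> stands for the squared gradient,
  \<open>d\<close> for the distance of \<open>u\<close> from its mean.\<close>

lemma strict_stability_neighbourhood:
  fixes \<rho> \<rho>' \<rho>'' :: "real \<Rightarrow> real"
  assumes cont: "isCont \<rho> s" "isCont \<rho>' s" "isCont \<rho>'' s"
    and pos: "\<rho> s > 0" "\<rho>' s > 0" and stable: "\<rho> s * \<rho>'' s - (\<rho>' s)\<^sup>2 > -1"
  obtains \<delta> \<epsilon> \<mu> \<kappa> c0 where "\<delta> > 0" "0 \<le> \<mu>" "\<kappa> < 2 * \<mu>"
    "\<And>x v d. \<bar>x - s\<bar> < \<delta> \<Longrightarrow> \<bar>v\<bar> < \<delta> \<Longrightarrow> \<bar>d\<bar> < \<delta> \<Longrightarrow>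
       \<mu> \<le> 1 / sqrt ((\<rho> x)\<^sup>2 + v) * (1 - 2 * \<rho>' x * d / \<rho> x)"
    "\<And>x v. \<bar>x - s\<bar> < \<delta> \<Longrightarrow> \<bar>v\<bar> < \<delta> \<Longrightarrow> \<bar>2 * \<rho>' x / sqrt ((\<rho> x)\<^sup>2 + v) - c0\<bar> \<le> \<epsilon>"
    "\<And>x c. \<bar>x - s\<bar> < \<delta> \<Longrightarrow> \<bar>c - c0\<bar> \<le> \<epsilon> \<Longrightarrow> 2 * \<rho>'' x - c * \<rho>' x \<ge> - \<kappa>"
    "\<And>x. \<bar>x - s\<bar> < \<delta> \<Longrightarrow> \<rho>' x \<ge> 0"
proof -
  define R where "R = \<rho> s"
  define P where "P = \<rho>' s"
  define Q where "Q = \<rho>'' s"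
  have R: "R > 0" using pos by (simp add: R_def)
  define gap where "gap = 1 - P\<^sup>2 + R * Q"
  have gap: "gap > 0" using stable by (simp add: gap_def R_def P_def Q_def)
  \<comment> \<open>The slack is spent three times, twice in \<open>2 * \<mu>\<close> and once in
    \<open>\<kappa>\<close>: \<open>2 * \<mu> - \<kappa> = 2 * gap / R - 3 * t\<close>, so half of
    \<open>gap / R\<close> is left. The minimum with 1 keeps \<open>\<mu>\<close>
    nonnegative.\<close>
  define t where "t = min gap 1 / (2 * R)"
  have t: "t > 0" "t \<le> gap / (2 * R)" "t \<le> 1 / (2 * R)"
    using gap R by (auto simp: t_def intro!: divide_right_mono)
  define c0 where "c0 = 2 * P / R"
  define \<mu> where "\<mu> = 1 / R - t"
  define \<kappa> where "\<kappa> = 2 * (P\<^sup>2 - R * Q) / R + t"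
  have \<mu>: "0 \<le> \<mu>"
  proof -
    have "1 / (2 * R) \<le> 1 / R" using R by (simp add: field_simps)
    then show ?thesis using t by (simp add: \<mu>_def)
  qed
  have \<kappa>: "\<kappa> < 2 * \<mu>"
  proof -
    have "2 * \<mu> - \<kappa> = 2 * (gap / R) - 3 * t"
      using R by (simp add: \<mu>_def \<kappa>_def gap_def field_simps)
    moreover have "3 * t \<le> 3 / 2 * (gap / R)" using t by simp
    moreover have "gap / R > 0" using gap R by simp
    ultimately show ?thesis by linarith
  qed
  have c: "isCont (\<lambda>p. f (fst p)) (s, 0 :: real, 0 :: real)" if "isCont f s" for f :: "real \<Rightarrow> real"
    by (rule isCont_o2[where f = fst and g = f]) (use that in \<open>simp_all add: isCont_fst\<close>)
  note c = c[OF cont(1)] c[OF cont(2)] c[OF cont(3)]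
  define G1 where "G1 = (\<lambda>p::real \<times> real \<times> real. 1 / sqrt ((\<rho> (fst p))\<^sup>2 + fst (snd p))
     * (1 - 2 * \<rho>' (fst p) * snd (snd p) / \<rho> (fst p)))"
  have "isCont G1 (s, 0, 0)"
    unfolding G1_def using pos by (intro continuous_intros c) auto
  moreover have "G1 (s, 0, 0) > \<mu>"
    using t R by (simp add: G1_def \<mu>_def R_def)
  ultimately obtain d1 where d1: "d1 > 0"
    "\<And>x y z. \<bar>x - s\<bar> < d1 \<Longrightarrow> \<bar>y - 0\<bar> < d1 \<Longrightarrow> \<bar>z - 0\<bar> < d1 \<Longrightarrow> G1 (x, y, z) > \<mu>"
    using isCont_box by metis
  define G3 where "G3 = (\<lambda>p::real \<times> real \<times> real. 2 * \<rho>'' (fst p) - (c0 + fst (snd p)) * \<rho>' (fst p))"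
  have "isCont G3 (s, 0, 0)"
    unfolding G3_def by (intro continuous_intros c)
  moreover have "G3 (s, 0, 0) > - \<kappa>"
  proof -
    have "G3 (s, 0, 0) = - \<kappa> + t"
      using R unfolding G3_def by (simp add: c0_def \<kappa>_def P_def[symmetric] Q_def[symmetric] field_simps power2_eq_square)
    then show ?thesis using t by simp
  qed
  ultimately obtain d3 where d3: "d3 > 0"
    "\<And>x y z. \<bar>x - s\<bar> < d3 \<Longrightarrow> \<bar>y - 0\<bar> < d3 \<Longrightarrow> \<bar>z - 0\<bar> < d3 \<Longrightarrow> G3 (x, y, z) > - \<kappa>"
    using isCont_box by metis
  \<comment> \<open>The order of choices matters: the tolerance for \<open>c\<close> comes from the
    bound with \<open>\<kappa>\<close>, and only then is the neighbourhood shrunk until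
    \<open>2 \<rho>' / N\<close> stays within that tolerance. Halving turns a strict bound into a
    weak one.\<close>
  define \<epsilon> where "\<epsilon> = d3 / 2"
  define G2 where "G2 = (\<lambda>p::real \<times> real \<times> real. \<epsilon> - \<bar>2 * \<rho>' (fst p) / sqrt ((\<rho> (fst p))\<^sup>2 + fst (snd p)) - c0\<bar>)"
  have "isCont G2 (s, 0, 0)"
    unfolding G2_def using pos by (intro continuous_intros c) auto
  moreover have "G2 (s, 0, 0) > 0"
    using R d3 by (simp add: G2_def c0_def P_def[symmetric] R_def[symmetric] \<epsilon>_def)
  ultimately obtain d2 where d2: "d2 > 0"
    "\<And>x y z. \<bar>x - s\<bar> < d2 \<Longrightarrow> \<bar>y - 0\<bar> < d2 \<Longrightarrow> \<bar>z - 0\<bar> < d2 \<Longrightarrow> G2 (x, y, z) > 0"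
    using isCont_box by metis
  define G4 where "G4 = (\<lambda>p::real \<times> real \<times> real. \<rho>' (fst p))"
  have "isCont G4 (s, 0, 0)" "G4 (s, 0, 0) > 0" unfolding G4_def using c pos by auto
  then obtain d4 where d4: "d4 > 0"
    "\<And>x y z. \<bar>x - s\<bar> < d4 \<Longrightarrow> \<bar>y - 0\<bar> < d4 \<Longrightarrow> \<bar>z - 0\<bar> < d4 \<Longrightarrow> G4 (x, y, z) > 0"
    using isCont_box by metis
  define \<delta> where "\<delta> = min (min d1 d2) (min d3 d4)"
  show thesis
  proof (rule that[of \<delta> \<mu> \<kappa> c0 \<epsilon>])
    show "\<mu> \<le> 1 / sqrt ((\<rho> x)\<^sup>2 + v) * (1 - 2 * \<rho>' x * d / \<rho> x)"
      if "\<bar>x - s\<bar> < \<delta>" "\<bar>v\<bar> < \<delta>" "\<bar>d\<bar> < \<delta>" for x v d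
      using d1(2)[of x v d] that by (simp add: \<delta>_def G1_def)
    show "\<bar>2 * \<rho>' x / sqrt ((\<rho> x)\<^sup>2 + v) - c0\<bar> \<le> \<epsilon>" if "\<bar>x - s\<bar> < \<delta>" "\<bar>v\<bar> < \<delta>" for x v
      using d2(2)[of x v 0] d2(1) that by (simp add: \<delta>_def G2_def)
    show "2 * \<rho>'' x - c * \<rho>' x \<ge> - \<kappa>" if "\<bar>x - s\<bar> < \<delta>" "\<bar>c - c0\<bar> \<le> \<epsilon>" for x c
      using d3(2)[of x "c - c0" 0] d3(1) that by (simp add: \<delta>_def G3_def \<epsilon>_def)
    show "\<rho>' x \<ge> 0" if "\<bar>x - s\<bar> < \<delta>" for x
      using d4(2)[of x 0 0] d4(1) that by (simp add: \<delta>_def G4_def)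
    show "\<delta> > 0" using d1 d2 d3 d4 by (simp add: \<delta>_def)
  qed (rule \<mu> \<kappa>)+
qed

section \<open>Functions on the sphere in spherical coordinates\<close>

lemma norm_sph [simp]: "norm (sph \<theta> \<phi>) = 1"
proof -
  have "(norm (sph \<theta> \<phi>))\<^sup>2 = (sin \<theta>)\<^sup>2 * (cos \<phi>)\<^sup>2 + (sin \<theta>)\<^sup>2 * (sin \<phi>)\<^sup>2 + (cos \<theta>)\<^sup>2"
    by (simp add: norm_eq_sqrt_inner inner_vec_def sum_3 sph_def power_mult_distrib
        power2_eq_square[symmetric])
  also have "\<dots> = (sin \<theta>)\<^sup>2 * ((cos \<phi>)\<^sup>2 + (sin \<phi>)\<^sup>2) + (cos \<theta>)\<^sup>2"
    by (simp only: distrib_left)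
  finally have "(norm (sph \<theta> \<phi>))\<^sup>2 = 1" by simp
  then show ?thesis by (simp add: power2_eq_1_iff) (metis norm_ge_zero not_one_le_zero neg_0_le_iff_le)
qed

lemma sph_nonzero [simp]: "sph \<theta> \<phi> \<noteq> 0"
  using norm_sph[of \<theta> \<phi>] by (metis norm_zero zero_neq_one)

lemma hom_ext_sph: "hom_ext u (sph \<theta> \<phi>) = u (sph \<theta> \<phi>)"
  by (simp add: hom_ext_def sgn_div_norm)

lemma sph_surj:
  assumes "x \<in> sphere 0 1"
  obtains \<theta> \<phi> where "0 \<le> \<theta>" "\<theta> \<le> pi" "0 \<le> \<phi>" "\<phi> \<le> 2 * pi" "x = sph \<theta> \<phi>"
proof -
  have "(norm x)\<^sup>2 = 1" using assms by simp
  then have 1: "(x $ 1)\<^sup>2 + (x $ 2)\<^sup>2 + (x $ 3)\<^sup>2 = 1"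
    by (simp add: norm_eq_sqrt_inner inner_vec_def sum_3 power2_eq_square)
  define \<theta> where "\<theta> = arccos (x $ 3)"
  have "(x $ 3)\<^sup>2 \<le> 1" using 1 by (smt (verit) zero_le_power2)
  then have x3: "- 1 \<le> x $ 3" "x $ 3 \<le> 1" by (auto simp: power2_le_iff_abs_le abs_le_iff abs_square_le_1)
  have \<theta>: "0 \<le> \<theta>" "\<theta> \<le> pi" "cos \<theta> = x $ 3"
    using x3 by (auto simp: \<theta>_def arccos_lbound arccos_ubound)
  have s: "sin \<theta> \<ge> 0" using \<theta> by (intro sin_ge_zero)
  have ss: "(sin \<theta>)\<^sup>2 = (x $ 1)\<^sup>2 + (x $ 2)\<^sup>2" using 1 \<theta>(3) by (simp add: sin_squared_eq)
  show thesis
  proof (cases "sin \<theta> = 0")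
    case True
    then have "x $ 1 = 0" "x $ 2 = 0" using ss by (auto simp: sum_power2_eq_zero_iff)
    then have "x = sph \<theta> 0" using \<theta> True by (simp add: sph_def vec_eq_iff forall_3)
    then show thesis using that[of \<theta> 0] \<theta> by simp
  next
    case False
    then have "(x $ 1 / sin \<theta>)\<^sup>2 + (x $ 2 / sin \<theta>)\<^sup>2 = 1"
      unfolding power_divide add_divide_distrib[symmetric] ss[symmetric] by simp
    then obtain \<phi> where \<phi>: "0 \<le> \<phi>" "\<phi> < 2 * pi" "x $ 1 / sin \<theta> = cos \<phi>" "x $ 2 / sin \<theta> = sin \<phi>"
      by (rule sincos_total_2pi)
    then have "x = sph \<theta> \<phi>" using False \<theta> by (simp add: sph_def vec_eq_iff forall_3 field_simps)
    then show thesis using that[of \<theta> \<phi>] \<theta> \<phi> by simp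
  qed
qed

lemma DERIV_sph_t:
  assumes "F differentiable at (sph \<theta> \<phi>)"
  shows "((\<lambda>\<theta>. F (sph \<theta> \<phi>)) has_real_derivative
    pd 1 F (sph \<theta> \<phi>) * (cos \<theta> * cos \<phi>) + pd 2 F (sph \<theta> \<phi>) * (cos \<theta> * sin \<phi>)
      - pd 3 F (sph \<theta> \<phi>) * sin \<theta>) (at \<theta>)"
proof -
  have "((\<lambda>\<theta>. sph \<theta> \<phi>) has_derivative
      (\<lambda>t. vector [t * (cos \<theta> * cos \<phi>), t * (cos \<theta> * sin \<phi>), t * - sin \<theta>])) (at \<theta>)"
    unfolding sph_def
    by (intro has_derivative_vector_3) (auto intro!: derivative_eq_intros simp: fun_eq_iff)
  from has_derivative_compose[OF this has_derivative_pd_sum[OF assms]]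
  show ?thesis
    unfolding has_field_derivative_def by (rule has_derivative_eq_rhs) (simp add: sum_3 fun_eq_iff algebra_simps)
qed

text \<open>The factor \<open>sin \<theta>\<close> is the length of the coordinate vector and stays
  outside; the other factor is the derivative along the unit vector and has no singularity at the
  poles.\<close>

lemma DERIV_sph_p:
  assumes "F differentiable at (sph \<theta> \<phi>)"
  shows "((\<lambda>\<phi>. F (sph \<theta> \<phi>)) has_real_derivative
    sin \<theta> * (pd 2 F (sph \<theta> \<phi>) * cos \<phi> - pd 1 F (sph \<theta> \<phi>) * sin \<phi>)) (at \<phi>)"
proof -
  have "((\<lambda>\<phi>. sph \<theta> \<phi>) has_derivative
      (\<lambda>t. vector [t * (- sin \<theta> * sin \<phi>), t * (sin \<theta> * cos \<phi>), 0])) (at \<phi>)"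
    unfolding sph_def
    by (intro has_derivative_vector_3) (auto intro!: derivative_eq_intros simp: fun_eq_iff)
  from has_derivative_compose[OF this has_derivative_pd_sum[OF assms]]
  show ?thesis
    unfolding has_field_derivative_def by (rule has_derivative_eq_rhs) (simp add: sum_3 fun_eq_iff algebra_simps)
qed

lemma differentiable_sph:
  fixes F :: "real ^ 3 \<Rightarrow> real" and q :: "real ^ 2"
  assumes "F differentiable at (sph (q $ 1) (q $ 2))"
  shows "(\<lambda>q. F (sph (q $ 1) (q $ 2))) differentiable at q"
proof -
  note n = has_derivative_vec_nth[where 'a = real and 'b = 2]
  have "\<exists>D. ((\<lambda>q :: real ^ 2. sph (q $ 1) (q $ 2)) has_derivative D) (at q)"
    unfolding sph_def
    by (rule exI, rule has_derivative_vector_3)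
      (rule derivative_eq_intros n DERIV_compose_FDERIV[OF DERIV_sin n] DERIV_compose_FDERIV[OF DERIV_cos n] refl)+
  then obtain D where D: "((\<lambda>q :: real ^ 2. sph (q $ 1) (q $ 2)) has_derivative D) (at q)" by blast
  show ?thesis
    using has_derivative_compose[OF D has_derivative_pd_sum[OF assms]] by (auto simp: differentiable_def)
qed

text \<open>Connects \<open>pd\<close>, used in the curvature formula, with the one-variable
  derivatives used for integration: a total derivative restricts to coordinate lines, and
  one-variable derivatives are unique.\<close>

lemma pd_polar:
  fixes W :: "real \<Rightarrow> real \<Rightarrow> real" and q :: "real ^ 2"
  assumes d: "(\<lambda>q. W (q $ 1) (q $ 2)) differentiable at q"
  shows "((\<lambda>\<theta>. W \<theta> (q $ 2)) has_real_derivative D) (at (q $ 1)) \<Longrightarrow> pd 1 (\<lambda>q. W (q $ 1) (q $ 2)) q = D"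
    and "((\<lambda>\<phi>. W (q $ 1) \<phi>) has_real_derivative D) (at (q $ 2)) \<Longrightarrow> pd 2 (\<lambda>q. W (q $ 1) (q $ 2)) q = D"
proof -
  let ?f = "\<lambda>q :: real ^ 2. W (q $ 1) (q $ 2)"
  have v: "vector [x, y] = x *\<^sub>R axis 1 1 + y *\<^sub>R (axis 2 1 :: real ^ 2)" for x y :: real
    by (simp add: vec_eq_iff forall_2 axis_def)
  have q: "vector [q $ 1, q $ 2] = q" by (simp add: vec_eq_iff forall_2)
  note f = has_derivative_pd_sum[OF d]
  have "((\<lambda>\<theta>. vector [\<theta>, q $ 2]) has_derivative (\<lambda>t. t *\<^sub>R (axis 1 1 :: real ^ 2))) (at (q $ 1))"
    unfolding v by (auto intro!: derivative_eq_intros)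
  from has_derivative_compose[OF this, of ?f "\<lambda>h. \<Sum>j\<in>UNIV. pd j ?f q * h $ j", unfolded q, OF f]
  have "((\<lambda>\<theta>. W \<theta> (q $ 2)) has_derivative (\<lambda>t. pd 1 ?f q * t)) (at (q $ 1))"
    by (simp add: sum_2 axis_def)
  then have "((\<lambda>\<theta>. W \<theta> (q $ 2)) has_real_derivative pd 1 ?f q) (at (q $ 1))"
    by (simp add: has_field_derivative_def)
  then show "((\<lambda>\<theta>. W \<theta> (q $ 2)) has_real_derivative D) (at (q $ 1)) \<Longrightarrow> pd 1 ?f q = D"
    by (rule DERIV_unique)
  have "((\<lambda>\<phi>. vector [q $ 1, \<phi>]) has_derivative (\<lambda>t. t *\<^sub>R (axis 2 1 :: real ^ 2))) (at (q $ 2))"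
    unfolding v by (auto intro!: derivative_eq_intros)
  from has_derivative_compose[OF this, of ?f "\<lambda>h. \<Sum>j\<in>UNIV. pd j ?f q * h $ j", unfolded q, OF f]
  have "((\<lambda>\<phi>. W (q $ 1) \<phi>) has_derivative (\<lambda>t. pd 2 ?f q * t)) (at (q $ 2))"
    by (simp add: sum_2 axis_def)
  then have "((\<lambda>\<phi>. W (q $ 1) \<phi>) has_real_derivative pd 2 ?f q) (at (q $ 2))"
    by (simp add: has_field_derivative_def)
  then show "((\<lambda>\<phi>. W (q $ 1) \<phi>) has_real_derivative D) (at (q $ 2)) \<Longrightarrow> pd 2 ?f q = D"
    by (rule DERIV_unique)
qed

lemma holder_imp_continuous_on:
  fixes f :: "'a::metric_space \<Rightarrow> real"
  assumes "0 < \<beta>" "\<And>x y. x \<in> S \<Longrightarrow> y \<in> S \<Longrightarrow> \<bar>f x - f y\<bar> \<le> C * dist x y powr \<beta>"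
  shows "continuous_on S f"
  unfolding continuous_on_def
proof
  fix x assume x: "x \<in> S"
  have "((\<lambda>y. dist y x) \<longlongrightarrow> 0) (at x within S)"
    by (rule tendsto_eq_intros refl)+ simp
  then have "((\<lambda>y. C * dist y x powr \<beta>) \<longlongrightarrow> C * 0) (at x within S)"
    using assms(1) by (intro tendsto_mult tendsto_const tendsto_zero_powrI[where b = \<beta>]) auto
  then have a: "((\<lambda>y. C * dist y x powr \<beta>) \<longlongrightarrow> 0) (at x within S)" by (simp only: mult_zero_right)
  have b: "eventually (\<lambda>y. norm (f y - f x) \<le> C * dist y x powr \<beta>) (at x within S)"
    using assms(2)[OF _ x] unfolding eventually_at_filter by (intro always_eventually) auto
  show "(f \<longlongrightarrow> f x) (at x within S)"
    by (rule LIM_zero_cancel) (rule Lim_null_comparison[OF b a])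
qed

text \<open>\<open>h\<close> stands for the 0-homogeneous extension. All polar derivatives are
  expressed by its Cartesian derivatives on the sphere, which do not see the poles; their continuity
  on the whole plane is therefore inherited by composition.\<close>

locale sphere_C2 =
  fixes h :: "real ^ 3 \<Rightarrow> real"
  assumes d1: "\<And>y. y \<noteq> 0 \<Longrightarrow> h differentiable at y"
    and d2: "\<And>j y. y \<noteq> 0 \<Longrightarrow> pd j h differentiable at y"
    and d2_cont: "\<And>i j. continuous_on (sphere 0 1) (pd i (pd j h))"
begin

definition U where "U \<theta> \<phi> = h (sph \<theta> \<phi>)"
definition G where "G j \<theta> \<phi> = pd j h (sph \<theta> \<phi>)"
definition H where "H i j \<theta> \<phi> = pd i (pd j h) (sph \<theta> \<phi>)"
definition Gt where "Gt j \<theta> \<phi> = H 1 j \<theta> \<phi> * (cos \<theta> * cos \<phi>) + H 2 j \<theta> \<phi> * (cos \<theta> * sin \<phi>) - H 3 j \<theta> \<phi> * sin \<theta>"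
definition Gp where "Gp j \<theta> \<phi> = sin \<theta> * (H 2 j \<theta> \<phi> * cos \<phi> - H 1 j \<theta> \<phi> * sin \<phi>)"
definition Ut where "Ut \<theta> \<phi> = G 1 \<theta> \<phi> * (cos \<theta> * cos \<phi>) + G 2 \<theta> \<phi> * (cos \<theta> * sin \<phi>) - G 3 \<theta> \<phi> * sin \<theta>"
definition k where "k \<theta> \<phi> = G 2 \<theta> \<phi> * cos \<phi> - G 1 \<theta> \<phi> * sin \<phi>"
definition Utt where "Utt \<theta> \<phi> = Gt 1 \<theta> \<phi> * (cos \<theta> * cos \<phi>) + Gt 2 \<theta> \<phi> * (cos \<theta> * sin \<phi>) - Gt 3 \<theta> \<phi> * sin \<theta>
  - G 1 \<theta> \<phi> * (sin \<theta> * cos \<phi>) - G 2 \<theta> \<phi> * (sin \<theta> * sin \<phi>) - G 3 \<theta> \<phi> * cos \<theta>"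
definition Utp where "Utp \<theta> \<phi> = Gp 1 \<theta> \<phi> * (cos \<theta> * cos \<phi>) + Gp 2 \<theta> \<phi> * (cos \<theta> * sin \<phi>) - Gp 3 \<theta> \<phi> * sin \<theta>
  - G 1 \<theta> \<phi> * (cos \<theta> * sin \<phi>) + G 2 \<theta> \<phi> * (cos \<theta> * cos \<phi>)"
definition kt where "kt \<theta> \<phi> = Gt 2 \<theta> \<phi> * cos \<phi> - Gt 1 \<theta> \<phi> * sin \<phi>"
definition kp where "kp \<theta> \<phi> = Gp 2 \<theta> \<phi> * cos \<phi> - Gp 1 \<theta> \<phi> * sin \<phi> - G 2 \<theta> \<phi> * sin \<phi> - G 1 \<theta> \<phi> * cos \<phi>"

lemma G_t: "((\<lambda>\<theta>. G j \<theta> \<phi>) has_real_derivative Gt j \<theta> \<phi>) (at \<theta>)"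
  and G_p: "((\<lambda>\<phi>. G j \<theta> \<phi>) has_real_derivative Gp j \<theta> \<phi>) (at \<phi>)"
  unfolding G_def Gt_def Gp_def H_def
  using DERIV_sph_t[OF d2[OF sph_nonzero]] DERIV_sph_p[OF d2[OF sph_nonzero]] by auto

lemma continuous_on_sph: "continuous_on S (\<lambda>x. sph (fst x) (snd x))"
unfolding sph_def vector_3_axis by (intro continuous_intros)

lemma continuous_on_h: "continuous_on (sphere 0 1) h" "continuous_on (sphere 0 1) (pd j h)"
proof -
  have "x \<noteq> 0" if "x \<in> sphere 0 1" for x :: "real ^ 3" using that by auto
  then show "continuous_on (sphere 0 1) h" "continuous_on (sphere 0 1) (pd j h)"
    using differentiable_imp_continuous_within[OF d1] differentiable_imp_continuous_within[OF d2]
    by (simp_all add: continuous_at_imp_continuous_on)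
qed

lemma continuous_on_UGH [continuous_intros]:
  "continuous_on S (\<lambda>x. U (fst x) (snd x))" "continuous_on S (\<lambda>x. G j (fst x) (snd x))"
  "continuous_on S (\<lambda>x. H i j (fst x) (snd x))"
  unfolding U_def G_def H_def
  by (rule continuous_on_compose2[OF continuous_on_h(1) continuous_on_sph]
      continuous_on_compose2[OF continuous_on_h(2) continuous_on_sph]
      continuous_on_compose2[OF d2_cont continuous_on_sph]; force)+

sublocale polar: sphere_function U Ut k Utt Utp kt kp
proof
  show "((\<lambda>\<theta>. U \<theta> \<phi>) has_real_derivative Ut \<theta> \<phi>) (at \<theta>)"
    "((\<lambda>\<phi>. U \<theta> \<phi>) has_real_derivative sin \<theta> * k \<theta> \<phi>) (at \<phi>)" for \<theta> \<phi>
    unfolding U_def Ut_def k_def G_def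
    using DERIV_sph_t[OF d1[OF sph_nonzero]] DERIV_sph_p[OF d1[OF sph_nonzero]] by auto
  show "((\<lambda>\<theta>. Ut \<theta> \<phi>) has_real_derivative Utt \<theta> \<phi>) (at \<theta>)" for \<theta> \<phi>
    unfolding Ut_def Utt_def by (auto intro!: derivative_eq_intros G_t simp: algebra_simps)
  show "((\<lambda>\<phi>. Ut \<theta> \<phi>) has_real_derivative Utp \<theta> \<phi>) (at \<phi>)" for \<theta> \<phi>
    unfolding Ut_def Utp_def by (auto intro!: derivative_eq_intros G_p simp: algebra_simps)
  show "((\<lambda>\<theta>. k \<theta> \<phi>) has_real_derivative kt \<theta> \<phi>) (at \<theta>)" for \<theta> \<phi>
    unfolding k_def kt_def by (auto intro!: derivative_eq_intros G_t simp: algebra_simps)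
  show "((\<lambda>\<phi>. k \<theta> \<phi>) has_real_derivative kp \<theta> \<phi>) (at \<phi>)" for \<theta> \<phi>
    unfolding k_def kp_def by (auto intro!: derivative_eq_intros G_p simp: algebra_simps)
  show "continuous_on UNIV (\<lambda>x. U (fst x) (snd x))" "continuous_on UNIV (\<lambda>x. Ut (fst x) (snd x))"
    "continuous_on UNIV (\<lambda>x. k (fst x) (snd x))" "continuous_on UNIV (\<lambda>x. Utt (fst x) (snd x))"
    "continuous_on UNIV (\<lambda>x. kt (fst x) (snd x))"
    unfolding Ut_def k_def Utt_def kt_def Gt_def by (intro continuous_intros)+
  show "U \<theta> (\<phi> + 2 * pi) = U \<theta> \<phi>" "Ut \<theta> (\<phi> + 2 * pi) = Ut \<theta> \<phi>" "k \<theta> (\<phi> + 2 * pi) = k \<theta> \<phi>" for \<theta> \<phi>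
    by (simp_all add: U_def Ut_def k_def G_def sph_def)
  show "U 0 \<phi> = U 0 0" "U pi \<phi> = U pi 0" for \<phi>
    by (simp_all add: U_def sph_def)
qed

lemma differentiable_U: "(\<lambda>q :: real ^ 2. U (q $ 1) (q $ 2)) differentiable at q"
  unfolding U_def by (rule differentiable_sph) (simp add: d1)

lemma differentiable_G: "(\<lambda>q :: real ^ 2. G j (q $ 1) (q $ 2)) differentiable at q"
  unfolding G_def by (rule differentiable_sph) (simp add: d2)

lemma differentiable_sin_cos_nth:
  "(\<lambda>q :: real ^ 2. sin (q $ n)) differentiable at q" "(\<lambda>q :: real ^ 2. cos (q $ n)) differentiable at q"
  using DERIV_compose_FDERIV[OF DERIV_sin has_derivative_vec_nth] DERIV_compose_FDERIV[OF DERIV_cos has_derivative_vec_nth]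
  unfolding differentiable_def by blast+

lemma differentiable_Ut: "(\<lambda>q :: real ^ 2. Ut (q $ 1) (q $ 2)) differentiable at q"
  unfolding Ut_def
  by (intro differentiable_add differentiable_diff differentiable_mult differentiable_G differentiable_sin_cos_nth)

lemma differentiable_sin_k: "(\<lambda>q :: real ^ 2. sin (q $ 1) * k (q $ 1) (q $ 2)) differentiable at q"
  unfolding k_def
  by (intro differentiable_add differentiable_diff differentiable_mult differentiable_G differentiable_sin_cos_nth)

lemma pd_U:
  "pd 1 (\<lambda>q :: real ^ 2. U (q $ 1) (q $ 2)) = (\<lambda>q. Ut (q $ 1) (q $ 2))"
  "pd 2 (\<lambda>q :: real ^ 2. U (q $ 1) (q $ 2)) = (\<lambda>q. sin (q $ 1) * k (q $ 1) (q $ 2))"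
  using pd_polar[OF differentiable_U] polar.U_t polar.U_p by (auto simp: fun_eq_iff)

lemma pd2_U:
  "pd 1 (\<lambda>q :: real ^ 2. Ut (q $ 1) (q $ 2)) q = Utt (q $ 1) (q $ 2)"
  "pd 2 (\<lambda>q :: real ^ 2. Ut (q $ 1) (q $ 2)) q = Utp (q $ 1) (q $ 2)"
  "pd 1 (\<lambda>q :: real ^ 2. sin (q $ 1) * k (q $ 1) (q $ 2)) q
    = cos (q $ 1) * k (q $ 1) (q $ 2) + sin (q $ 1) * kt (q $ 1) (q $ 2)"
  "pd 2 (\<lambda>q :: real ^ 2. sin (q $ 1) * k (q $ 1) (q $ 2)) q = sin (q $ 1) * kp (q $ 1) (q $ 2)"
proof -
  show "pd 1 (\<lambda>q :: real ^ 2. Ut (q $ 1) (q $ 2)) q = Utt (q $ 1) (q $ 2)"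
    by (rule pd_polar(1)[OF differentiable_Ut polar.Ut_t])
  show "pd 2 (\<lambda>q :: real ^ 2. Ut (q $ 1) (q $ 2)) q = Utp (q $ 1) (q $ 2)"
    by (rule pd_polar(2)[OF differentiable_Ut polar.Ut_p])
  show "pd 1 (\<lambda>q :: real ^ 2. sin (q $ 1) * k (q $ 1) (q $ 2)) q
    = cos (q $ 1) * k (q $ 1) (q $ 2) + sin (q $ 1) * kt (q $ 1) (q $ 2)"
    by (rule pd_polar(1)[OF differentiable_sin_k]) (auto intro!: derivative_eq_intros polar.k_t)
  show "pd 2 (\<lambda>q :: real ^ 2. sin (q $ 1) * k (q $ 1) (q $ 2)) q = sin (q $ 1) * kp (q $ 1) (q $ 2)"
    by (rule pd_polar(2)[OF differentiable_sin_k]) (auto intro!: derivative_eq_intros polar.k_p)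
qed

end

context sphere_C2
begin

text \<open>The curvature formula is applied with \<open>b = sin \<theta> * k\<close> and
  \<open>w = n / R\<close>. In the latter the factors \<open>sin \<theta>\<close> cancel, so
  \<open>n\<close> stays regular at the poles.\<close>

lemma cmc_flux:
  assumes \<rho>: "(\<rho> has_real_derivative P) (at (U \<theta> \<phi>))" and R: "\<rho> (U \<theta> \<phi>) > 0"
    and S: "0 < \<theta>" "\<theta> < pi"
    and c: "mean_curvature (warped_metric \<rho>) (\<lambda>q. vector [U (q $ 1) (q $ 2), q $ 1, q $ 2]) (vector [\<theta>, \<phi>]) = c"
  defines "n \<equiv> sqrt ((\<rho> (U \<theta> \<phi>))\<^sup>2 + (Ut \<theta> \<phi>)\<^sup>2 + (k \<theta> \<phi>)\<^sup>2)"
  shows "(cos \<theta> * Ut \<theta> \<phi> + sin \<theta> * Utt \<theta> \<phi>) / n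
        - sin \<theta> * Ut \<theta> \<phi> * (\<rho> (U \<theta> \<phi>) * P * Ut \<theta> \<phi>
            + Ut \<theta> \<phi> * Utt \<theta> \<phi> + k \<theta> \<phi> * kt \<theta> \<phi>) / n ^ 3
        + kp \<theta> \<phi> / n
        - k \<theta> \<phi> * (\<rho> (U \<theta> \<phi>) * P * (sin \<theta> * k \<theta> \<phi>)
            + Ut \<theta> \<phi> * Utp \<theta> \<phi> + k \<theta> \<phi> * kp \<theta> \<phi>) / n ^ 3
      = (2 * P * \<rho> (U \<theta> \<phi>) / n - c * \<rho> (U \<theta> \<phi>)) * sin \<theta>"
proof -
  let ?f = "\<lambda>q :: real ^ 2. U (q $ 1) (q $ 2)"
  let ?R = "\<rho> (U \<theta> \<phi>)" and ?a = "Ut \<theta> \<phi>" and ?k = "k \<theta> \<phi>" and ?S = "sin \<theta>"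
  let ?q = "vector [\<theta>, \<phi>] :: real ^ 2"
  have S0: "?S > 0" using S by (rule sin_gt_zero)
  have n: "n > 0" "n\<^sup>2 = ?R\<^sup>2 + ?a\<^sup>2 + ?k\<^sup>2"
    unfolding n_def using R by (auto intro!: real_sqrt_gt_zero add_pos_nonneg)
  have w: "n / ?R = sqrt (1 + ?a\<^sup>2 / ?R\<^sup>2 + (?S * ?k)\<^sup>2 / (?R\<^sup>2 * ?S\<^sup>2))"
  proof -
    have "1 + ?a\<^sup>2 / ?R\<^sup>2 + (?S * ?k)\<^sup>2 / (?R\<^sup>2 * ?S\<^sup>2) = (n / ?R)\<^sup>2"
      unfolding power_divide n(2) using R S0 by (simp add: power_mult_distrib add_divide_distrib)
    moreover have "n / ?R \<ge> 0" using n R by simp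
    ultimately show ?thesis by (simp only: real_sqrt_abs abs_of_nonneg)
  qed
  have f2: "pd a ?f differentiable at ?q" for a
    using exhaust_2[of a] differentiable_Ut differentiable_sin_k by (auto simp: pd_U)
  have "c = - (((?S * ?k)\<^sup>2 + ?R\<^sup>2 * ?S\<^sup>2) * (pd 1 (pd 1 ?f) ?q - ?R * P - 2 * ?a\<^sup>2 * P / ?R)
        + (?a\<^sup>2 + ?R\<^sup>2) * (pd 2 (pd 2 ?f) ?q - ?R * P * ?S\<^sup>2 + ?S * cos \<theta> * ?a - 2 * (?S * ?k)\<^sup>2 * P / ?R)
        - ?a * (?S * ?k) * (pd 1 (pd 2 ?f) ?q + pd 2 (pd 1 ?f) ?q - 4 * ?a * (?S * ?k) * P / ?R - 2 * (?S * ?k) * cos \<theta> / ?S))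
      / (?R ^ 4 * ?S\<^sup>2 * (n / ?R) ^ 3)"
    unfolding c[symmetric]
    by (rule mean_curvature_graph[OF differentiable_U f2 _ _ _ _ _ _ _ _ w])
      (use \<rho> R S0 in \<open>simp_all add: pd_U\<close>)
  then have c: "c = - (((?S * ?k)\<^sup>2 + ?R\<^sup>2 * ?S\<^sup>2) * (Utt \<theta> \<phi> - ?R * P - 2 * ?a\<^sup>2 * P / ?R)
        + (?a\<^sup>2 + ?R\<^sup>2) * (?S * kp \<theta> \<phi> - ?R * P * ?S\<^sup>2 + ?S * cos \<theta> * ?a - 2 * (?S * ?k)\<^sup>2 * P / ?R)
        - ?a * (?S * ?k) * ((cos \<theta> * ?k + ?S * kt \<theta> \<phi>) + Utp \<theta> \<phi> - 4 * ?a * (?S * ?k) * P / ?R - 2 * (?S * ?k) * cos \<theta> / ?S))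
      / (?R ^ 4 * ?S\<^sup>2 * (n / ?R) ^ 3)"
    by (simp only: pd_U pd2_U vector_2)
  show ?thesis by (rule flux_identity[OF R S0 n c])
qed

end

section \<open>Local rigidity\<close>

text \<open>Valid at points of non-differentiability too: both functions have the same derivatives,
  so the choice inside \<open>frechet_derivative\<close> is the same even if there are none.\<close>

lemma pd_diff_const: "pd j (\<lambda>y. f y - c) = pd j f"
proof
  fix p
  have "((\<lambda>y. f y - c) has_derivative D) (at p) \<longleftrightarrow> (f has_derivative D) (at p)" for D
  proof
    assume "((\<lambda>y. f y - c) has_derivative D) (at p)"
    from has_derivative_add[OF this has_derivative_const[of c]] show "(f has_derivative D) (at p)" by simp
  next
    assume "(f has_derivative D) (at p)"
    from has_derivative_diff[OF this has_derivative_const[of c]]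
    show "((\<lambda>y. f y - c) has_derivative D) (at p)" by simp
  qed
  then show "pd j (\<lambda>y. f y - c) p = pd j f p" by (simp add: pd_def frechet_derivative_def)
qed

lemma C2_holder_sphere_C2:
  assumes "C2_holder \<beta> u" "0 < \<beta>"
  shows "sphere_C2 (hom_ext u)"
proof
  obtain C where C: "\<And>i j x y. x \<in> sphere 0 1 \<Longrightarrow> y \<in> sphere 0 1 \<Longrightarrow>
      \<bar>pd i (pd j (hom_ext u)) x - pd i (pd j (hom_ext u)) y\<bar> \<le> C * dist x y powr \<beta>"
    using assms(1) unfolding C2_holder_def by blast
  show "continuous_on (sphere 0 1) (pd i (pd j (hom_ext u)))" for i j
    by (rule holder_imp_continuous_on[OF assms(2) C])
qed (use assms(1) in \<open>auto simp: C2_holder_def\<close>)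

text \<open>Each estimate keeps one summand of the norm, so all the others must be shown
  nonnegative. A real supremum is only meaningful for bounded sets: compactness of the sphere bounds
  the first three kinds, the Hoelder constant the last.\<close>

lemma C2_holder_norm_bounds:
  assumes u: "C2_holder \<beta> u" and \<beta>: "0 < \<beta>" and x: "x \<in> sphere 0 1"
  shows "\<bar>u x - s\<bar> \<le> C2_holder_norm \<beta> (\<lambda>x. u x - s)"
    "\<bar>pd j (hom_ext u) x\<bar> \<le> C2_holder_norm \<beta> (\<lambda>x. u x - s)"
proof -
  interpret sphere_C2 "hom_ext u" by (rule C2_holder_sphere_C2[OF u \<beta>])
  have he: "hom_ext (\<lambda>x. u x - s) = (\<lambda>y. hom_ext u y - s)" by (rule ext) (simp add: hom_ext_def)
  have bdd: "bdd_above ((\<lambda>x. \<bar>f x\<bar>) ` sphere 0 1)" if "continuous_on (sphere 0 1) f" for f :: "real ^ 3 \<Rightarrow> real"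
    using that by (intro bounded_imp_bdd_above compact_imp_bounded compact_continuous_image continuous_intros) auto
  have sup: "\<bar>f x\<bar> \<le> (SUP x\<in>sphere 0 1. \<bar>f x\<bar>)" if "continuous_on (sphere 0 1) f" for f :: "real ^ 3 \<Rightarrow> real"
    using x bdd[OF that] by (rule cSUP_upper)
  have sup0: "0 \<le> (SUP x\<in>sphere 0 1. \<bar>f x\<bar>)" if "continuous_on (sphere 0 1) f" for f :: "real ^ 3 \<Rightarrow> real"
    using sup[OF that] by linarith
  define T where "T = {(x :: real ^ 3, y). x \<in> sphere 0 1 \<and> y \<in> sphere 0 1 \<and> x \<noteq> y}"
  define g where "g = (\<lambda>i j (x, y). \<bar>pd i (pd j (hom_ext u)) x - pd i (pd j (hom_ext u)) y\<bar> / dist x y powr \<beta>)"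
  obtain C where C: "\<And>i j x y. x \<in> sphere 0 1 \<Longrightarrow> y \<in> sphere 0 1 \<Longrightarrow>
      \<bar>pd i (pd j (hom_ext u)) x - pd i (pd j (hom_ext u)) y\<bar> \<le> C * dist x y powr \<beta>"
    using u unfolding C2_holder_def by blast
  have supT: "0 \<le> (SUP p\<in>T. g i j p)" for i j
  proof -
    \<comment> \<open>Some pair of distinct points is needed for the supremum to range over a
      nonempty set.\<close>
    have "(axis 1 1, axis 2 1) \<in> T" by (auto simp: T_def axis_eq_axis)
    moreover have "bdd_above (g i j ` T)"
    proof (rule bdd_aboveI2)
      fix p assume "p \<in> T"
      then show "g i j p \<le> C"
        using C[of "fst p" "snd p" i j] by (auto simp: T_def g_def divide_le_eq split: prod.splits)
    qed
    ultimately have "g i j (axis 1 1, axis 2 1) \<le> (SUP p\<in>T. g i j p)" by (rule cSUP_upper)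
    moreover have "0 \<le> g i j (axis 1 1, axis 2 1)" by (simp add: g_def)
    ultimately show ?thesis by linarith
  qed
  have cu: "continuous_on (sphere 0 1) (\<lambda>x. u x - s)"
  proof -
    have "hom_ext u x = u x" if "x \<in> sphere 0 1" for x using that by (simp add: hom_ext_def sgn_div_norm)
    then have "continuous_on (sphere 0 1) u"
      using continuous_on_h(1) by (rule continuous_on_eq[rotated]) 
    then show ?thesis by (intro continuous_intros)
  qed
  define n0 where "n0 = (SUP x\<in>sphere 0 1. \<bar>u x - s\<bar>)"
  define n1 where "n1 = (\<lambda>j. SUP x\<in>sphere 0 1. \<bar>pd j (hom_ext u) x\<bar>)"
  define n2 where "n2 = (\<Sum>i\<in>UNIV. \<Sum>j\<in>UNIV. SUP x\<in>sphere 0 1. \<bar>pd i (pd j (hom_ext u)) x\<bar>)"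
  define n3 where "n3 = (\<Sum>i\<in>UNIV. \<Sum>j\<in>UNIV. SUP p\<in>T. g i j p)"
  have N: "C2_holder_norm \<beta> (\<lambda>x. u x - s) = n0 + (\<Sum>j\<in>UNIV. n1 j) + n2 + n3"
    unfolding C2_holder_norm_def he pd_diff_const n0_def n1_def n2_def n3_def T_def g_def by (rule refl)
  have n2: "n2 \<ge> 0" unfolding n2_def by (intro sum_nonneg sup0 d2_cont)
  have n3: "n3 \<ge> 0" unfolding n3_def by (intro sum_nonneg supT)
  have n1: "n1 j \<ge> 0" for j unfolding n1_def by (rule sup0[OF continuous_on_h(2)])
  then have n1s: "(\<Sum>j\<in>UNIV. n1 j) \<ge> 0" by (intro sum_nonneg)
  have n0: "n0 \<ge> 0" unfolding n0_def by (rule sup0[OF cu])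
  have "\<bar>u x - s\<bar> \<le> n0" unfolding n0_def by (rule sup[OF cu])
  then show "\<bar>u x - s\<bar> \<le> C2_holder_norm \<beta> (\<lambda>x. u x - s)" unfolding N using n2 n3 n1s by linarith
  have "\<bar>pd j (hom_ext u) x\<bar> \<le> n1 j" unfolding n1_def by (rule sup[OF continuous_on_h(2)])
  also have "n1 j \<le> (\<Sum>j\<in>UNIV. n1 j)" by (rule member_le_sum) (auto simp: n1)
  finally show "\<bar>pd j (hom_ext u) x\<bar> \<le> C2_holder_norm \<beta> (\<lambda>x. u x - s)" unfolding N using n2 n3 n0 by linarith
qed

lemma adss_metric_eq: "adss_metric K E shat = warped_metric (r_of_s K E shat)"
  by (rule ext) (simp add: adss_metric_def warped_metric_def)

lemma interval_integral_pos:
  fixes f :: "real \<Rightarrow> real"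
  assumes "a < b" "continuous_on {a..b} f" "\<And>x. x \<in> {a..b} \<Longrightarrow> f x > 0"
  shows "(LBINT x=ereal a..ereal b. f x) > 0"
proof -
  have eq: "(LBINT x=ereal a..ereal b. f x) = integral {a..b} f"
    using assms by (intro interval_integral_eq_integral borel_integrable_atLeastAtMost') auto
  have "integral {a..b} f \<ge> 0"
    using assms by (intro integral_nonneg integrable_continuous_real) (auto intro: less_imp_le)
  moreover have "integral {a..b} f \<noteq> 0"
  proof
    assume "integral {a..b} f = 0"
    then have "f a = 0"
      using integral_eq_0_iff[OF assms(2,1) less_imp_le[OF assms(3)]] assms(1) by simp
    then show False using assms(3)[of a] assms(1) by simp
  qed
  ultimately show ?thesis using eq by simp
qed

text \<open>For constant \<open>u\<close> the volume is \<open>4 * pi\<close> times the oriented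
  integral of the squared warping function from \<open>\<sigma>\<close> to \<open>m\<close>. The
  integrand is positive, so the integral vanishes only for equal endpoints.\<close>

lemma signed_volume_constant:
  assumes KE: "K > 0" "E > 0" and m: "shat < m" and \<sigma>: "shat < \<sigma>"
    and u: "\<And>x. x \<in> sphere 0 1 \<Longrightarrow> u x = m"
    and vol: "signed_volume K E shat \<sigma> u = 0"
  shows "m = \<sigma>"
proof (rule ccontr)
  assume ne: "m \<noteq> \<sigma>"
  define f where "f = (\<lambda>t. (r_of_s K E shat t)\<^sup>2)"
  have f_pos: "f t > 0" if "t > shat" for t
    using r_of_s_pos[OF KE that] by (simp add: f_def)
  have f_cont: "continuous_on {a..b} f" if "a > shat" for a b
    unfolding f_def
  proof (intro continuous_intros continuous_at_imp_continuous_on ballI)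
    fix x assume "x \<in> {a..b}"
    then show "isCont (r_of_s K E shat) x"
      using that by (intro DERIV_isCont[OF r_of_s_has_derivative[OF KE]]) auto
  qed
  have det: "sqrt (det (adss_metric K E shat (vector [t, \<theta>, \<phi>]))) = f t * \<bar>sin \<theta>\<bar>" for t \<theta> \<phi>
  proof -
    have "det (adss_metric K E shat (vector [t, \<theta>, \<phi>])) = (f t * sin \<theta>)\<^sup>2"
      by (simp add: adss_metric_def det_3 f_def power2_eq_square)
    then show ?thesis by (simp add: abs_mult f_def)
  qed
  define I where "I = (LBINT t=ereal \<sigma>..ereal m. f t)"
  have I: "I \<noteq> 0"
  proof (cases "\<sigma> < m")
    case True
    then show ?thesis
      using interval_integral_pos[OF True f_cont[OF \<sigma>]] f_pos \<sigma> by (force simp: I_def)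
  next
    case False
    with ne have "m < \<sigma>" by simp
    then have "(LBINT t=ereal m..ereal \<sigma>. f t) > 0"
      using m f_pos by (intro interval_integral_pos f_cont) auto
    then show ?thesis
      unfolding I_def by (subst interval_integral_endpoints_reverse) simp
  qed
  have "(LBINT \<theta>=ereal 0..ereal pi. \<bar>sin \<theta>\<bar>) = integral {0..pi} (\<lambda>\<theta>. \<bar>sin \<theta>\<bar>)"
    by (intro interval_integral_eq_integral borel_integrable_atLeastAtMost' continuous_intros) simp
  also have "\<dots> = integral {0..pi} sin"
    by (intro integral_cong) (simp add: sin_ge_zero)
  also have "\<dots> = 2" by (rule integral_sin_0_pi)
  finally have s: "(LBINT \<theta>=ereal 0..ereal pi. \<bar>sin \<theta>\<bar>) = 2" .
  have c: "(LBINT \<phi>=ereal 0..ereal (2 * pi). x) = 2 * pi * x" for x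
  proof -
    have "(LBINT \<phi>=ereal 0..ereal (2 * pi). x) = integral {0..2*pi} (\<lambda>\<phi>. x)"
      by (intro interval_integral_eq_integral borel_integrable_atLeastAtMost' continuous_intros) simp
    then show ?thesis by simp
  qed
  have "signed_volume K E shat \<sigma> u = 2 * pi * (I * 2)"
    unfolding signed_volume_def
    by (simp add: u det I_def[symmetric] c s mult.commute[of _ "\<bar>sin _\<bar>"] flip: s)
  then show False using vol I by simp
qed

theorem corollary4p1:
  fixes K E shat :: real
  assumes "K > 0" and "E > 0"
  shows "\<forall>s>shat. locally_rigid K E shat s"
proof (intro allI impI)
  fix s assume s: "s > shat"
  note KE = assms
  let ?\<rho> = "r_of_s K E shat"
  let ?\<rho>' = "\<lambda>x. psi K E (?\<rho> x)"
  let ?\<rho>'' = "\<lambda>x. K / (?\<rho> x)\<^sup>2 + E * ?\<rho> x"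
  note \<rho>_d = r_of_s_has_derivative[OF KE] and \<rho>'_d = warping_derivative_has_derivative[OF KE]
    and \<rho>_pos = r_of_s_pos[OF KE]
  have c: "isCont ?\<rho> s" "isCont ?\<rho>' s" "isCont ?\<rho>'' s"
  proof -
    show 1: "isCont ?\<rho> s" by (rule DERIV_isCont[OF \<rho>_d[OF s]])
    show "isCont ?\<rho>' s" by (rule DERIV_isCont[OF \<rho>'_d[OF s]])
    show "isCont ?\<rho>'' s" using 1 \<rho>_pos[OF s] by (intro continuous_intros) auto
  qed
  have pos: "?\<rho>' s > 0" using r_of_s_inverse(1)[OF KE s] by (rule psi_pos[OF KE])
  have stable: "?\<rho> s * ?\<rho>'' s - (?\<rho>' s)\<^sup>2 > -1"
    unfolding warping_identity[OF KE s] using KE \<rho>_pos[OF s] by simp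
  show "locally_rigid K E shat s"
  proof (rule strict_stability_neighbourhood[OF c \<rho>_pos[OF s] pos stable])
    fix \<delta> \<epsilon> \<mu> \<kappa> c0 assume \<delta>: "\<delta> > 0" and \<mu>: "0 \<le> \<mu>" "\<kappa> < 2 * \<mu>"
      and b1: "\<And>x v d. \<bar>x - s\<bar> < \<delta> \<Longrightarrow> \<bar>v\<bar> < \<delta> \<Longrightarrow> \<bar>d\<bar> < \<delta> \<Longrightarrow>
         \<mu> \<le> 1 / sqrt ((?\<rho> x)\<^sup>2 + v) * (1 - 2 * ?\<rho>' x * d / ?\<rho> x)"
      and b2: "\<And>x v. \<bar>x - s\<bar> < \<delta> \<Longrightarrow> \<bar>v\<bar> < \<delta> \<Longrightarrow> \<bar>2 * ?\<rho>' x / sqrt ((?\<rho> x)\<^sup>2 + v) - c0\<bar> \<le> \<epsilon>"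
      and b3: "\<And>x c. \<bar>x - s\<bar> < \<delta> \<Longrightarrow> \<bar>c - c0\<bar> \<le> \<epsilon> \<Longrightarrow> 2 * ?\<rho>'' x - c * ?\<rho>' x \<ge> - \<kappa>"
      and b4: "\<And>x. \<bar>x - s\<bar> < \<delta> \<Longrightarrow> ?\<rho>' x \<ge> 0"
    show "locally_rigid K E shat s"
      unfolding locally_rigid_def
    proof
      assume "bifurcation_point K E shat s"
      then obtain \<beta> \<sigma> u where \<beta>: "0 < \<beta>" and \<sigma>: "\<And>i::nat. shat < \<sigma> i"
        and u: "\<And>i. C2_holder \<beta> (u i)" "\<And>i x. x \<in> sphere 0 1 \<Longrightarrow> shat < u i x"
        and lim: "(\<lambda>i. C2_holder_norm \<beta> (\<lambda>x. u i x - s)) \<longlonglongrightarrow> 0"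
        and cmc: "\<And>i. cmc_graph K E shat (u i)" and vol: "\<And>i. signed_volume K E shat (\<sigma> i) (u i) = 0"
        and ne: "\<And>i. sphere_graph (u i) \<noteq> slice (\<sigma> i)"
        unfolding bifurcation_point_def by blast
      \<comment> \<open>With first derivatives below \<open>e\<close> one gets
        \<open>|Ut| \<le> 3 * e\<close> and \<open>|k| \<le> 2 * e\<close>, hence a squared gradient
        of at most \<open>13 * e * e\<close>; \<open>e \<le> 1\<close> and
        \<open>14 * e \<le> \<delta>\<close> bring this strictly below \<open>\<delta>\<close>. The
        last term keeps the surface away from the horizon.\<close>
      define e where "e = min (min 1 (\<delta> / 14)) ((s - shat) / 2)"
      have e: "e > 0" "e \<le> 1" "e \<le> \<delta> / 14" using \<delta> s by (auto simp: e_def)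
      have "e \<le> (s - shat) / 2" unfolding e_def by (rule min.cobounded2)
      then have "e < s - shat" using s by simp
      note e = e this
      have "eventually (\<lambda>i. C2_holder_norm \<beta> (\<lambda>x. u i x - s) < e) sequentially"
        using lim e(1) by (rule order_tendstoD)
      then obtain i where i: "C2_holder_norm \<beta> (\<lambda>x. u i x - s) < e"
        using eventually_happens by fastforce
      interpret S: sphere_C2 "hom_ext (u i)" by (rule C2_holder_sphere_C2[OF u(1) \<beta>])
      have sph: "sph \<theta> \<phi> \<in> sphere 0 1" for \<theta> \<phi> by simp
      have U: "S.U \<theta> \<phi> = u i (sph \<theta> \<phi>)" for \<theta> \<phi> by (simp add: S.U_def hom_ext_sph)
      have Us: "\<bar>S.U \<theta> \<phi> - s\<bar> < e" for \<theta> \<phi>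
        using C2_holder_norm_bounds(1)[OF u(1)[of i] \<beta> sph, of \<theta> \<phi> s] i unfolding U by linarith
      have G: "\<bar>S.G j \<theta> \<phi>\<bar> \<le> e" for j \<theta> \<phi>
        using C2_holder_norm_bounds(2)[OF u(1)[of i] \<beta> sph, of j \<theta> \<phi> s] i unfolding S.G_def by linarith
      have Gx: "\<bar>S.G j \<theta> \<phi> * y\<bar> \<le> e" if "\<bar>y\<bar> \<le> 1" for j \<theta> \<phi> y
        using mult_mono[OF G[of j \<theta> \<phi>] that] e by (simp add: abs_mult)
      have tri: "\<bar>sin x\<bar> \<le> 1" "\<bar>cos x\<bar> \<le> 1" "\<bar>cos x * sin y\<bar> \<le> 1" "\<bar>cos x * cos y\<bar> \<le> 1" for x y :: real
        using mult_le_one[OF abs_cos_le_one abs_ge_zero abs_sin_le_one, of x y]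
          mult_le_one[OF abs_cos_le_one abs_ge_zero abs_cos_le_one, of x y] by (simp_all add: abs_mult)
      have Ut: "\<bar>S.Ut \<theta> \<phi>\<bar> \<le> 3 * e" for \<theta> \<phi>
        using Gx[OF tri(4), of 1 \<theta> \<phi> \<theta> \<phi>] Gx[OF tri(3), of 2 \<theta> \<phi> \<theta> \<phi>] Gx[OF tri(1), of 3 \<theta> \<phi> \<theta>]
        unfolding S.Ut_def by linarith
      have k: "\<bar>S.k \<theta> \<phi>\<bar> \<le> 2 * e" for \<theta> \<phi>
        using Gx[OF tri(2), of 2 \<theta> \<phi> \<phi>] Gx[OF tri(1), of 1 \<theta> \<phi> \<phi>]
        unfolding S.k_def by linarith
      have v: "\<bar>(S.Ut \<theta> \<phi>)\<^sup>2 + (S.k \<theta> \<phi>)\<^sup>2\<bar> < \<delta>" for \<theta> \<phi>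
      proof -
        have "(S.Ut \<theta> \<phi>)\<^sup>2 \<le> (3 * e)\<^sup>2"
          by (subst power2_le_iff_abs_le) (use e Ut in auto)
        moreover have "(S.k \<theta> \<phi>)\<^sup>2 \<le> (2 * e)\<^sup>2"
          by (subst power2_le_iff_abs_le) (use e k in auto)
        moreover have "(3 * e)\<^sup>2 + (2 * e)\<^sup>2 = 13 * (e * e)" by (simp add: power2_eq_square)
        moreover have "e * e \<le> e * 1" using e by (intro mult_left_mono) auto
        ultimately have "(S.Ut \<theta> \<phi>)\<^sup>2 + (S.k \<theta> \<phi>)\<^sup>2 < \<delta>" using e by linarith
        then show ?thesis by simp
      qed
      obtain C where C: "\<And>A \<theta> \<phi>. rotation_matrix A \<Longrightarrow> 0 < \<theta> \<Longrightarrow> \<theta> < pi \<Longrightarrow>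
          mean_curvature (adss_metric K E shat) (graph_param (u i) A) (vector [\<theta>, \<phi>]) = C"
        using cmc[of i] unfolding cmc_graph_def by blast
      \<comment> \<open>The single chart for the identity frame is enough: it misses only the poles,
        and the argument uses the equation only in integrated form.\<close>
      have gp: "graph_param (u i) (mat 1) = (\<lambda>q. vector [S.U (q $ 1) (q $ 2), q $ 1, q $ 2])"
        by (simp add: graph_param_def fun_eq_iff U)
      have U_gt: "S.U \<theta> \<phi> > shat" for \<theta> \<phi> unfolding U by (rule u(2)[OF sph])
      interpret M: cmc_function S.U S.Ut S.k S.Utt S.Utp S.kt S.kp ?\<rho> ?\<rho>' ?\<rho>'' shat C
        "\<lambda>\<theta> \<phi>. sqrt ((?\<rho> (S.U \<theta> \<phi>))\<^sup>2 + (S.Ut \<theta> \<phi>)\<^sup>2 + (S.k \<theta> \<phi>)\<^sup>2)"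
      proof unfold_locales
        fix \<theta> \<phi> :: real assume \<theta>: "0 < \<theta>" "\<theta> < pi"
        have "rotation_matrix (mat 1 :: real ^ 3 ^ 3)"
          by (simp add: rotation_matrix_def orthogonal_matrix_id)
        from C[OF this \<theta>, of \<phi>]
        show "(cos \<theta> * S.Ut \<theta> \<phi> + sin \<theta> * S.Utt \<theta> \<phi>)
            / sqrt ((?\<rho> (S.U \<theta> \<phi>))\<^sup>2 + (S.Ut \<theta> \<phi>)\<^sup>2 + (S.k \<theta> \<phi>)\<^sup>2)
          - sin \<theta> * S.Ut \<theta> \<phi> * (?\<rho> (S.U \<theta> \<phi>) * ?\<rho>' (S.U \<theta> \<phi>) * S.Ut \<theta> \<phi>
              + S.Ut \<theta> \<phi> * S.Utt \<theta> \<phi> + S.k \<theta> \<phi> * S.kt \<theta> \<phi>)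
            / sqrt ((?\<rho> (S.U \<theta> \<phi>))\<^sup>2 + (S.Ut \<theta> \<phi>)\<^sup>2 + (S.k \<theta> \<phi>)\<^sup>2) ^ 3
          + S.kp \<theta> \<phi> / sqrt ((?\<rho> (S.U \<theta> \<phi>))\<^sup>2 + (S.Ut \<theta> \<phi>)\<^sup>2 + (S.k \<theta> \<phi>)\<^sup>2)
          - S.k \<theta> \<phi> * (?\<rho> (S.U \<theta> \<phi>) * ?\<rho>' (S.U \<theta> \<phi>) * (sin \<theta> * S.k \<theta> \<phi>)
              + S.Ut \<theta> \<phi> * S.Utp \<theta> \<phi> + S.k \<theta> \<phi> * S.kp \<theta> \<phi>)
            / sqrt ((?\<rho> (S.U \<theta> \<phi>))\<^sup>2 + (S.Ut \<theta> \<phi>)\<^sup>2 + (S.k \<theta> \<phi>)\<^sup>2) ^ 3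
        = (2 * ?\<rho>' (S.U \<theta> \<phi>) * ?\<rho> (S.U \<theta> \<phi>) / sqrt ((?\<rho> (S.U \<theta> \<phi>))\<^sup>2 + (S.Ut \<theta> \<phi>)\<^sup>2 + (S.k \<theta> \<phi>)\<^sup>2)
            - C * ?\<rho> (S.U \<theta> \<phi>)) * sin \<theta>"
          unfolding adss_metric_eq gp by (rule S.cmc_flux[OF \<rho>_d[OF U_gt] \<rho>_pos[OF U_gt] \<theta>])
      qed (use \<rho>_d \<rho>'_d \<rho>_pos U_gt in auto)
      define m where "m = S.polar.mean"
      have m: "s - e \<le> m" "m \<le> s + e"
        unfolding m_def using M.mean_bounds[of "s - e" "s + e"] Us by (auto simp: abs_less_iff algebra_simps less_imp_le)
      have const: "S.U \<theta> \<phi> = m" if "0 \<le> \<theta>" "\<theta> \<le> pi" "0 \<le> \<phi>" "\<phi> \<le> 2 * pi" for \<theta> \<phi>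
        unfolding m_def
      proof (rule M.cmc_imp_constant[where ?x1.0 = "s - e" and ?x2.0 = "s + e" and \<epsilon> = \<epsilon> and ?c0.0 = c0 and \<mu> = \<mu> and \<kappa> = \<kappa>])
        show "S.U \<theta> \<phi> \<in> {s - e..s + e}" for \<theta> \<phi> using Us[of \<theta> \<phi>] by (simp add: abs_less_iff)
        show "shat < s - e" using e by simp
        have x: "\<bar>S.U \<theta> \<phi> - s\<bar> < \<delta>" for \<theta> \<phi> using Us[of \<theta> \<phi>] e by simp
        show "\<bar>2 * ?\<rho>' (S.U \<theta> \<phi>) / sqrt ((?\<rho> (S.U \<theta> \<phi>))\<^sup>2 + (S.Ut \<theta> \<phi>)\<^sup>2 + (S.k \<theta> \<phi>)\<^sup>2) - c0\<bar> \<le> \<epsilon>" for \<theta> \<phi>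
          using b2[OF x v] by (simp only: add.assoc)
        \<comment> \<open>Both \<open>U\<close> and its mean lie within \<open>e\<close> of
          \<open>s\<close>, so they differ by less than \<open>2 * e\<close>.\<close>
        have d: "\<bar>\<bar>S.U \<theta> \<phi> - S.polar.mean\<bar>\<bar> < \<delta>" for \<theta> \<phi>
          using Us[of \<theta> \<phi>] m e unfolding m_def by linarith
        show "\<mu> \<le> 1 / sqrt ((?\<rho> (S.U \<theta> \<phi>))\<^sup>2 + (S.Ut \<theta> \<phi>)\<^sup>2 + (S.k \<theta> \<phi>)\<^sup>2)
            * (1 - 2 * ?\<rho>' (S.U \<theta> \<phi>) * \<bar>S.U \<theta> \<phi> - S.polar.mean\<bar> / ?\<rho> (S.U \<theta> \<phi>))" for \<theta> \<phi>
          using b1[OF x v d] by (simp only: add.assoc)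
        show "?\<rho>' (S.U \<theta> \<phi>) \<ge> 0" for \<theta> \<phi> by (rule b4[OF x])
        show "2 * ?\<rho>'' x - c * ?\<rho>' x \<ge> - \<kappa>" if "x \<in> {s - e..s + e}" "\<bar>c - c0\<bar> \<le> \<epsilon>" for x c
          using that e \<delta> by (intro b3) auto
      qed (use \<mu> that in auto)
      have um: "u i x = m" if "x \<in> sphere 0 1" for x
        using sph_surj[OF that] const U by metis
      have "m = \<sigma> i"
        using m e by (intro signed_volume_constant[OF KE _ \<sigma> um vol]) auto
      then have "sphere_graph (u i) = slice (\<sigma> i)"
        using um by (auto simp: sphere_graph_def slice_def)
      with ne show False by blast
    qed
  qed
qed

end
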